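(* Let $G = \mathrm{Isom}(\mathbb H^2) = \mathrm{PO}(2,1)$. Suppose $\mu$ is a probability measure on $\mathrm{Sub}_G$ which belongs to the closure, in the topology of weak convergence of measures on $\mathrm{Sub}_G$, of the set $\{\mu_P\}$ where $P$ ranges over all finite-volume Coxeter polygons in $\mathbb H^2$. Then for $\mu$-almost every subgroup $H \in \mathrm{Sub}_G$, $H$ is nontrivial and $H$ is generated by reflections.
   Context: $\mathrm{Sub}_G$ is the space of closed subgroups of $G$ with the Chabauty topology. A Coxeter polygon is a finite-area region of $\mathbb H^2$ bounded by finitely many geodesics such that each angle between adjacent sides is of the form $\pi/m$ for an integer $m\ge 2$. For such $P$, $\Gamma_P$ is the (discrete, finite covolume) subgroup of $G$ generated by the reflections in the sides of $P$, and $\mu_P$ is the $G$-invariant (under conjugation) probability measure on $\mathrm{Sub}_G$ supported on the conjugacy class of $\Gamma_P$, i.e. the pushforward of the $G$-invariant probability measure on $G/\Gamma_P$ under $g\Gamma_P \mapsto g\Gamma_P g^{-1}$. A reflection is an isometry of $\mathbb H^2$ of order 2 fixing a geodesic pointwise. *)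

theory Defs
  imports "HOL-Analysis.Analysis" "HOL-Probability.Probability" "HOL-Algebra.Generated_Groups"
begin

definition H2 :: "complex set" where
  "H2 = {z. Im z > 0}"

definition hdist :: "complex \<Rightarrow> complex \<Rightarrow> real" where
  "hdist z w = arcosh (1 + (cmod (z - w))\<^sup>2 / (2 * Im z * Im w))"

definition geodesic_lines :: "complex set set" where
  "geodesic_lines =
     {{z \<in> H2. Re z = a} | a. True} \<union>
     {{z \<in> H2. cmod (z - complex_of_real c) = r} | c r. r > 0}"

definition closed_halfplanes :: "complex set set" where
  "closed_halfplanes =
     {{z \<in> H2. Re z \<le> a} | a. True} \<union> {{z \<in> H2. Re z \<ge> a} | a. True} \<union>
     {{z \<in> H2. cmod (z - complex_of_real c) \<le> r} | c r. r > 0} \<union>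
     {{z \<in> H2. cmod (z - complex_of_real c) \<ge> r} | c r. r > 0}"

definition hp_boundary :: "complex set \<Rightarrow> complex set" where
  "hp_boundary h = h \<inter> closure (H2 - h)"

definition harea :: "complex set \<Rightarrow> ennreal" where
  "harea P = emeasure (density lborel (\<lambda>z::complex. ennreal (1 / (Im z)\<^sup>2))) P"

text \<open>Interior angle of a region P at a point v: the (Lebesgue) measure of the set of
  directions pointing into P from v.  The upper half-plane model is conformal, so this is
  the hyperbolic angle.\<close>
definition interior_angle :: "complex set \<Rightarrow> complex \<Rightarrow> real" where
  "interior_angle P v =
     measure lborel {\<phi> \<in> {0..<2*pi}. \<exists>\<epsilon>>0. \<forall>t\<in>{0<..<\<epsilon>}. v + complex_of_real t * cis \<phi> \<in> P}"

text \<open>Finite-area Coxeter polygons: finite intersections of closed half-planes, with nonempty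
  interior, every bounding geodesic contributing a side of positive length, finite area, and
  every angle at a vertex (a point of P on two distinct bounding geodesics) equal to pi/m
  with m an integer at least 2.\<close>
definition coxeter_polygon :: "complex set \<Rightarrow> complex set set \<Rightarrow> bool" where
  "coxeter_polygon P S \<longleftrightarrow>
     finite S \<and> S \<subseteq> closed_halfplanes \<and> P = H2 \<inter> \<Inter>S \<and> interior P \<noteq> {} \<and>
     (\<forall>h\<in>S. infinite (P \<inter> hp_boundary h)) \<and>
     harea P < \<infinity> \<and>
     (\<forall>v\<in>P. \<forall>h1\<in>S. \<forall>h2\<in>S.
        hp_boundary h1 \<noteq> hp_boundary h2 \<and> v \<in> hp_boundary h1 \<and> v \<in> hp_boundary h2 \<longrightarrow>
        (\<exists>m::nat. m \<ge> 2 \<and> interior_angle P v = pi / real m))"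

definition isom :: "(complex \<Rightarrow> complex) set" where
  "isom = {f. f ` H2 = H2 \<and> (\<forall>z\<in>H2. \<forall>w\<in>H2. hdist (f z) (f w) = hdist z w) \<and>
              (\<forall>z. z \<notin> H2 \<longrightarrow> f z = z)}"

definition IsomG :: "(complex \<Rightarrow> complex) monoid" where
  "IsomG = \<lparr>carrier = isom, mult = (\<circ>), one = id\<rparr>"

text \<open>Topology of G: pointwise convergence (coincides with the compact-open topology on isometries).\<close>
definition Gtop :: "(complex \<Rightarrow> complex) topology" where
  "Gtop = subtopology euclidean isom"

definition reflections :: "(complex \<Rightarrow> complex) set" where
  "reflections = {r \<in> isom. r \<noteq> id \<and> r \<circ> r = id \<and> (\<exists>l\<in>geodesic_lines. \<forall>z\<in>l. r z = z)}"

definition side_reflections :: "complex set set \<Rightarrow> (complex \<Rightarrow> complex) set" where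
  "side_reflections S = {r \<in> reflections. \<exists>h\<in>S. \<forall>z\<in>hp_boundary h. r z = z}"

definition Gamma :: "complex set set \<Rightarrow> (complex \<Rightarrow> complex) set" where
  "Gamma S = generate IsomG (side_reflections S)"

definition SubG :: "(complex \<Rightarrow> complex) set set" where
  "SubG = {H. subgroup H IsomG \<and> closedin Gtop H}"

definition chabauty :: "(complex \<Rightarrow> complex) set topology" where
  "chabauty = subtopology
     (topology_generated_by
        ({{H. H \<inter> K = {}} | K. compactin Gtop K} \<union> {{H. H \<inter> U \<noteq> {}} | U. openin Gtop U}))
     SubG"

definition borel_of :: "'a topology \<Rightarrow> 'a measure" where
  "borel_of T = sigma (topspace T) {U. openin T U}"

definition conj :: "(complex \<Rightarrow> complex) \<Rightarrow> (complex \<Rightarrow> complex) set \<Rightarrow> (complex \<Rightarrow> complex) set" where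
  "conj g H = (\<lambda>h. g \<circ> h \<circ> inv_into UNIV g) ` H"

definition prob_on_SubG :: "(complex \<Rightarrow> complex) set measure \<Rightarrow> bool" where
  "prob_on_SubG \<nu> \<longleftrightarrow> prob_space \<nu> \<and> space \<nu> = SubG \<and> sets \<nu> = sets (borel_of chabauty)"

text \<open>mu_P: the conjugation-invariant probability measure on Sub_G supported on the conjugacy
  class of Gamma_P (unique; we take the set of all such measures).\<close>
definition mu_P :: "complex set set \<Rightarrow> (complex \<Rightarrow> complex) set measure set" where
  "mu_P S = {\<nu>. prob_on_SubG \<nu> \<and>
               (\<forall>g\<in>isom. distr \<nu> \<nu> (conj g) = \<nu>) \<and>
               (AE H in \<nu>. \<exists>g\<in>isom. H = conj g (Gamma S))}"

definition coxeter_IRS :: "(complex \<Rightarrow> complex) set measure set" where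
  "coxeter_IRS = (\<Union>{mu_P S | P S. coxeter_polygon P S})"

definition weak_closure :: "(complex \<Rightarrow> complex) set measure set \<Rightarrow> (complex \<Rightarrow> complex) set measure set" where
  "weak_closure M = {\<nu>. prob_on_SubG \<nu> \<and>
     (\<forall>F. finite F \<and> (\<forall>f\<in>F. continuous_map chabauty euclideanreal f \<and> bounded (f ` SubG)) \<longrightarrow>
       (\<forall>\<epsilon>>0. \<exists>\<mu>\<in>M. \<forall>f\<in>F. \<bar>(\<integral>H. f H \<partial>\<nu>) - (\<integral>H. f H \<partial>\<mu>)\<bar> < \<epsilon>))}"

end

theory Submission
  imports Defs
begin

text \<open>Isometries are represented by real two by two matrices of determinant 1 or -1, and
  reflections are the traceless matrices of determinant -1. A measure in \<^const>\<open>mu_P\<close> lives on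
  closed subgroups, so the reflection groups that it charges are closed and countable, hence
  discrete by Baire's theorem. Almost every subgroup for the weak limit is a Chabauty limit of such
  discrete reflection groups.

  A limit H of discrete reflection groups is generated by reflections. The elements of the
  approximating groups are products of reflections along which the displacement of a base point
  decreases, so the partial products stay in a compact set and converge along subsequences. This
  suffices if the subgroup generated by the reflections in H is open in H, which is clear if H is
  discrete. Otherwise the small elements of H commute by Zassenhaus' argument, and they are products
  of two reflections in H.

  That almost every H contains a reflection follows by mass transport. By a linear isoperimetric
  inequality, the base point is at distance more than r from all mirrors with probability at most
  \<open>e\<^sup>-\<^sup>r\<close>, uniformly in the polygon, and this bound passes to the limit.\<close>

section \<open>Two by two matrices of determinant 1 and -1\<close>

text \<open>Neither Poincare's polygon theorem nor a tiling of the plane by copies of the polygon is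
  used: tiles are cut out by all mirrors of the group, and it suffices that the tile of a point at
  positive distance from all mirrors is carried into the polygon by an isometry. The norm of a
  matrix M satisfies norm^2 = 2 cosh d(i, M i). That every element descends to the identity is
  proved as confluence of a rewriting system: multiply on the left by a reflection that lowers the
  norm. Discreteness makes it terminate. Two competing steps involve two mirrors, and the
  concurrent, asymptotic and ultraparallel cases are treated together, by a linear recurrence for
  the signed heights over the mirrors of the dihedral group that they generate. The rate of decay
  comes from the dilation of the half-plane: a point at distance more than ln E from all mirrors can
  be lowered by the factor E without leaving its tile, and lowering multiplies area by E. As heights
  over mirrors are 2 sinh of a distance, the threshold appears as E - 1/E = 2 sinh (ln E).\<close>

type_synonym mat2 = "real \<times> real \<times> real \<times> real"

fun mmul :: "mat2 \<Rightarrow> mat2 \<Rightarrow> mat2" (infixl "\<odot>" 70) where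
  "(a, b, c, d) \<odot> (a', b', c', d') =
     (a * a' + b * c', a * b' + b * d', c * a' + d * c', c * b' + d * d')"

fun mdet :: "mat2 \<Rightarrow> real" where "mdet (a, b, c, d) = a * d - b * c"

fun mtr :: "mat2 \<Rightarrow> real" where "mtr (a, b, c, d) = a + d"

definition mone :: mat2 where "mone = (1, 0, 0, 1)"

text \<open>A determinant of 1 or -1 is its own inverse, so multiplying the adjugate by it inverts
  both kinds of matrices without a division.\<close>

fun minv :: "mat2 \<Rightarrow> mat2" where
  "minv (a, b, c, d) = mdet (a, b, c, d) *\<^sub>R (d, - b, - c, a)"

definition unimod :: "mat2 set" where "unimod = {M. mdet M = 1 \<or> mdet M = - 1}"

definition refl_mat :: "mat2 \<Rightarrow> bool" where "refl_mat R \<longleftrightarrow> mtr R = 0 \<and> mdet R = - 1"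

lemma mmul_assoc: "A \<odot> B \<odot> C = A \<odot> (B \<odot> C)"
  by (cases A; cases B; cases C) (simp add: algebra_simps)

lemma mmul_one [simp]: "mone \<odot> M = M" "M \<odot> mone = M"
  by (cases M; simp add: mone_def)+

lemma mmul_minus [simp]: "(- A) \<odot> B = - (A \<odot> B)" "A \<odot> (- B) = - (A \<odot> B)"
  by (cases A; cases B; simp)+

lemma mmul_distrib: "A \<odot> (B + C) = A \<odot> B + A \<odot> C" "(A + B) \<odot> C = A \<odot> C + B \<odot> C"
    "A \<odot> (B - C) = A \<odot> B - A \<odot> C" "(A - B) \<odot> C = A \<odot> C - B \<odot> C"
  by (cases A; cases B; cases C; simp add: algebra_simps)+

lemma mmul_scaleR [simp]: "(t *\<^sub>R A) \<odot> B = t *\<^sub>R (A \<odot> B)" "A \<odot> (t *\<^sub>R B) = t *\<^sub>R (A \<odot> B)"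
  by (cases A; cases B; simp add: algebra_simps)+

lemma mdet_mul [simp]: "mdet (A \<odot> B) = mdet A * mdet B"
  by (cases A; cases B) (simp add: algebra_simps)

lemma mdet_simps [simp]: "mdet mone = 1" "mdet (- A) = mdet A"
  by (simp add: mone_def, cases A, simp)

lemma mtr_linear [simp]: "mtr (A + B) = mtr A + mtr B" "mtr (A - B) = mtr A - mtr B"
    "mtr (- A) = - mtr A" "mtr (t *\<^sub>R A) = t * mtr A" "mtr mone = 2"
  by (cases A; cases B; simp add: algebra_simps mone_def)+

lemma mtr_commute: "mtr (A \<odot> B) = mtr (B \<odot> A)"
  by (cases A; cases B) simp

lemma unimodD: "M \<in> unimod \<Longrightarrow> mdet M * mdet M = 1"
  by (auto simp: unimod_def)

lemma minv_mul [simp]: "M \<in> unimod \<Longrightarrow> minv M \<odot> M = mone" "M \<in> unimod \<Longrightarrow> M \<odot> minv M = mone"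
proof -
  assume "M \<in> unimod"
  then have *: "mdet M * mdet M = 1" by (rule unimodD)
  obtain a b c d where M: "M = (a, b, c, d)" by (cases M)
  have 1: "minv M \<odot> M = (mdet M * mdet M) *\<^sub>R mone" "M \<odot> minv M = (mdet M * mdet M) *\<^sub>R mone"
    unfolding M mone_def by (simp_all add: algebra_simps)
  show "minv M \<odot> M = mone" "M \<odot> minv M = mone"
    unfolding 1 * by simp_all
qed

lemma unimod_simps [simp]: "mone \<in> unimod" "- M \<in> unimod \<longleftrightarrow> M \<in> unimod"
  by (auto simp: unimod_def)

lemma unimod_mul [simp]: "A \<in> unimod \<Longrightarrow> B \<in> unimod \<Longrightarrow> A \<odot> B \<in> unimod"
  by (auto simp: unimod_def)

lemma mdet_minv: "M \<in> unimod \<Longrightarrow> mdet (minv M) = mdet M"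
proof -
  assume "M \<in> unimod"
  then have *: "mdet M * mdet M = 1" by (rule unimodD)
  obtain a b c d where M: "M = (a, b, c, d)" by (cases M)
  have "mdet (minv M) = mdet M * mdet M * mdet M"
    unfolding M by simp algebra
  then show ?thesis using * by simp
qed

lemma minv_unimod [simp]: "M \<in> unimod \<Longrightarrow> minv M \<in> unimod"
  using mdet_minv by (auto simp: unimod_def)

lemma mmul_cancel [simp]: "M \<in> unimod \<Longrightarrow> minv M \<odot> (M \<odot> A) = A" "M \<in> unimod \<Longrightarrow> M \<odot> (minv M \<odot> A) = A"
  by (simp_all flip: mmul_assoc)

lemma minv_unique: "M \<in> unimod \<Longrightarrow> A \<odot> M = mone \<Longrightarrow> A = minv M"
  by (metis minv_mul(2) mmul_assoc mmul_one)

lemma minv_simps [simp]: "minv mone = mone" "minv (- M) = - minv M"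
  by (simp add: mone_def) (cases M, simp)

lemma minv_mmul: "A \<in> unimod \<Longrightarrow> B \<in> unimod \<Longrightarrow> minv (A \<odot> B) = minv B \<odot> minv A"
  by (rule minv_unique[symmetric]) (auto simp: mmul_assoc)

lemma minv_minv [simp]: "M \<in> unimod \<Longrightarrow> minv (minv M) = M"
  by (rule minv_unique[symmetric]) auto

lemma refl_mat_unimod [simp]: "refl_mat R \<Longrightarrow> R \<in> unimod"
  by (auto simp: refl_mat_def unimod_def)

lemma refl_mat_minus [simp]: "refl_mat (- R) \<longleftrightarrow> refl_mat R"
  by (auto simp: refl_mat_def)

lemma refl_mat_iff: "refl_mat (a, b, c, d) \<longleftrightarrow> a = - d \<and> d * d + b * c = 1"
  by (auto simp: refl_mat_def; algebra)

lemma refl_mat_sq [simp]: "refl_mat R \<Longrightarrow> R \<odot> R = mone"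
proof -
  assume R: "refl_mat R"
  obtain a b c d where [simp]: "R = (a, b, c, d)" by (cases R)
  have "a = - d" "d * d + b * c = 1" using R by (auto simp: refl_mat_iff)
  then show ?thesis unfolding mone_def by simp algebra
qed

lemma refl_mat_cancel [simp]: "refl_mat R \<Longrightarrow> R \<odot> (R \<odot> A) = A"
  by (simp flip: mmul_assoc)

lemma refl_mat_minv: "refl_mat R \<Longrightarrow> minv R = R"
  by (metis minv_unique refl_mat_sq refl_mat_unimod)

lemma refl_mat_conj:
  assumes "refl_mat R" "K \<in> unimod"
  shows "refl_mat (minv K \<odot> R \<odot> K)"
proof -
  have "mtr (minv K \<odot> R \<odot> K) = mtr (K \<odot> (minv K \<odot> R))" by (rule mtr_commute)
  then show ?thesis using assms unimodD[OF assms(2)] by (auto simp: refl_mat_def mdet_minv)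
qed

text \<open>Polarised Cayley-Hamilton: traceless matrices satisfy R X + X R = tr (R X) 1. Multiply
  by \<open>R\<close>, whose square is 1. Up to sign, this is the orthogonal reflection of the
  vector \<open>X\<close> along the normal \<open>R\<close>.\<close>

lemma refl_mat_sandwich:
  assumes "refl_mat R" "mtr X = 0"
  shows "R \<odot> X \<odot> R = mtr (R \<odot> X) *\<^sub>R R - X"
proof -
  obtain a b c d where R: "R = (a, b, c, d)" by (cases R)
  obtain a' b' c' d' where X: "X = (a', b', c', d')" by (cases X)
  have "a = - d" "d' = - a'" "d * d + b * c = 1" using assms unfolding R X by (auto simp: refl_mat_iff)
  then show ?thesis unfolding R X by simp algebra
qed

section \<open>The norm and the heights over walls\<close>

lemma norm_mat2: "(norm (a, b, c, d :: real))\<^sup>2 = a\<^sup>2 + b\<^sup>2 + c\<^sup>2 + d\<^sup>2"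
  for a b c :: real
  by (simp add: norm_Pair)

lemma norm_mmul: "norm (A \<odot> B) \<le> norm A * norm B"
proof -
  obtain a b c d where A: "A = (a, b, c, d)" by (cases A)
  obtain e f g h where B: "B = (e, f, g, h)" by (cases B)
  have CS: "(x * u + y * v)\<^sup>2 \<le> (x\<^sup>2 + y\<^sup>2) * (u\<^sup>2 + v\<^sup>2)" for x y u v :: real
    using zero_le_power2[of "x * v - y * u"] by (simp add: power2_eq_square algebra_simps)
  have "(norm (A \<odot> B))\<^sup>2 \<le> (norm A * norm B)\<^sup>2"
    unfolding A B power_mult_distrib norm_mat2 mmul.simps
    using CS[of a e b g] CS[of a f b h] CS[of c e d g] CS[of c f d h]
    by (simp add: algebra_simps)
  then show ?thesis by (rule power2_le_imp_le) simp
qed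

lemma norm_minv: "M \<in> unimod \<Longrightarrow> norm (minv M) = norm M"
proof -
  assume "M \<in> unimod"
  then have *: "mdet M * mdet M = 1" by (rule unimodD)
  obtain a b c d where M: "M = (a, b, c, d)" by (cases M)
  have "(norm (minv M))\<^sup>2 = (norm M)\<^sup>2"
    using * unfolding M minv.simps norm_scaleR power_mult_distrib norm_mat2
    by (simp add: power2_eq_square)
  then show ?thesis by simp
qed

lemma norm_mone: "norm mone = sqrt 2"
  by (simp add: mone_def norm_Pair)

text \<open>norm^2 - 2 is the sum of squares (a - d)^2 + (b + c)^2 for determinant 1 and (a + d)^2 +
  (b - c)^2 for determinant -1. The bound is attained at \<open>mone\<close>, so no reflection
  lowers the norm of the identity, which is where a descent ends.\<close>

lemma norm_unimod_ge:
  assumes "M \<in> unimod" shows "norm M \<ge> sqrt 2"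
proof (rule power2_le_imp_le)
  obtain a b c d where M: "M = (a, b, c, d)" by (cases M)
  have "a * d - b * c = 1 \<or> a * d - b * c = - 1" using assms by (simp add: M unimod_def)
  then show "(sqrt 2)\<^sup>2 \<le> (norm M)\<^sup>2"
    using zero_le_power2[of "a - d"] zero_le_power2[of "b + c"]
      zero_le_power2[of "a + d"] zero_le_power2[of "b - c"]
    unfolding M norm_mat2 by (auto simp: power2_eq_square algebra_simps)
qed simp

lemma tendsto_mmul: "(f \<longlongrightarrow> A) F \<Longrightarrow> (g \<longlongrightarrow> B) F \<Longrightarrow> ((\<lambda>x. f x \<odot> g x) \<longlongrightarrow> A \<odot> B) F"
proof -
  have eq: "A \<odot> B = (fst A * fst B + fst (snd A) * fst (snd (snd B)),
      fst A * fst (snd B) + fst (snd A) * snd (snd (snd B)),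
      fst (snd (snd A)) * fst B + snd (snd (snd A)) * fst (snd (snd B)),
      fst (snd (snd A)) * fst (snd B) + snd (snd (snd A)) * snd (snd (snd B)))" for A B
    by (cases A; cases B) simp
  assume "(f \<longlongrightarrow> A) F" "(g \<longlongrightarrow> B) F"
  then show ?thesis unfolding eq by (intro tendsto_intros)
qed

text \<open>For a reflection matrix A this is \<open>2 sinh\<close> of the signed distance from the axis of A to the image
  of \<open>\<i>\<close> under M.\<close>
fun hgt :: "mat2 \<Rightarrow> mat2 \<Rightarrow> real" where
  "hgt (a, b, c, d) (a', b', c', d') =
     c * (a'\<^sup>2 + b'\<^sup>2) + (d - a) * (a' * c' + b' * d') - b * (c'\<^sup>2 + d'\<^sup>2)"

lemma hgt_linear [simp]: "hgt (A - B) M = hgt A M - hgt B M" "hgt (t *\<^sub>R A) M = t * hgt A M"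
    "hgt (- A) M = - hgt A M" "hgt A (- M) = hgt A M"
  by (cases A; cases B; cases M; simp add: algebra_simps)+

lemma hgt_mone [simp]: "hgt (a, b, c, d) mone = c - b"
  by (simp add: mone_def)

text \<open>Since the squared norm is 2 cosh of the displacement of i, this is a sign rule:
  \<open>R\<close> brings the image of i under \<open>M\<close> closer to i exactly when its mirror
  separates the two points. Every descent step rests on it.\<close>

lemma norm_refl_mmul:
  assumes "refl_mat R"
  shows "(norm (R \<odot> M))\<^sup>2 = (norm M)\<^sup>2 + hgt R mone * hgt R M"
proof -
  obtain a b c d where R: "R = (a, b, c, d)" by (cases R)
  obtain a' b' c' d' where M: "M = (a', b', c', d')" by (cases M)
  have "a = - d" "d * d + b * c = 1" using assms unfolding R by (auto simp: refl_mat_iff)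
  then show ?thesis unfolding R M hgt_mone mmul.simps norm_mat2 hgt.simps by algebra
qed

lemma hgt_refl:
  assumes "refl_mat R"
  shows "hgt R (R \<odot> M) = - hgt R M"
proof -
  obtain a b c d where R: "R = (a, b, c, d)" by (cases R)
  obtain a' b' c' d' where M: "M = (a', b', c', d')" by (cases M)
  have "a = - d" "d * d + b * c = 1" using assms unfolding R by (auto simp: refl_mat_iff)
  then show ?thesis unfolding R M mmul.simps hgt.simps by algebra
qed

section \<open>Walls under conjugation, and pairs of walls\<close>

lemma hgt_conj:
  assumes "K \<in> unimod"
  shows "hgt (minv K \<odot> R \<odot> K) M = mdet K * hgt R (K \<odot> M)"
proof -
  obtain a b c d where R: "R = (a, b, c, d)" by (cases R)
  obtain a' b' c' d' where M: "M = (a', b', c', d')" by (cases M)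
  obtain p q r s where K: "K = (p, q, r, s)" by (cases K)
  show ?thesis unfolding R M K
    by (simp add: power2_eq_square algebra_simps)
qed

text \<open>The expression is -det (t P - s Q). The matrix t P - s Q has height 0 at i, so it is
  symmetric and traceless, and minus the determinant of such a matrix is a sum of two squares. If it
  vanishes, \<open>P\<close> and \<open>Q\<close> are proportional.\<close>

lemma hgt_sq_identity:
  assumes "refl_mat P" "refl_mat Q"
  defines "s \<equiv> hgt P mone" and "t \<equiv> hgt Q mone"
  shows "s\<^sup>2 + t\<^sup>2 - mtr (Q \<odot> P) * s * t \<ge> 0"
    and "s\<^sup>2 + t\<^sup>2 - mtr (Q \<odot> P) * s * t = 0 \<Longrightarrow> s \<noteq> 0 \<Longrightarrow> t \<noteq> 0 \<Longrightarrow> Q = P \<or> Q = - P"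
proof -
  obtain a b c d where P: "P = (a, b, c, d)" by (cases P)
  obtain a' b' c' d' where Q: "Q = (a', b', c', d')" by (cases Q)
  have 1: "a = - d" "d * d + b * c = 1" "a' = - d'" "d' * d' + b' * c' = 1"
    using assms unfolding P Q by (auto simp: refl_mat_iff)
  have s: "s = c - b" and t: "t = c' - b'" by (simp_all add: s_def t_def P Q mone_def)
  have eq: "4 * (s\<^sup>2 + t\<^sup>2 - mtr (Q \<odot> P) * s * t) =
      (2 * (t * d - s * d'))\<^sup>2 + (t * (b + c) - s * (b' + c'))\<^sup>2"
    using 1 unfolding s t P Q mmul.simps mtr.simps by algebra
  show "s\<^sup>2 + t\<^sup>2 - mtr (Q \<odot> P) * s * t \<ge> 0"
  proof -
    have "X \<ge> 0" if "4 * X = u\<^sup>2 + v\<^sup>2" for X u v :: real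
      using that zero_le_power2[of u] zero_le_power2[of v] by linarith
    then show ?thesis using eq .
  qed
  assume 0: "s\<^sup>2 + t\<^sup>2 - mtr (Q \<odot> P) * s * t = 0" and nz: "s \<noteq> 0" "t \<noteq> 0"
  have "t * d = s * d'" "t * (b + c) = s * (b' + c')"
    using eq unfolding 0 by (auto simp: add_nonneg_eq_0_iff)
  then have "t * d = s * d'" "t * b = s * b'" "t * c = s * c'"
    using s t by algebra+
  moreover define k where "k = t / s"
  ultimately have k: "d' = k * d" "b' = k * b" "c' = k * c"
    using nz by (auto simp: field_simps)
  have "k * k = 1" using 1 k by algebra
  then have "k = 1 \<or> k = - 1" by algebra
  then show "Q = P \<or> Q = - P" using k 1 unfolding P Q by auto
qed

text \<open>The quotients of consecutive terms decrease, so one initial decrease forces geometric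
  decay. But the left side of the recurrence is positive, which keeps (y (k + 1))^2 above
  \<open>I\<close>.\<close>

lemma log_concave_decreasing_absurd:
  fixes y :: "nat \<Rightarrow> real"
  assumes pos: "\<And>k. y k > 0" and rec: "\<And>k. y (k + 2) * y k = (y (k + 1))\<^sup>2 - I"
    and "I > 0" "y 1 < y 0"
  shows False
proof -
  define \<theta> where "\<theta> = y 1 / y 0"
  have \<theta>: "0 < \<theta>" "\<theta> < 1" using pos assms(4) by (auto simp: \<theta>_def)
  have step: "y (k + 1) \<le> \<theta> * y k" for k
  proof (induction k)
    case 0
    show ?case using pos[of 0] by (simp add: \<theta>_def)
  next
    case (Suc k)
    have "y (k + 2) * y k \<le> y (k + 1) * y (k + 1)"
      using rec[of k] \<open>I > 0\<close> by (simp add: power2_eq_square)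
    also have "\<dots> \<le> y (k + 1) * (\<theta> * y k)"
      using Suc pos[of "k + 1"] by (intro mult_left_mono) auto
    finally have "y (k + 2) * y k \<le> (\<theta> * y (k + 1)) * y k" by (simp add: mult_ac)
    from mult_right_le_imp_le[OF this pos] show ?case by simp
  qed
  have bound: "y k \<le> \<theta> ^ k * y 0" for k
  proof (induction k)
    case (Suc k)
    have "\<theta> * y k \<le> \<theta> * (\<theta> ^ k * y 0)" using Suc \<theta> by (intro mult_left_mono) auto
    then show ?case using step[of k] by (simp add: mult.assoc)
  qed simp
  have "(\<lambda>k. \<theta> ^ k * y 0) \<longlonglongrightarrow> 0 * y 0"
    by (intro tendsto_intros LIMSEQ_realpow_zero) (use \<theta> in auto)
  then have "(\<lambda>k. \<theta> ^ k * y 0) \<longlonglongrightarrow> 0" by simp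
  then have "eventually (\<lambda>k. \<theta> ^ k * y 0 < sqrt I) sequentially"
    by (rule order_tendstoD) (use \<open>I > 0\<close> in simp)
  then obtain k where k: "\<And>j. j \<ge> k \<Longrightarrow> \<theta> ^ j * y 0 < sqrt I" by (auto simp: eventually_sequentially)
  have "y (k + 1) < sqrt I" using bound[of "k + 1"] k[of "k + 1"] by linarith
  then have "(y (k + 1))\<^sup>2 < I"
    using power_strict_mono[of "y (k+1)" "sqrt I" 2] pos[of "k+1"] \<open>I > 0\<close> by (simp add: less_imp_le)
  then show False using rec[of k] mult_pos_pos[OF pos[of "k+2"] pos[of k]] by linarith
qed

text \<open>With T = Q P these are the reflections T^k P of the dihedral group of \<open>P\<close>
  and \<open>Q\<close>; exchanging \<open>P\<close> and \<open>Q\<close> gives T^(1-k) P, the same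
  family run in the other direction. Written as palindromes, all terms are visibly
  reflections.\<close>

fun pal :: "mat2 \<Rightarrow> mat2 \<Rightarrow> nat \<Rightarrow> mat2" where
  "pal P Q 0 = P"
| "pal P Q (Suc 0) = Q"
| "pal P Q (Suc (Suc k)) = pal P Q (Suc k) \<odot> pal P Q k \<odot> pal P Q (Suc k)"

context
  fixes P Q :: mat2
  assumes refl: "refl_mat P" "refl_mat Q"
begin

lemma refl_mat_pal: "refl_mat (pal P Q k)"
proof (induction k rule: induct_nat_012)
  case (ge2 k)
  then show ?case using refl_mat_conj[of "pal P Q k" "pal P Q (Suc k)"] by (simp add: refl_mat_minv)
qed (use refl in auto)

lemma pal_translation: "pal P Q (Suc k) \<odot> pal P Q k = Q \<odot> P"
proof (induction k)
  case (Suc k)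
  then show ?case using refl_mat_pal[of "Suc k"] by (simp add: mmul_assoc)
qed simp

lemma pal_rec: "pal P Q (Suc (Suc k)) = mtr (Q \<odot> P) *\<^sub>R pal P Q (Suc k) - pal P Q k"
  using refl_mat_sandwich[OF refl_mat_pal[of "Suc k"], of "pal P Q k"] refl_mat_pal[of k]
  by (simp add: pal_translation refl_mat_def)

text \<open>Conjugation by Q P advances the index by two. Comparing one wall at the two points given
  by \<open>M\<close> and Q P M thus becomes comparing heights two indices apart at a single
  point.\<close>

lemma hgt_pal_shift: "hgt (pal P Q (Suc (Suc k))) (Q \<odot> P \<odot> M) = hgt (pal P Q k) M"
proof -
  let ?A = "pal P Q k" and ?B = "pal P Q (Suc k)"
  have R: "refl_mat ?A" "refl_mat ?B" by (rule refl_mat_pal)+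
  then have "minv (?B \<odot> ?A) \<odot> pal P Q (Suc (Suc k)) \<odot> (?B \<odot> ?A) = ?A"
    by (simp add: minv_mmul refl_mat_minv mmul_assoc)
  moreover have "mdet (?B \<odot> ?A) = 1" "?B \<odot> ?A \<in> unimod" using R by (auto simp: refl_mat_def)
  ultimately show ?thesis using hgt_conj[of "?B \<odot> ?A" "pal P Q (Suc (Suc k))" M]
    by (simp add: pal_translation)
qed

text \<open>The quadratic invariant of the recurrence x (k+2) = tr (Q P) x (k+1) - x k that the
  heights satisfy: every pair of consecutive heights gives the same value.\<close>

definition pal_inv :: "mat2 \<Rightarrow> real" where
  "pal_inv M = (hgt P M)\<^sup>2 + (hgt Q M)\<^sup>2 - mtr (Q \<odot> P) * hgt P M * hgt Q M"

lemma hgt_pal_rec: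
  "hgt (pal P Q (Suc (Suc k))) M * hgt (pal P Q k) M = (hgt (pal P Q (Suc k)) M)\<^sup>2 - pal_inv M"
proof -
  let ?s = "\<lambda>k. hgt (pal P Q k) M" and ?t = "mtr (Q \<odot> P)"
  have r: "?s (Suc (Suc k)) = ?t * ?s (Suc k) - ?s k" for k
    unfolding pal_rec by simp
  have I: "(?s k)\<^sup>2 + (?s (Suc k))\<^sup>2 - ?t * ?s k * ?s (Suc k) = pal_inv M" for k
  proof (induction k)
    case (Suc k)
    then show ?case unfolding r by (simp add: power2_eq_square algebra_simps)
  qed (simp add: pal_inv_def)
  show ?thesis unfolding I[of k, symmetric] r[of k] by (simp add: power2_eq_square algebra_simps)
qed

text \<open>Conjugation by \<open>M\<close> moves the point to i, where
  \<open>hgt_sq_identity\<close> applies; the determinant of \<open>M\<close> enters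
  squared.\<close>

lemma pal_inv_pos:
  assumes M: "M \<in> unimod" and "Q \<noteq> P" "Q \<noteq> - P" "hgt P M \<noteq> 0" "hgt Q M \<noteq> 0"
  shows "pal_inv M > 0"
proof -
  let ?P = "minv M \<odot> P \<odot> M" and ?Q = "minv M \<odot> Q \<odot> M"
  have R: "refl_mat ?P" "refl_mat ?Q" using refl M by (auto intro: refl_mat_conj)
  have h: "hgt ?P mone = mdet M * hgt P M" "hgt ?Q mone = mdet M * hgt Q M"
    using hgt_conj[OF M] by simp_all
  have dd: "mdet M * (mdet M * x) = x" for x using unimodD[OF M] by (simp flip: mult.assoc)
  have tr: "mtr (?Q \<odot> ?P) = mtr (Q \<odot> P)"
    using M mtr_commute[of "minv M" "Q \<odot> P \<odot> M"] by (simp add: mmul_assoc)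
  have inv: "(hgt ?P mone)\<^sup>2 + (hgt ?Q mone)\<^sup>2 - mtr (?Q \<odot> ?P) * hgt ?P mone * hgt ?Q mone = pal_inv M"
  proof -
    have "(e * x)\<^sup>2 + (e * y)\<^sup>2 - t * (e * x) * (e * y) = x\<^sup>2 + y\<^sup>2 - t * x * y"
      if "e * e = 1" for e x y t :: real
      using that by algebra
    then show ?thesis unfolding h tr pal_inv_def using unimodD[OF M] by blast
  qed
  have inj: "A = B" if "minv M \<odot> A \<odot> M = minv M \<odot> B \<odot> M" for A B
  proof -
    have "M \<odot> (minv M \<odot> A \<odot> M) \<odot> minv M = M \<odot> (minv M \<odot> B \<odot> M) \<odot> minv M" using that by simp
    then show ?thesis using M by (simp add: mmul_assoc)
  qed
  have "?Q \<noteq> ?P" "?Q \<noteq> - ?P" using inj[of Q P] inj[of Q "- P"] assms by auto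
  then have "pal_inv M \<noteq> 0"
    using hgt_sq_identity(2)[OF R, unfolded inv] h assms M by (auto simp: unimod_def)
  moreover have "pal_inv M \<ge> 0" using hgt_sq_identity(1)[OF R, unfolded inv] .
  ultimately show ?thesis by simp
qed

text \<open>Heights two apart have equal signs, so the absolute values satisfy the same recurrence
  with a positive defect, and such a sequence cannot decrease.\<close>

lemma pal_no_decrease:
  assumes M: "M \<in> unimod" and ne: "Q \<noteq> P" "Q \<noteq> - P"
    and pos: "\<And>k. hgt (pal P Q k) M * hgt (pal P Q (Suc (Suc k))) M > 0"
  shows "\<bar>hgt P M\<bar> < \<bar>hgt Q M\<bar>"
proof (rule ccontr)
  let ?y = "\<lambda>k. \<bar>hgt (pal P Q k) M\<bar>"
  assume "\<not> ?thesis"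
  then have le: "?y 1 \<le> ?y 0" by simp
  have nz: "hgt (pal P Q k) M \<noteq> 0" for k using pos[of k] by auto
  have I: "pal_inv M > 0" using pal_inv_pos[OF M ne] nz[of 0] nz[of 1] by simp
  have rec: "?y (k + 2) * ?y k = (?y (k + 1))\<^sup>2 - pal_inv M" for k
    using pos[of k] hgt_pal_rec[of k M] by (simp add: abs_mult[symmetric] mult.commute)
  show False
  proof (cases "?y 1 < ?y 0")
    case True
    show False by (rule log_concave_decreasing_absurd[of ?y, OF _ rec I True]) (use nz in auto)
  next
    case False
    \<comment> \<open>Equal first terms are no exception: the defect makes the next term strictly
      smaller, and the argument applies to the sequence shifted by one.\<close>
    with le have "?y 1 = ?y 0" by simp
    then have "?y 2 * ?y 1 < ?y 1 * ?y 1" using rec[of 0] I by (simp add: power2_eq_square numeral_2_eq_2)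
    from mult_right_less_imp_less[OF this] have "?y (Suc 1) < ?y 1" by (simp add: numeral_2_eq_2)
    then show False
      using log_concave_decreasing_absurd[of "\<lambda>k. ?y (Suc k)" "pal_inv M"] nz rec[of "Suc _"] I
      by (simp add: numeral_2_eq_2)
  qed
qed

end

text \<open>If no wall separated the two points, the heights along the palindromic products would keep a
  constant sign on even and on odd indices. By \<open>hgt_pal_rec\<close> they would be log-concave with a fixed positive
  defect, so they could not decrease; this applies to the sequence run in both directions.\<close>
lemma dihedral_separation:
  assumes refl: "refl_mat P" "refl_mat Q" and M: "M \<in> unimod" and ne: "Q \<noteq> P" "Q \<noteq> - P"
    and cl: "P \<in> S" "Q \<in> S" "\<And>A B. A \<in> S \<Longrightarrow> B \<in> S \<Longrightarrow> A \<odot> B \<odot> A \<in> S"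
  shows "\<exists>R\<in>S. hgt R M * hgt R (Q \<odot> P \<odot> M) \<le> 0"
proof (rule ccontr)
  assume contra: "\<not> ?thesis"
  have sep: "hgt R M * hgt R (Q \<odot> P \<odot> M) > 0" if "R \<in> S" for R
  proof (rule ccontr)
    assume "\<not> hgt R M * hgt R (Q \<odot> P \<odot> M) > 0"
    then have "hgt R M * hgt R (Q \<odot> P \<odot> M) \<le> 0" by linarith
    then show False using contra that by blast
  qed
  have S: "pal A B k \<in> S" if "A \<in> S" "B \<in> S" for A B k
    by (induction k rule: induct_nat_012) (use that cl in auto)
  \<comment> \<open>P Q undoes Q P, so in the other direction the shift by two leads from
    \<open>M\<close> to Q P M, and the same walls can be used to compare the two points.\<close>
  have "P \<odot> Q \<odot> (Q \<odot> P \<odot> M) = M" using refl by (simp add: mmul_assoc)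
  then have 1: "hgt (pal Q P (Suc (Suc k))) M = hgt (pal Q P k) (Q \<odot> P \<odot> M)" for k
    using hgt_pal_shift[OF refl(2,1), of k "Q \<odot> P \<odot> M"] by simp
  have "\<bar>hgt P M\<bar> < \<bar>hgt Q M\<bar>"
  proof (rule pal_no_decrease[OF refl M ne])
    fix k show "0 < hgt (pal P Q k) M * hgt (pal P Q (Suc (Suc k))) M"
      using sep[OF S[OF cl(1,2), of "Suc (Suc k)"]] hgt_pal_shift[OF refl, of k M] by (simp add: mult.commute)
  qed
  moreover have "\<bar>hgt Q M\<bar> < \<bar>hgt P M\<bar>"
  proof (rule pal_no_decrease[OF refl(2,1) M])
    fix k show "0 < hgt (pal Q P k) M * hgt (pal Q P (Suc (Suc k))) M"
      using sep[OF S[OF cl(2,1), of k]] 1 by simp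
  qed (use ne in auto)
  ultimately show False by simp
qed

section \<open>Discrete groups generated by reflections\<close>

declare split_paired_All [simp del] split_paired_Ex [simp del]

locale mat_group =
  fixes \<Gamma> :: "mat2 set"
  assumes subset: "\<Gamma> \<subseteq> unimod"
    and one [simp, intro]: "mone \<in> \<Gamma>"
    and mul [simp, intro]: "A \<in> \<Gamma> \<Longrightarrow> B \<in> \<Gamma> \<Longrightarrow> A \<odot> B \<in> \<Gamma>"
    and inv [simp, intro]: "A \<in> \<Gamma> \<Longrightarrow> minv A \<in> \<Gamma>"
    and neg [simp, intro]: "A \<in> \<Gamma> \<Longrightarrow> - A \<in> \<Gamma>"
begin

lemma unimod [simp, intro]: "A \<in> \<Gamma> \<Longrightarrow> A \<in> unimod"
  using subset by auto

end

section \<open>Reduction to the identity by reflections\<close>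

inductive_set refl_gen :: "mat2 set \<Rightarrow> mat2 set" for \<Gamma> where
  one: "M = mone \<or> M = - mone \<Longrightarrow> M \<in> refl_gen \<Gamma>"
| mul: "R \<in> \<Gamma> \<Longrightarrow> refl_mat R \<Longrightarrow> M \<in> refl_gen \<Gamma> \<Longrightarrow> R \<odot> M \<in> refl_gen \<Gamma>"

text \<open>The decrease of the norm confines the whole chain to the ball through its first member.
  This is what survives when the groups themselves converge.\<close>

inductive descends :: "mat2 set \<Rightarrow> mat2 \<Rightarrow> bool" for \<Gamma> where
  one: "M = mone \<or> M = - mone \<Longrightarrow> descends \<Gamma> M"
| step: "R \<in> \<Gamma> \<Longrightarrow> refl_mat R \<Longrightarrow> norm (R \<odot> M) < norm M \<Longrightarrow> descends \<Gamma> (R \<odot> M) \<Longrightarrow>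
    descends \<Gamma> M"

lemma descends_minus: "descends \<Gamma> M \<Longrightarrow> descends \<Gamma> (- M)"
proof (induction rule: descends.induct)
  case (one M)
  then show ?case by (intro descends.one) auto
next
  case (step R M)
  then show ?case using descends.step[of R \<Gamma> "- M"] by auto
qed

text \<open>\<open>finite_ball\<close> is discreteness. \<open>base_off_walls\<close> makes i
  generic, so that multiplication by a reflection always changes the norm of a group
  element.\<close>

locale reflection_mats = mat_group +
  assumes finite_ball: "finite {M \<in> \<Gamma>. norm M \<le> C}"
    and generated: "\<Gamma> \<subseteq> refl_gen \<Gamma>"
    and base_off_walls: "R \<in> \<Gamma> \<Longrightarrow> refl_mat R \<Longrightarrow> hgt R mone \<noteq> 0"
begin

lemma hgt_nonzero:
  assumes "R \<in> \<Gamma>" "refl_mat R" "M \<in> \<Gamma>"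
  shows "hgt R M \<noteq> 0"
proof -
  have "minv M \<odot> R \<odot> M \<in> \<Gamma>" using assms by auto
  then have "hgt (minv M \<odot> R \<odot> M) mone \<noteq> 0"
    using assms by (intro base_off_walls refl_mat_conj) auto
  then show ?thesis using hgt_conj[of M R mone] assms by auto
qed

text \<open>Counting the finitely many elements of smaller norm turns the decrease of a real number
  into a well-founded order.\<close>

definition rank :: "mat2 \<Rightarrow> nat" where "rank M = card {N \<in> \<Gamma>. norm N < norm M}"

lemma rank_less: 
  assumes "N \<in> \<Gamma>" "norm N < norm M" shows "rank N < rank M"
  unfolding rank_def
proof (rule psubset_card_mono)
  show "finite {N \<in> \<Gamma>. norm N < norm M}"
    by (rule finite_subset[OF _ finite_ball[of "norm M"]]) auto
  have "N \<in> {N \<in> \<Gamma>. norm N < norm M}" "N \<notin> {K \<in> \<Gamma>. norm K < norm N}" using assms by auto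
  then show "{K \<in> \<Gamma>. norm K < norm N} \<subset> {K \<in> \<Gamma>. norm K < norm M}" using assms by auto
qed

text \<open>The rewriting step, with the admissible reflections restricted to \<open>D\<close>. By
  the sign rule for norms, a normal form lies on the same side as i of every wall in
  \<open>D\<close>.\<close>

definition red :: "mat2 set \<Rightarrow> mat2 \<Rightarrow> mat2 \<Rightarrow> bool" where
  "red D M M' \<longleftrightarrow> (\<exists>R\<in>D. refl_mat R \<and> M' = R \<odot> M \<and> norm M' < norm M)"

lemma red_normal_form:
  assumes "M \<in> \<Gamma>" "D \<subseteq> \<Gamma>"
  shows "\<exists>M'. (red D)\<^sup>*\<^sup>* M M' \<and> (\<forall>M''. \<not> red D M' M'')"
  using assms(1)
proof (induction "rank M" arbitrary: M rule: less_induct)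
  case less
  show ?case
  proof (cases "\<exists>M'. red D M M'")
    case True
    then obtain M' where M': "red D M M'" ..
    then have "M' \<in> \<Gamma>" "norm M' < norm M" using less.prems assms(2) by (auto simp: red_def)
    then obtain N where "(red D)\<^sup>*\<^sup>* M' N" "\<forall>M''. \<not> red D N M''"
      using less.hyps[OF rank_less] by blast
    then show ?thesis using M' by (meson converse_rtranclp_into_rtranclp)
  next
    case False
    then show ?thesis by (meson rtranclp.rtrancl_refl)
  qed
qed

lemma normal_form_same_side:
  assumes "\<forall>M'. \<not> red D M M'" "M \<in> \<Gamma>" "D \<subseteq> \<Gamma>" "R \<in> D" "refl_mat R"
  shows "hgt R mone * hgt R M > 0"
proof -
  have "\<not> norm (R \<odot> M) < norm M" using assms unfolding red_def by blast
  then have "\<not> (norm (R \<odot> M))\<^sup>2 < (norm M)\<^sup>2" by (simp add: power2_less_imp_less linorder_not_less)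
  then have "hgt R mone * hgt R M \<ge> 0" using norm_refl_mmul[OF assms(5), of M] by simp
  moreover have "hgt R mone * hgt R M \<noteq> 0" using hgt_nonzero[of R mone] hgt_nonzero[of R M] assms by auto
  ultimately show ?thesis by (simp add: order_less_le)
qed

text \<open>The elements of the group that fix, up to the sign given by the determinant, the common
  orthogonal complement N of the normals of two walls form a dihedral group.\<close>
lemma dihedral_normal_form_unique:
  fixes N :: mat2
  defines "D \<equiv> {X \<in> \<Gamma>. X \<odot> N = mdet X *\<^sub>R (N \<odot> X)}"
  assumes N: "N \<noteq> 0" "mtr N = 0" and P: "P \<in> D" "refl_mat P"
    and d: "d \<in> D" and M: "M \<in> \<Gamma>"
    and nf: "\<forall>M'. \<not> red D M M'" "\<forall>M'. \<not> red D (d \<odot> M) M'"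
  shows "d = mone \<or> d = - mone"
proof (rule ccontr)
  assume nd: "\<not> ?thesis"
  have D: "D \<subseteq> \<Gamma>" by (auto simp: D_def)
  have Dmul: "A \<odot> B \<in> D" if "A \<in> D" "B \<in> D" for A B
  proof -
    have "A \<odot> B \<odot> N = A \<odot> (mdet B *\<^sub>R (N \<odot> B))" using that by (simp add: D_def mmul_assoc)
    also have "\<dots> = mdet B *\<^sub>R (A \<odot> N \<odot> B)" by (simp add: mmul_assoc)
    also have "\<dots> = mdet (A \<odot> B) *\<^sub>R (N \<odot> (A \<odot> B))"
      using that by (simp add: D_def mmul_assoc mult.commute)
    finally show ?thesis using that by (auto simp: D_def)
  qed
  \<comment> \<open>An element of determinant -1 in \<open>D\<close> anticommutes with
    \<open>N\<close>. As \<open>N\<close> is traceless and not 0, this forces its trace to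
    vanish.\<close>
  have Drefl: "refl_mat X" if "X \<in> D" "mdet X = - 1" for X
  proof -
    obtain a b c e where X: "X = (a, b, c, e)" by (cases X)
    obtain p q r s where N': "N = (p, q, r, s)" by (cases N)
    have "X \<odot> N = - (N \<odot> X)" using that by (simp add: D_def)
    moreover have "s = - p" using N by (simp add: N')
    ultimately have "a * p + b * r = - (p * a + q * c)" "a * q - b * p = - (p * b + q * e)"
      "c * p + e * r = - (r * a - p * c)" "c * q - e * p = - (r * b - p * e)"
      unfolding X N' by simp_all
    then have "(a + e) * p = 0" "(a + e) * q = 0" "(a + e) * r = 0" by algebra+
    then have "a + e = 0" using N \<open>s = - p\<close> by (auto simp: N' zero_prod_def)
    then show ?thesis using that by (simp add: refl_mat_def X)
  qed
  have dM: "d \<odot> M \<in> \<Gamma>" using M d D by auto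
  have side: "hgt R M * hgt R (d \<odot> M) > 0" if "R \<in> D" "refl_mat R" for R
    using normal_form_same_side[OF nf(1) M D that] normal_form_same_side[OF nf(2) dM D that]
    by (auto simp: zero_less_mult_iff)
  have "d \<in> unimod" using d D by auto
  then consider "mdet d = - 1" | "mdet d = 1" by (auto simp: unimod_def)
  then show False
  proof cases
    case 1
    then have "refl_mat d" using Drefl d by auto
    then have "hgt d (d \<odot> M) = - hgt d M" by (rule hgt_refl)
    then show False using side[OF d \<open>refl_mat d\<close>] zero_le_square[of "hgt d M"] by simp
  next
    case 2
    \<comment> \<open>An orientation-preserving \<open>d\<close> is the product of the two
      reflections \<open>Q\<close> and \<open>P\<close> of \<open>D\<close>. Then some wall of
      \<open>D\<close> separates the two normal forms, although both lie on the same side as i of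
      all of them.\<close>
    define Q where "Q = d \<odot> P"
    have Q: "Q \<in> D" using Dmul d P by (auto simp: Q_def)
    have rQ: "refl_mat Q" using Drefl[OF Q] 2 P by (simp add: Q_def refl_mat_def)
    have QP: "Q \<odot> P = d" using P by (simp add: Q_def mmul_assoc)
    have "Q \<noteq> P" "Q \<noteq> - P" using QP P nd by auto
    moreover have "A \<odot> B \<odot> A \<in> {R \<in> D. refl_mat R}"
      if "A \<in> {R \<in> D. refl_mat R}" "B \<in> {R \<in> D. refl_mat R}" for A B
      using that Dmul refl_mat_conj[of B A] by (auto simp: refl_mat_minv)
    ultimately obtain R where "R \<in> {R \<in> D. refl_mat R}" "hgt R M * hgt R (Q \<odot> P \<odot> M) \<le> 0"
      using dihedral_separation[of P Q M "{R \<in> D. refl_mat R}"] P rQ Q M by auto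
    then show False using side[of R] QP by auto
  qed
qed

lemma red_imp_norm_less: "red D M M' \<Longrightarrow> norm M' < norm M"
  by (auto simp: red_def)

lemma red_closed: "red D M M' \<Longrightarrow> D \<subseteq> \<Gamma> \<Longrightarrow> M \<in> \<Gamma> \<Longrightarrow> M' \<in> \<Gamma>"
  by (auto simp: red_def)

lemma red_mono: "(red D)\<^sup>*\<^sup>* M M' \<Longrightarrow> D \<subseteq> \<Gamma> \<Longrightarrow> (red \<Gamma>)\<^sup>*\<^sup>* M M'"
  by (erule mono_rtranclp[rule_format, rotated]) (auto simp: red_def)

text \<open>The commutator \<open>N\<close> of the two reflections is orthogonal to both normals; it
  stands for the common point, common ideal point or common perpendicular of the walls. Both
  reductions are continued with the elements of the group that preserve \<open>N\<close> up to the
  determinant, and there the normal form is unique up to sign.\<close>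

lemma local_confluence:
  assumes M: "M \<in> \<Gamma>" and red: "red \<Gamma> M M1" "red \<Gamma> M M2"
  shows "\<exists>Z Z'. (red \<Gamma>)\<^sup>*\<^sup>* M1 Z \<and> (red \<Gamma>)\<^sup>*\<^sup>* M2 Z' \<and> (Z' = Z \<or> Z' = - Z)"
proof -
  obtain R1 R2 where R: "R1 \<in> \<Gamma>" "refl_mat R1" "M1 = R1 \<odot> M" "R2 \<in> \<Gamma>" "refl_mat R2" "M2 = R2 \<odot> M"
    using red by (auto simp: red_def)
  define N where "N = R1 \<odot> R2 - R2 \<odot> R1"
  show ?thesis
  proof (cases "N = 0")
    case True
    then have comm: "R1 \<odot> R2 = R2 \<odot> R1" by (simp add: N_def)
    show ?thesis
    proof (cases "R2 = R1 \<or> R2 = - R1")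
      case True
      then show ?thesis using R by (intro exI[of _ M1] exI[of _ M2]) auto
    next
      case False
      have "\<exists>t. R2 = t *\<^sub>R R1"
      proof -
        obtain a b c d where R1: "R1 = (a, b, c, d)" by (cases R1)
        obtain a' b' c' d' where R2: "R2 = (a', b', c', d')" by (cases R2)
        have 1: "a = - d" "d * d + b * c = 1" "a' = - d'" "d' * d' + b' * c' = 1"
          using R unfolding R1 R2 by (auto simp: refl_mat_iff)
        then have 2: "b * c' = b' * c" "b * d' = b' * d" "c * d' = c' * d"
          using comm unfolding R1 R2 by simp_all
        \<comment> \<open>The factor of proportionality is half the trace of
          \<open>R1 \<odot> R2\<close>.\<close>
        have "b' = (d' * d + b' * c) * b" "c' = (d' * d + b' * c) * c" "d' = (d' * d + b' * c) * d"
          using 1 2 by algebra+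
        then show ?thesis using 1 unfolding R1 R2 by (intro exI[of _ "d' * d + b' * c"]) simp
      qed
      then obtain t where t: "R2 = t *\<^sub>R R1" ..
      have "t * t = 1" using refl_mat_sq[OF R(5)] R(2) unfolding t by (simp add: mone_def)
      then have "t = 1 \<or> t = - 1" by algebra
      then show ?thesis using False t by auto
    qed
  next
    case False
    define D where "D = {X \<in> \<Gamma>. X \<odot> N = mdet X *\<^sub>R (N \<odot> X)}"
    have D: "D \<subseteq> \<Gamma>" by (auto simp: D_def)
    have RD: "R1 \<in> D" "R2 \<in> D"
      using R by (auto simp: D_def N_def mmul_distrib mmul_assoc refl_mat_def[of R1] refl_mat_def[of R2])
    obtain Z1 where Z1: "(red D)\<^sup>*\<^sup>* M1 Z1" "\<forall>M'. \<not> red D Z1 M'"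
      using red_normal_form[OF _ D] R M by blast
    obtain Z2 where Z2: "(red D)\<^sup>*\<^sup>* M2 Z2" "\<forall>M'. \<not> red D Z2 M'"
      using red_normal_form[OF _ D] R M by blast
    have Dmul: "A \<odot> B \<in> D" if "A \<in> D" "B \<in> D" for A B
    proof -
      have "A \<odot> B \<odot> N = A \<odot> (mdet B *\<^sub>R (N \<odot> B))" using that by (simp add: D_def mmul_assoc)
      also have "\<dots> = mdet B *\<^sub>R (A \<odot> N \<odot> B)" by (simp add: mmul_assoc)
      also have "\<dots> = mdet (A \<odot> B) *\<^sub>R (N \<odot> (A \<odot> B))"
        using that by (simp add: D_def mmul_assoc mult.commute)
      finally show ?thesis using that by (auto simp: D_def)
    qed
    have orbit: "\<exists>X\<in>D. \<exists>Y\<in>D. Z = X \<odot> M \<and> M = Y \<odot> Z"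
      if "(red D)\<^sup>*\<^sup>* (R \<odot> M) Z" "R \<in> D" "refl_mat R" for R Z
      using that(1)
    proof (induction rule: rtranclp_induct)
      case base
      then show ?case using that by (intro bexI[of _ R]) auto
    next
      case (step Z Z')
      then obtain X Y where XY: "X \<in> D" "Y \<in> D" "Z = X \<odot> M" "M = Y \<odot> Z" by blast
      obtain R' where R': "R' \<in> D" "refl_mat R'" "Z' = R' \<odot> Z" using step by (auto simp: red_def)
      show ?case
      proof (intro bexI conjI)
        show "Z' = R' \<odot> X \<odot> M" using XY R' by (simp add: mmul_assoc)
        show "M = Y \<odot> R' \<odot> Z'" using XY(4) R' by (simp add: mmul_assoc)
      qed (use Dmul XY R' in auto)
    qed
    obtain X1 Y1 where X1: "X1 \<in> D" "Y1 \<in> D" "Z1 = X1 \<odot> M" "M = Y1 \<odot> Z1"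
      using orbit[OF _ RD(1), of Z1] Z1 R by auto
    obtain X2 Y2 where X2: "X2 \<in> D" "Y2 \<in> D" "Z2 = X2 \<odot> M" "M = Y2 \<odot> Z2"
      using orbit[OF _ RD(2), of Z2] Z2 R by auto
    have Z2eq: "Z2 = (X2 \<odot> Y1) \<odot> Z1" using X1(4) X2(3) by (simp add: mmul_assoc)
    have "X2 \<odot> Y1 = mone \<or> X2 \<odot> Y1 = - mone"
    proof (rule dihedral_normal_form_unique[of N R1 "X2 \<odot> Y1" Z1, folded D_def])
      show "mtr N = 0" by (simp add: N_def mtr_commute[of R1])
      show "Z1 \<in> \<Gamma>" unfolding X1(3) using X1(1) M D by blast
      show "X2 \<odot> Y1 \<in> D" using Dmul X1 X2 by blast
      show "\<forall>M'. \<not> red D (X2 \<odot> Y1 \<odot> Z1) M'" using Z2(2) Z2eq by simp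
    qed (fact False RD R Z1)+
    then have "Z2 = Z1 \<or> Z2 = - Z1" using Z2eq by auto
    then show ?thesis using red_mono[OF Z1(1) D] red_mono[OF Z2(1) D] by blast
  qed
qed

lemma descends_rev: "(red \<Gamma>)\<^sup>*\<^sup>* M Z \<Longrightarrow> descends \<Gamma> Z \<Longrightarrow> descends \<Gamma> M"
proof (induction rule: converse_rtranclp_induct)
  case (step M M')
  then obtain R where "R \<in> \<Gamma>" "refl_mat R" "M' = R \<odot> M" "norm M' < norm M" by (auto simp: red_def)
  then show ?case using descends.step[of R \<Gamma> M] step by simp
qed

text \<open>Newman's argument for the property of reducing to the identity. The first step of a
  descent and the given step have common reducts up to sign; the induction hypothesis carries the
  property down one side, and it is pulled back up the other.\<close>

lemma descends_red:
  assumes "M \<in> \<Gamma>" "descends \<Gamma> M" "red \<Gamma> M M'"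
  shows "descends \<Gamma> M'"
  using assms
proof (induction "rank M" arbitrary: M M' rule: less_induct)
  case less
  have IH: "descends \<Gamma> Z" if "(red \<Gamma>)\<^sup>*\<^sup>* M1 Z" "descends \<Gamma> M1" "red \<Gamma> M M1" for M1 Z
  proof -
    from that(1) have "descends \<Gamma> Z \<and> Z \<in> \<Gamma> \<and> norm Z < norm M"
    proof (induction rule: rtranclp_induct)
      case base
      then show ?case using that less.prems(1) red_closed red_imp_norm_less by blast
    next
      case (step Y Z)
      then have "rank Y < rank M" by (intro rank_less) auto
      then show ?case using step less.hyps[of Y Z] red_closed[of \<Gamma> Y Z] red_imp_norm_less[of \<Gamma> Y Z] by auto
    qed
    then show ?thesis by blast
  qed
  from less.prems(2) show ?case
  proof cases
    case one
    then have "norm M = sqrt 2" by (auto simp: norm_mone)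
    moreover have "norm M' \<ge> sqrt 2"
      using less.prems red_closed by (intro norm_unimod_ge) auto
    ultimately show ?thesis using red_imp_norm_less[OF less.prems(3)] by simp
  next
    case (step R)
    then have red1: "red \<Gamma> M (R \<odot> M)" by (auto simp: red_def)
    obtain Z Z' where Z: "(red \<Gamma>)\<^sup>*\<^sup>* (R \<odot> M) Z" "(red \<Gamma>)\<^sup>*\<^sup>* M' Z'" "Z' = Z \<or> Z' = - Z"
      using local_confluence[OF less.prems(1) red1 less.prems(3)] by blast
    have "descends \<Gamma> Z" using IH[OF Z(1) step(4) red1] .
    then have "descends \<Gamma> Z'" using Z(3) descends_minus[of \<Gamma> Z] by (elim disjE) simp_all
    then show ?thesis using descends_rev[OF Z(2)] by blast
  qed
qed

text \<open>Follow a word in reflections letter by letter. No letter leaves the norm unchanged; if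
  it lowers the norm, confluence preserves the descent, and if it raises the norm, the letter itself
  is the first step of the new descent.\<close>

theorem all_descend:
  assumes "M \<in> \<Gamma>" shows "descends \<Gamma> M"
proof -
  have "M \<in> refl_gen \<Gamma>" using assms generated by auto
  then have "M \<in> \<Gamma> \<and> descends \<Gamma> M"
  proof (induction rule: refl_gen.induct)
    case (one M)
    then show ?case by (auto intro: descends.one)
  next
    case (mul R M)
    have "(norm (R \<odot> M))\<^sup>2 \<noteq> (norm M)\<^sup>2"
      using norm_refl_mmul[OF mul(2)] hgt_nonzero[OF mul(1,2)] mul base_off_walls[OF mul(1,2)] by simp
    then consider "norm (R \<odot> M) < norm M" | "norm M < norm (R \<odot> M)" by fastforce
    then show ?case
    proof cases
      case 1
      then show ?thesis using descends_red[of M "R \<odot> M"] mul by (auto simp: red_def)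
    next
      case 2
      then show ?thesis using descends.step[of R \<Gamma> "R \<odot> M"] mul by auto
    qed
  qed
  then show ?thesis by blast
qed

end

section \<open>Small elements of discrete groups\<close>

definition tl_part :: "mat2 \<Rightarrow> mat2" where "tl_part A = A - (mtr A / 2) *\<^sub>R mone"

lemma tl_part_eq: "tl_part (a, b, c, d) = ((a - d) / 2, b, c, (d - a) / 2)"
  by (simp add: tl_part_def mone_def field_simps)

lemma mtr_tl_part [simp]: "mtr (tl_part A) = 0"
  by (simp add: tl_part_def)

lemma decompose_tl_part: "A = (mtr A / 2) *\<^sub>R mone + tl_part A"
  by (simp add: tl_part_def)

lemma mtr_conj: "K \<in> unimod \<Longrightarrow> mtr (K \<odot> A \<odot> minv K) = mtr A"
  by (simp add: mtr_commute[of "K \<odot> A"])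

lemma tl_part_conj: "K \<in> unimod \<Longrightarrow> tl_part (K \<odot> A \<odot> minv K) = K \<odot> tl_part A \<odot> minv K"
  by (simp add: tl_part_def mtr_conj mmul_distrib)

lemma commute_tl_part: "A \<odot> B = B \<odot> A \<longleftrightarrow> tl_part A \<odot> B = B \<odot> tl_part A"
  by (simp add: tl_part_def mmul_distrib)

text \<open>The centraliser of a non-scalar matrix consists of the linear combinations of that
  matrix and the identity.\<close>

lemma commute_imp_parallel:
  assumes comm: "A \<odot> B = B \<odot> A" and nz: "tl_part A \<noteq> 0"
  shows "\<exists>t. tl_part B = t *\<^sub>R tl_part A"
proof -
  obtain a b c d where A: "A = (a, b, c, d)" by (cases A)
  obtain a' b' c' d' where B: "B = (a', b', c', d')" by (cases B)
  have "a * a' + b * c' = a' * a + b' * c" "a * b' + b * d' = a' * b + b' * d"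
    "c * a' + d * c' = c' * a + d' * c"
    using comm unfolding A B by simp_all
  then have 1: "b * c' = b' * c" "b' * (a - d) = b * (a' - d')" "c' * (a - d) = c * (a' - d')"
    by algebra+
  have "a - d \<noteq> 0 \<or> b \<noteq> 0 \<or> c \<noteq> 0" using nz unfolding A tl_part_eq by (auto simp: zero_prod_def)
  then consider "a - d \<noteq> 0" | "b \<noteq> 0" | "c \<noteq> 0" by blast
  then show ?thesis
  proof cases
    case 1
    then show ?thesis using \<open>b' * (a - d) = _\<close> \<open>c' * (a - d) = _\<close> unfolding A B tl_part_eq
      by (intro exI[of _ "(a' - d') / (a - d)"]) (auto simp: field_simps)
  next
    case 2
    have "(a' - d') / 2 = b' / b * ((a - d) / 2)" "c' = b' / b * c"
      using 1 2 by (simp_all add: field_simps)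
    then show ?thesis using 2 unfolding A B tl_part_eq
      by (intro exI[of _ "b' / b"]) (auto simp: field_simps)
  next
    case 3
    have "(a' - d') / 2 = c' / c * ((a - d) / 2)" "b' = c' / c * b"
      using 1 3 by (simp_all add: field_simps)
    then show ?thesis using 3 unfolding A B tl_part_eq
      by (intro exI[of _ "c' / c"]) (auto simp: field_simps)
  qed
qed

lemma norm_near_one: "norm (A - mone) \<le> e \<Longrightarrow> norm A \<le> 1.42 + e"
proof -
  have "sqrt 2 \<le> 1.42" by (rule real_le_lsqrt) (auto simp: power2_eq_square)
  moreover have "norm A \<le> norm (A - mone) + norm mone" by norm
  moreover assume "norm (A - mone) \<le> e"
  ultimately show ?thesis by (simp add: norm_mone)
qed

lemma near_one_det_tr:
  assumes "A \<in> unimod" "norm (A - mone) \<le> 1/2"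
  shows "mdet A = 1" "mtr A > 0"
proof -
  obtain a b c d where A: "A = (a, b, c, d)" by (cases A)
  have "(norm (A - mone))\<^sup>2 \<le> (1/2)\<^sup>2" using assms by (intro power_mono) auto
  then have n: "(a - 1)\<^sup>2 + b\<^sup>2 + c\<^sup>2 + (d - 1)\<^sup>2 \<le> 1/4"
    unfolding A mone_def diff_Pair norm_mat2 by (simp add: power2_eq_square)
  have le: "x\<^sup>2 \<le> 1/4 \<Longrightarrow> \<bar>x\<bar> \<le> 1/2" for x :: real
    by (rule power2_le_imp_le) (auto simp: power2_eq_square)
  have "(a - 1)\<^sup>2 \<le> 1/4" "(d - 1)\<^sup>2 \<le> 1/4"
    using n zero_le_power2[of "a - 1"] zero_le_power2[of "d - 1"] zero_le_power2[of b] zero_le_power2[of c]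
    by linarith+
  then have "\<bar>a - 1\<bar> \<le> 1/2" "\<bar>d - 1\<bar> \<le> 1/2" by (blast intro: le)+
  then have ad: "a \<ge> 1/2" "d \<ge> 1/2" by linarith+
  show "mtr A > 0" using ad by (simp add: A)
  have "a * d \<ge> 1/2 * (1/2)" using ad by (intro mult_mono) auto
  moreover have "2 * (b * c) \<le> b\<^sup>2 + c\<^sup>2" using zero_le_power2[of "b - c"] by (simp add: power2_eq_square algebra_simps)
  moreover have "b\<^sup>2 + c\<^sup>2 \<le> 1/4" using n zero_le_power2[of "a - 1"] zero_le_power2[of "d - 1"] by linarith
  ultimately have "mdet A > 0" by (simp add: A)
  then show "mdet A = 1" using assms by (auto simp: unimod_def)
qed

definition mcomm :: "mat2 \<Rightarrow> mat2 \<Rightarrow> mat2" where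
  "mcomm A B = A \<odot> B \<odot> minv A \<odot> minv B"

text \<open>A B - B A = X Y - Y X for X = A - 1 and Y = B - 1, so the commutator differs from the
  identity by a product of two small terms. With radius 1/20 and inverses of norm at most 1.47 the
  contraction factor is at most 3/10.\<close>

lemma norm_mcomm:
  assumes "A \<in> unimod" "B \<in> unimod" "norm (A - mone) \<le> 1/20" "norm (B - mone) \<le> 1/20"
  shows "norm (mcomm A B - mone) \<le> norm (B - mone) / 2"
proof -
  let ?X = "A - mone" and ?Y = "B - mone"
  have eq: "mcomm A B - mone = (?X \<odot> ?Y - ?Y \<odot> ?X) \<odot> (minv A \<odot> minv B)"
    using assms unfolding mcomm_def by (simp add: mmul_distrib mmul_assoc)
  have "norm (?X \<odot> ?Y - ?Y \<odot> ?X) \<le> norm (?X \<odot> ?Y) + norm (?Y \<odot> ?X)" by (rule norm_triangle_ineq4)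
  also have "\<dots> \<le> 2 * (norm ?X * norm ?Y)" using norm_mmul[of ?X ?Y] norm_mmul[of ?Y ?X] by (simp add: mult.commute)
  also have "norm ?X * norm ?Y \<le> 1/20 * norm ?Y" using assms by (intro mult_right_mono) auto
  finally have 1: "norm (?X \<odot> ?Y - ?Y \<odot> ?X) \<le> norm ?Y / 10" by simp
  have "norm (minv A \<odot> minv B) \<le> norm A * norm B"
    using norm_mmul[of "minv A" "minv B"] assms by (simp add: norm_minv)
  also have "\<dots> \<le> 1.47 * 1.47"
    using norm_near_one[OF assms(3)] norm_near_one[OF assms(4)] by (intro mult_mono) auto
  finally have 2: "norm (minv A \<odot> minv B) \<le> 3" by simp
  have "norm (mcomm A B - mone) \<le> norm (?X \<odot> ?Y - ?Y \<odot> ?X) * norm (minv A \<odot> minv B)"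
    unfolding eq by (rule norm_mmul)
  also have "\<dots> \<le> norm ?Y / 10 * 3" using 1 2 by (intro mult_mono) auto
  also have "\<dots> \<le> norm ?Y / 2" by simp
  finally show ?thesis .
qed

locale discrete_mats = mat_group +
  assumes finite_ball: "finite {M \<in> \<Gamma>. norm M \<le> C}"
begin

text \<open>Conjugation by the powers of \<open>B\<close> would give infinitely many distinct
  elements 1 + t^k X in a bounded set.\<close>

lemma no_contraction:
  assumes "B \<in> \<Gamma>" "mone + X \<in> \<Gamma>" "X \<noteq> 0" "B \<odot> X \<odot> minv B = t *\<^sub>R X" "0 < t" "t < 1"
  shows False
proof -
  have in_\<Gamma>: "mone + t ^ k *\<^sub>R X \<in> \<Gamma>" for k
  proof (induction k)
    case (Suc k)
    then have "B \<odot> (mone + t ^ k *\<^sub>R X) \<odot> minv B \<in> \<Gamma>" using assms(1) by blast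
    moreover have "B \<odot> (mone + t ^ k *\<^sub>R X) \<odot> minv B = mone + t ^ k *\<^sub>R (B \<odot> X \<odot> minv B)"
      using assms(1) by (simp add: mmul_distrib)
    ultimately show ?case by (simp add: assms(4) mult.commute)
  qed (use assms in simp)
  have "norm (mone + t ^ k *\<^sub>R X) \<le> norm mone + norm X" for k
  proof -
    have "t ^ k \<le> 1" "t ^ k \<ge> 0" using assms by (auto simp: power_le_one)
    then have "norm (t ^ k *\<^sub>R X) \<le> norm X" by (simp add: mult_left_le_one_le)
    then show ?thesis using norm_triangle_ineq[of mone "t ^ k *\<^sub>R X"] by linarith
  qed
  then have sub: "range (\<lambda>k. mone + t ^ k *\<^sub>R X) \<subseteq> {M \<in> \<Gamma>. norm M \<le> norm mone + norm X}"
    using in_\<Gamma> by blast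
  have "inj (\<lambda>k. mone + t ^ k *\<^sub>R X)"
  proof (rule injI)
    fix j k assume "mone + t ^ j *\<^sub>R X = mone + t ^ k *\<^sub>R X"
    then have "t ^ j = t ^ k" using assms by simp
    then show "j = k" using assms power_strict_decreasing[of j k t] power_strict_decreasing[of k j t]
      by (metis linorder_neqE_nat order_less_irrefl)
  qed
  then have "infinite (range (\<lambda>k. mone + t ^ k *\<^sub>R X))" by (rule range_inj_infinite)
  then show False using finite_subset[OF sub finite_ball] by blast
qed

text \<open>\<open>B\<close> is near the identity, so \<open>t\<close> is near 1 and positive.
  Comparing determinants, either t = 1 or the traceless part X of \<open>A\<close> is singular. In
  the second case \<open>A\<close> is the unipotent matrix 1 + X, which \<open>B\<close> or its
  inverse would contract, against discreteness.\<close>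

lemma eigenvalue_one:
  assumes A: "A \<in> \<Gamma>" "norm (A - mone) \<le> 1/20" "tl_part A \<noteq> 0"
    and B: "B \<in> \<Gamma>" "norm (B - mone) \<le> 1/20"
    and eq: "B \<odot> tl_part A \<odot> minv B = t *\<^sub>R tl_part A"
  shows "t = 1"
proof (rule ccontr)
  assume "t \<noteq> 1"
  let ?X = "tl_part A"
  have dA: "mdet A = 1" "mtr A > 0" using near_one_det_tr[of A] A by auto
  have "(t - 1) *\<^sub>R ?X = ((B - mone) \<odot> ?X - ?X \<odot> (B - mone)) \<odot> minv B"
    using eq B by (simp add: mmul_distrib mmul_assoc scaleR_left_diff_distrib)
  then have "\<bar>t - 1\<bar> * norm ?X = norm (((B - mone) \<odot> ?X - ?X \<odot> (B - mone)) \<odot> minv B)"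
    by (metis norm_scaleR)
  also have "\<dots> \<le> norm ((B - mone) \<odot> ?X - ?X \<odot> (B - mone)) * norm B"
    using norm_mmul[of _ "minv B"] norm_minv B by (metis unimod)
  also have "\<dots> \<le> (2 * (1/20 * norm ?X)) * 1.47"
  proof (rule mult_mono)
    have "norm ((B - mone) \<odot> ?X - ?X \<odot> (B - mone)) \<le> norm ((B - mone) \<odot> ?X) + norm (?X \<odot> (B - mone))"
      by (rule norm_triangle_ineq4)
    also have "\<dots> \<le> 2 * (norm (B - mone) * norm ?X)"
      using norm_mmul[of "B - mone" ?X] norm_mmul[of ?X "B - mone"] by (simp add: mult.commute)
    also have "norm (B - mone) * norm ?X \<le> 1/20 * norm ?X" using B by (intro mult_right_mono) auto
    finally show "norm ((B - mone) \<odot> ?X - ?X \<odot> (B - mone)) \<le> 2 * (1/20 * norm ?X)" by simp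
    show "norm B \<le> 1.47" using norm_near_one[OF B(2)] by simp
  qed auto
  also have "\<dots> < 1 * norm ?X" using A by simp
  finally have "\<bar>t - 1\<bar> < 1" using A by simp
  then have "t > 0" by simp
  have "mdet (t *\<^sub>R ?X) = mdet B * mdet ?X * mdet B"
    using arg_cong[OF eq, of mdet] B mdet_minv[of B] by simp
  also have "\<dots> = mdet ?X" using unimodD[of B] B(1) by (simp add: mult.commute flip: mult.assoc)
  finally have "mdet (t *\<^sub>R ?X) = mdet ?X" .
  moreover have "mdet (t *\<^sub>R ?X) = t * t * mdet ?X"
    by (cases ?X) (simp add: algebra_simps)
  ultimately have "t * t = 1 \<or> mdet ?X = 0" by auto
  moreover have "t * t \<noteq> 1" using \<open>t > 0\<close> \<open>t \<noteq> 1\<close> by (auto simp: square_eq_1_iff)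
  ultimately have d0: "mdet ?X = 0" by blast
  have "(mtr A / 2)\<^sup>2 + mdet ?X = mdet A"
    by (cases A) (simp add: tl_part_eq power2_eq_square field_simps)
  then have "(mtr A / 2)\<^sup>2 = 1" using d0 dA by simp
  then have "mtr A / 2 = 1" using dA by (auto simp: power2_eq_1_iff)
  then have A1: "mone + ?X \<in> \<Gamma>" using A(1) decompose_tl_part[of A] by simp
  show False
  proof (cases "t < 1")
    case True
    then show False using no_contraction[OF B(1) A1 A(3) eq \<open>t > 0\<close>] by blast
  next
    case False
    have "minv B \<odot> (B \<odot> ?X \<odot> minv B) \<odot> B = t *\<^sub>R (minv B \<odot> ?X \<odot> B)" unfolding eq by simp
    then have "?X = t *\<^sub>R (minv B \<odot> ?X \<odot> B)" using B by (simp add: mmul_assoc)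
    then have "inverse t *\<^sub>R ?X = minv B \<odot> ?X \<odot> B" using \<open>t > 0\<close>
      by (metis scaleR_scaleR left_inverse order_less_irrefl scaleR_one)
    then have "minv B \<odot> ?X \<odot> minv (minv B) = inverse t *\<^sub>R ?X" using B by simp
    moreover have "0 < inverse t" "inverse t < 1"
      using False \<open>t \<noteq> 1\<close> \<open>t > 0\<close> by (auto simp: inverse_less_1_iff)
    ultimately show False using no_contraction[OF inv[OF B(1)] A1 A(3)] by blast
  qed
qed

text \<open>Zassenhaus' argument: iterated commutators of two elements near the identity tend to the
  identity, so by discreteness they eventually equal it; then one climbs back.\<close>
lemma small_elements_commute:
  assumes A: "A \<in> \<Gamma>" "norm (A - mone) \<le> 1/20" and B: "B \<in> \<Gamma>" "norm (B - mone) \<le> 1/20"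
  shows "A \<odot> B = B \<odot> A"
proof -
  define C where "C = (\<lambda>k. (mcomm A ^^ k) B)"
  have C0: "C 0 = B" and CS: "C (Suc k) = mcomm A (C k)" for k by (auto simp: C_def)
  have C: "C k \<in> \<Gamma> \<and> norm (C k - mone) \<le> (1/2) ^ k / 20" for k
  proof (induction k)
    case (Suc k)
    have "(1/2 :: real) ^ k / 20 \<le> 1/20" by (simp add: power_le_one)
    then have *: "norm (C k - mone) \<le> 1/20" using Suc by linarith
    have "C (Suc k) \<in> \<Gamma>" using Suc A unfolding CS mcomm_def by blast
    moreover have "norm (C (Suc k) - mone) \<le> norm (C k - mone) / 2"
      unfolding CS using norm_mcomm[OF _ _ A(2) *] A Suc by auto
    ultimately show ?case using Suc by simp
  qed (use B C0 in simp)
  have small: "norm (C k - mone) \<le> 1/20" for k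
  proof -
    have "(1/2 :: real) ^ k / 20 \<le> 1/20" by (simp add: power_le_one)
    then show ?thesis using C[of k] by linarith
  qed
  have "\<exists>k. C k = mone"
  proof (rule ccontr)
    assume no: "\<nexists>k. C k = mone"
    let ?F = "(\<lambda>M. norm (M - mone)) ` ({M \<in> \<Gamma>. norm M \<le> 2} - {mone})"
    have F: "finite ?F" using finite_ball[of 2] by auto
    have mem: "norm (C k - mone) \<in> ?F" for k
      using C no norm_near_one[OF small[of k]] by auto
    define \<delta> where "\<delta> = Min ?F"
    have "\<delta> \<in> ?F" unfolding \<delta>_def using F mem by (intro Min_in) auto
    then have "\<delta> > 0" by auto
    then obtain k where "(1/2 :: real) ^ k < \<delta>" using real_arch_pow_inv[of \<delta> "1/2"] by auto
    moreover have "\<delta> \<le> norm (C k - mone)" unfolding \<delta>_def using F mem by (intro Min_le) auto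
    moreover have "norm (C k - mone) \<le> (1/2) ^ k / 20" using C by blast
    moreover have "(1/2 :: real) ^ k / 20 \<le> (1/2) ^ k" by simp
    ultimately show False by linarith
  qed
  then obtain k where k: "C k = mone" ..
  \<comment> \<open>\<open>C (Suc j)\<close> is \<open>A\<close> times the inverse of Y = C j A (C
    j)^-1. If \<open>A\<close> commutes with it, then \<open>A\<close> commutes with Y, so
    conjugation by \<open>C j\<close> rescales the traceless part of \<open>A\<close>; by
    \<open>eigenvalue_one\<close> the factor is 1.\<close>
  have down: "A \<odot> C j = C j \<odot> A" if "A \<odot> C (Suc j) = C (Suc j) \<odot> A" for j
  proof (cases "tl_part A = 0")
    case True
    then show ?thesis by (subst commute_tl_part) (cases "C j", simp add: zero_prod_def)
  next
    case False
    let ?C = "C j" and ?Y = "C j \<odot> A \<odot> minv (C j)"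
    have u: "A \<in> unimod" "?C \<in> unimod" using A C by auto
    have Yi: "minv ?Y = ?C \<odot> minv A \<odot> minv ?C" using u by (simp add: minv_mmul mmul_assoc)
    have K: "C (Suc j) = A \<odot> minv ?Y" unfolding CS mcomm_def Yi by (simp add: mmul_assoc)
    have "minv A \<odot> (A \<odot> (A \<odot> minv ?Y)) = minv A \<odot> (A \<odot> minv ?Y \<odot> A)" using that unfolding K by simp
    then have comm: "A \<odot> minv ?Y = minv ?Y \<odot> A" using u by (simp add: mmul_assoc)
    have uY: "?Y \<in> unimod" using u by simp
    have "?Y \<odot> (A \<odot> minv ?Y) \<odot> ?Y = ?Y \<odot> (minv ?Y \<odot> A) \<odot> ?Y" unfolding comm ..
    then have "?Y \<odot> A \<odot> (minv ?Y \<odot> ?Y) = (?Y \<odot> minv ?Y) \<odot> A \<odot> ?Y" by (simp only: mmul_assoc)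
    then have "A \<odot> ?Y = ?Y \<odot> A" using uY by simp
    then obtain t where "tl_part ?Y = t *\<^sub>R tl_part A" using commute_imp_parallel False by blast
    then have eq: "?C \<odot> tl_part A \<odot> minv ?C = t *\<^sub>R tl_part A" using u by (simp add: tl_part_conj)
    have "t = 1" using eigenvalue_one[OF A False _ small eq] C by blast
    then have "?C \<odot> tl_part A \<odot> minv ?C \<odot> ?C = tl_part A \<odot> ?C" using eq by simp
    then have "tl_part A \<odot> ?C = ?C \<odot> tl_part A" using u by (simp add: mmul_assoc)
    then show ?thesis by (subst commute_tl_part)
  qed
  have "A \<odot> C (k - j) = C (k - j) \<odot> A" for j
  proof (induction j)
    case (Suc j)
    show ?case
    proof (cases "j < k")
      case True
      then have "Suc (k - Suc j) = k - j" by simp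
      then show ?thesis using Suc down[of "k - Suc j"] by simp
    qed (use Suc in simp)
  qed (simp add: k)
  from this[of k] show ?thesis by (simp add: C0)
qed

end

text \<open>An infinite bounded piece has an accumulation point, and translations move it to every
  element. The group is then a nonempty closed set without isolated points, and Baire's theorem
  forbids removing its countably many points one by one until nothing is left.\<close>

lemma (in mat_group) countable_closed_imp_discrete:
  assumes closed: "closed \<Gamma>" and count: "countable \<Gamma>"
  shows "discrete_mats \<Gamma>"
proof unfold_locales
  fix C show "finite {M \<in> \<Gamma>. norm M \<le> C}"
  proof (rule ccontr)
    let ?S = "{M \<in> \<Gamma>. norm M \<le> C}"
    assume inf: "infinite ?S"
    have "?S = \<Gamma> \<inter> cball 0 C" by auto
    then have "compact ?S" using closed by (simp add: closed_Int_compact)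
    then obtain L where "L \<in> ?S" "L islimpt ?S"
      using inf unfolding compact_eq_Bolzano_Weierstrass by blast
    then have L: "L \<in> \<Gamma>" "L islimpt \<Gamma>" using islimpt_subset[of L ?S \<Gamma>] by auto
    have lim: "M islimpt \<Gamma>" if M: "M \<in> \<Gamma>" for M
    proof -
      obtain f where f: "\<And>n. f n \<in> \<Gamma> - {L}" "f \<longlonglongrightarrow> L" using L(2) unfolding islimpt_sequential by blast
      let ?K = "M \<odot> minv L"
      have K: "?K \<in> \<Gamma>" "?K \<in> unimod" using M L by auto
      have "(\<lambda>n. ?K \<odot> f n) \<longlonglongrightarrow> ?K \<odot> L" by (intro tendsto_mmul f tendsto_const)
      then have "(\<lambda>n. ?K \<odot> f n) \<longlonglongrightarrow> M" using L by (simp add: mmul_assoc)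
      moreover have "?K \<odot> f n \<in> \<Gamma> - {M}" for n
      proof -
        have "?K \<odot> f n \<noteq> M"
        proof
          assume "?K \<odot> f n = M"
          then have "minv ?K \<odot> (?K \<odot> f n) = minv ?K \<odot> M" by simp
          then have "f n = minv ?K \<odot> M" using K by simp
          then show False using f(1)[of n] L M by (simp add: minv_mmul mmul_assoc)
        qed
        then show ?thesis using K f(1)[of n] by auto
      qed
      ultimately show ?thesis unfolding islimpt_sequential
        by (intro exI[of _ "\<lambda>n. ?K \<odot> f n"] conjI allI)
    qed
    have "\<Gamma> \<subseteq> closure (\<Inter>((\<lambda>x. \<Gamma> - {x}) ` \<Gamma>))"
    proof (rule Baire[OF closed])
      show "countable ((\<lambda>x. \<Gamma> - {x}) ` \<Gamma>)" using count by simp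
      fix T assume "T \<in> (\<lambda>x. \<Gamma> - {x}) ` \<Gamma>"
      then obtain x where x: "x \<in> \<Gamma>" "T = \<Gamma> - {x}" by blast
      have op: "openin (top_of_set \<Gamma>) T"
        unfolding x(2) Diff_eq by (intro openin_open_Int open_Compl closed_singleton)
      have cl: "y \<in> closure T" if "y \<in> \<Gamma>" for y
      proof (cases "y = x")
        case True
        have "x islimpt \<Gamma> - {x}" using lim[OF x(1)] islimpt_punctured by blast
        then show ?thesis unfolding closure_def True x(2) by blast
      next
        case False
        then have "y \<in> T" using x(2) that by simp
        then show ?thesis using closure_subset[of T] by (rule rev_subsetD)
      qed
      show "openin (top_of_set \<Gamma>) T \<and> \<Gamma> \<subseteq> closure T"
        by (rule conjI[OF op subsetI[OF cl]])
    qed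
    moreover have "\<Inter>((\<lambda>x. \<Gamma> - {x}) ` \<Gamma>) = {}" using one by blast
    ultimately show False using one by auto
  qed
qed

section \<open>Limits of discrete reflection groups\<close>

text \<open>Chabauty convergence in sequential form. The second clause ranges over subsequences
  because elements are extracted from infinitely many, not from almost all, of the groups.\<close>

definition mconv :: "(nat \<Rightarrow> mat2 set) \<Rightarrow> mat2 set \<Rightarrow> bool" where
  "mconv \<Gamma> H \<longleftrightarrow>
     (\<forall>M\<in>H. \<exists>m. (\<forall>n. m n \<in> \<Gamma> n) \<and> m \<longlonglongrightarrow> M) \<and>
     (\<forall>r m M. strict_mono r \<and> (\<forall>k. m k \<in> \<Gamma> (r k)) \<and> m \<longlonglongrightarrow> M \<longrightarrow> M \<in> H)"

lemma mconv_approx: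
  assumes "mconv \<Gamma> H" "M \<in> H" obtains m where "\<And>n. m n \<in> \<Gamma> n" "m \<longlonglongrightarrow> M"
  using assms unfolding mconv_def by blast

lemma mconv_limit:
  assumes "mconv \<Gamma> H" "strict_mono r" "\<And>k. m k \<in> \<Gamma> (r k)" "m \<longlonglongrightarrow> M" shows "M \<in> H"
  using assms unfolding mconv_def by blast

text \<open>This is K^-1 \<Gamma> K. In this direction the base point i of the new group plays the
  role of the image of i under \<open>K\<close> for the old one.\<close>

definition cj :: "mat2 \<Rightarrow> mat2 set \<Rightarrow> mat2 set" where
  "cj K \<Gamma> = {M. K \<odot> M \<odot> minv K \<in> \<Gamma>}"

lemma cj_iff: "M \<in> cj K \<Gamma> \<longleftrightarrow> K \<odot> M \<odot> minv K \<in> \<Gamma>"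
  by (simp add: cj_def)

lemma conj_in_cj: "K \<in> unimod \<Longrightarrow> minv K \<odot> M \<odot> K \<in> cj K \<Gamma> \<longleftrightarrow> M \<in> \<Gamma>"
  by (simp add: cj_def mmul_assoc)

lemma refl_mat_conj': "refl_mat R \<Longrightarrow> K \<in> unimod \<Longrightarrow> refl_mat (K \<odot> R \<odot> minv K)"
  using refl_mat_conj[of R "minv K"] by simp

lemma unimod_conj_iff: "K \<in> unimod \<Longrightarrow> K \<odot> M \<odot> minv K \<in> unimod \<longleftrightarrow> M \<in> unimod"
  by (auto simp: unimod_def mdet_minv)

lemma mat_group_cj:
  assumes "mat_group \<Gamma>" "K \<in> unimod" shows "mat_group (cj K \<Gamma>)"
proof -
  interpret mat_group \<Gamma> by fact
  show ?thesis
  proof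
    show "cj K \<Gamma> \<subseteq> unimod"
      using unimod_conj_iff[OF assms(2)] subset unfolding cj_def by blast
    show "mone \<in> cj K \<Gamma>" using assms(2) by (simp add: cj_def)
    fix A assume A: "A \<in> cj K \<Gamma>"
    show "- A \<in> cj K \<Gamma>" using A neg by (simp add: cj_def)
    have "A \<in> unimod" using A unimod_conj_iff[OF assms(2)] subset unfolding cj_def by blast
    then have "minv (K \<odot> A \<odot> minv K) = K \<odot> minv A \<odot> minv K"
      using assms(2) by (simp add: minv_mmul mmul_assoc)
    then show "minv A \<in> cj K \<Gamma>" using A inv unfolding cj_def by (metis mem_Collect_eq)
    fix B assume B: "B \<in> cj K \<Gamma>"
    have "K \<odot> (A \<odot> B) \<odot> minv K = (K \<odot> A \<odot> minv K) \<odot> (K \<odot> B \<odot> minv K)"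
      using assms(2) by (simp add: mmul_assoc)
    then show "A \<odot> B \<in> cj K \<Gamma>" using A B mul unfolding cj_def by (metis mem_Collect_eq)
  qed
qed

lemma discrete_mats_cj:
  assumes "discrete_mats \<Gamma>" "K \<in> unimod" shows "discrete_mats (cj K \<Gamma>)"
proof -
  interpret discrete_mats \<Gamma> by fact
  interpret cj: mat_group "cj K \<Gamma>" by (rule mat_group_cj) (unfold_locales, fact)
  show ?thesis
  proof
    fix C
    let ?f = "\<lambda>M. K \<odot> M \<odot> minv K"
    have "?f ` {M \<in> cj K \<Gamma>. norm M \<le> C} \<subseteq> {M \<in> \<Gamma>. norm M \<le> norm K * \<bar>C\<bar> * norm K}"
    proof (rule image_subsetI)
      fix M assume M: "M \<in> {M \<in> cj K \<Gamma>. norm M \<le> C}"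
      have "norm (?f M) \<le> norm (K \<odot> M) * norm (minv K)" by (rule norm_mmul)
      also have "\<dots> \<le> norm K * norm M * norm K"
        using norm_mmul[of K M] norm_minv[OF assms(2)] by (simp add: mult_right_mono)
      also have "\<dots> \<le> norm K * \<bar>C\<bar> * norm K"
        using M by (intro mult_right_mono mult_left_mono) auto
      finally show "?f M \<in> {M \<in> \<Gamma>. norm M \<le> norm K * \<bar>C\<bar> * norm K}"
        using M unfolding cj_def by blast
    qed
    then have "finite (?f ` {M \<in> cj K \<Gamma>. norm M \<le> C})" using finite_ball finite_subset by blast
    moreover have "inj_on ?f {M \<in> cj K \<Gamma>. norm M \<le> C}"
    proof (rule inj_onI)
      fix A B assume "?f A = ?f B"
      then have "minv K \<odot> ?f A \<odot> K = minv K \<odot> ?f B \<odot> K" by simp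
      then show "A = B" using assms(2) by (simp add: mmul_assoc)
    qed
    ultimately show "finite {M \<in> cj K \<Gamma>. norm M \<le> C}" by (rule finite_imageD)
  qed
qed

lemma refl_gen_cj:
  assumes "K \<in> unimod" "M \<in> refl_gen \<Gamma>" shows "minv K \<odot> M \<odot> K \<in> refl_gen (cj K \<Gamma>)"
  using assms(2)
proof (induction rule: refl_gen.induct)
  case (one M)
  then show ?case using assms(1) by (intro refl_gen.one) auto
next
  case (mul R M)
  have "(minv K \<odot> R \<odot> K) \<odot> (minv K \<odot> M \<odot> K) \<in> refl_gen (cj K \<Gamma>)"
    by (rule refl_gen.mul[OF _ refl_mat_conj]) (use mul assms(1) conj_in_cj in auto)
  then show ?case using assms(1) by (simp add: mmul_assoc)
qed

lemma generated_cj: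
  assumes "K \<in> unimod" "\<Gamma> \<subseteq> refl_gen \<Gamma>" shows "cj K \<Gamma> \<subseteq> refl_gen (cj K \<Gamma>)"
proof
  fix M assume "M \<in> cj K \<Gamma>"
  then have "K \<odot> M \<odot> minv K \<in> refl_gen \<Gamma>" using assms(2) by (auto simp: cj_def)
  from refl_gen_cj[OF assms(1) this] show "M \<in> refl_gen (cj K \<Gamma>)"
    using assms(1) by (simp add: mmul_assoc)
qed

lemma tendsto_minv: "(f \<longlongrightarrow> A) F \<Longrightarrow> ((\<lambda>x. minv (f x)) \<longlongrightarrow> minv A) F"
proof -
  have eq: "minv A = (fst A * snd (snd (snd A)) - fst (snd A) * fst (snd (snd A))) *\<^sub>R
      (snd (snd (snd A)), - fst (snd A), - fst (snd (snd A)), fst A)" for A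
    by (cases A) simp
  assume "(f \<longlongrightarrow> A) F"
  then show ?thesis unfolding eq by (intro tendsto_intros)
qed

lemma tendsto_mdet: "(f \<longlongrightarrow> A) F \<Longrightarrow> ((\<lambda>x. mdet (f x)) \<longlongrightarrow> mdet A) F"
proof -
  have eq: "mdet A = fst A * snd (snd (snd A)) - fst (snd A) * fst (snd (snd A))" for A
    by (cases A) simp
  assume "(f \<longlongrightarrow> A) F"
  then show ?thesis unfolding eq by (intro tendsto_intros)
qed

lemma tendsto_mtr: "(f \<longlongrightarrow> A) F \<Longrightarrow> ((\<lambda>x. mtr (f x)) \<longlongrightarrow> mtr A) F"
proof -
  have eq: "mtr A = fst A + snd (snd (snd A))" for A
    by (cases A) simp
  assume "(f \<longlongrightarrow> A) F"
  then show ?thesis unfolding eq by (intro tendsto_intros)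
qed

lemma refl_mat_limit:
  assumes "\<And>n. refl_mat (R n)" "R \<longlonglongrightarrow> L" shows "refl_mat L"
proof -
  have "(\<lambda>n. mtr (R n)) \<longlonglongrightarrow> mtr L" "(\<lambda>n. mdet (R n)) \<longlonglongrightarrow> mdet L"
    using assms(2) by (rule tendsto_mtr tendsto_mdet)+
  moreover have "mtr (R n) = 0" "mdet (R n) = - 1" for n using assms(1) by (auto simp: refl_mat_def)
  ultimately show ?thesis by (simp add: refl_mat_def LIMSEQ_const_iff)
qed

lemma mconv_cj:
  assumes conv: "mconv \<Gamma> H" and C: "\<And>n. C n \<in> unimod" "C \<longlonglongrightarrow> K" "K \<in> unimod"
  shows "mconv (\<lambda>n. cj (C n) (\<Gamma> n)) (cj K H)"
  unfolding mconv_def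
proof (intro conjI ballI allI impI)
  fix M assume "M \<in> cj K H"
  then obtain m where m: "\<And>n. m n \<in> \<Gamma> n" "m \<longlonglongrightarrow> K \<odot> M \<odot> minv K"
    using mconv_approx[OF conv] unfolding cj_def by blast
  have "(\<lambda>n. minv (C n) \<odot> m n \<odot> C n) \<longlonglongrightarrow> minv K \<odot> (K \<odot> M \<odot> minv K) \<odot> K"
    by (intro tendsto_mmul tendsto_minv C m)
  then have "(\<lambda>n. minv (C n) \<odot> m n \<odot> C n) \<longlonglongrightarrow> M" using C(3) by (simp add: mmul_assoc)
  moreover have "minv (C n) \<odot> m n \<odot> C n \<in> cj (C n) (\<Gamma> n)" for n
    using m(1) C(1) by (simp add: conj_in_cj)
  ultimately show "\<exists>m. (\<forall>n. m n \<in> cj (C n) (\<Gamma> n)) \<and> m \<longlonglongrightarrow> M"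
    by (intro exI[of _ "\<lambda>n. minv (C n) \<odot> m n \<odot> C n"] conjI allI)
next
  fix r m M assume *: "strict_mono r \<and> (\<forall>k. m k \<in> cj (C (r k)) (\<Gamma> (r k))) \<and> m \<longlonglongrightarrow> M"
  have "(\<lambda>k. C (r k)) \<longlonglongrightarrow> K" using LIMSEQ_subseq_LIMSEQ[OF C(2), of r] * by (simp add: comp_def)
  then have "(\<lambda>k. C (r k) \<odot> m k \<odot> minv (C (r k))) \<longlonglongrightarrow> K \<odot> M \<odot> minv K"
    using * by (intro tendsto_mmul tendsto_minv) auto
  moreover have "C (r k) \<odot> m k \<odot> minv (C (r k)) \<in> \<Gamma> (r k)" for k using * by (simp add: cj_def)
  ultimately show "M \<in> cj K H" unfolding cj_iff using * by (intro mconv_limit[OF conv, of r]) auto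
qed

text \<open>The curve \<open>t + i (1 + t)\<close> meets every wall in finitely many points.\<close>
lemma exists_off_walls:
  assumes "countable \<Gamma>" "\<epsilon> > 0"
  shows "\<exists>C. C \<in> unimod \<and> norm (C - mone) < \<epsilon> \<and> (\<forall>R\<in>\<Gamma>. refl_mat R \<longrightarrow> hgt R C \<noteq> 0)"
proof -
  define C where "C = (\<lambda>t::real. (sqrt (1 + t), t / sqrt (1 + t), 0::real, 1 / sqrt (1 + t)))"
  define bad where "bad R = {t. t > 0 \<and> hgt R (C t) = 0}" for R
  have fin: "finite (bad R)" if "refl_mat R" for R
  proof -
    obtain a b c d where R: "R = (a, b, c, d)" by (cases R)
    have r: "a = - d" "d * d + b * c = 1" using that by (auto simp: R refl_mat_iff)
    \<comment> \<open>\<open>C t\<close> maps i to t + i (1 + t); the polynomial is the numerator of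
      the wall equation at that point. It vanishes identically only if b, c and d are all 0.\<close>
    let ?p = "[:c - b, 2 * c + 2 * d, 2 * c:] :: real poly"
    have "?p \<noteq> 0"
    proof
      assume "?p = 0"
      then have "c = 0" "b = 0" "d = 0" by auto
      then show False using r by simp
    qed
    then have F: "finite {t. poly ?p t = 0}" by (rule poly_roots_finite)
    have sub: "poly ?p t = 0" if t: "t \<in> bad R" for t
    proof -
      define s where "s = sqrt (1 + t)"
      have s: "s > 0" "s\<^sup>2 = 1 + t" using t by (auto simp: bad_def s_def)
      have "0 = s\<^sup>2 * hgt R (C t)" using t by (simp add: bad_def)
      also have "\<dots> = s\<^sup>2 * (c * (s\<^sup>2 + (t / s)\<^sup>2) + (d - a) * (t / s * (1 / s)) - b * (1 / s)\<^sup>2)"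
        by (simp add: R C_def s_def[symmetric])
      also have "\<dots> = c * (s\<^sup>2 * s\<^sup>2 + t\<^sup>2) + (d - a) * t - b"
        using s(1) by (simp add: power2_eq_square field_simps)
      also have "\<dots> = poly ?p t"
        unfolding s(2) using r by (simp add: power2_eq_square algebra_simps)
      finally show ?thesis by simp
    qed
    show ?thesis by (rule finite_subset[OF _ F]) (use sub in blast)
  qed
  have "(C \<longlongrightarrow> C 0) (at_right 0)"
    unfolding C_def by (auto intro!: tendsto_eq_intros)
  then have "eventually (\<lambda>t. dist (C t) (C 0) < \<epsilon>) (at_right 0)"
    using assms(2) by (rule tendstoD)
  then obtain \<delta> where \<delta>: "\<delta> > 0" "\<And>t. 0 < t \<Longrightarrow> t < \<delta> \<Longrightarrow> dist (C t) (C 0) < \<epsilon>"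
    unfolding eventually_at_right_field by auto
  let ?B = "\<Union>R\<in>{R\<in>\<Gamma>. refl_mat R}. bad R"
  have "countable ?B" using assms(1) fin by (intro countable_UN) (auto intro: countable_finite)
  then have "uncountable ({0<..<\<delta>} - ?B)" using \<delta>(1) by (intro uncountable_minus_countable) (auto simp: uncountable_open_interval)
  then have "{0<..<\<delta>} - ?B \<noteq> {}" by (intro notI) (simp only: countable_empty not_True_eq_False)
  then obtain t where t: "t \<in> {0<..<\<delta>}" "t \<notin> ?B" by blast
  have "C 0 = mone" by (simp add: C_def mone_def)
  then have "norm (C t - mone) < \<epsilon>" using \<delta>(2)[of t] t by (simp add: dist_norm)
  moreover have "C t \<in> unimod" using t by (simp add: C_def unimod_def)
  moreover have "\<forall>R\<in>\<Gamma>. refl_mat R \<longrightarrow> hgt R (C t) \<noteq> 0" using t by (auto simp: bad_def)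
  ultimately show ?thesis by blast
qed

lemma (in discrete_mats) countable: "countable \<Gamma>"
proof -
  have "M \<in> (\<Union>n::nat. {M \<in> \<Gamma>. norm M \<le> real n})" if "M \<in> \<Gamma>" for M
  proof -
    obtain n :: nat where "norm M \<le> real n" using real_arch_simple by blast
    then show ?thesis using that by blast
  qed
  then have "\<Gamma> = (\<Union>n::nat. {M \<in> \<Gamma>. norm M \<le> real n})" by blast
  also have "countable \<dots>" 
    by (rule countable_UN[OF countableI_type countable_finite[OF finite_ball]])
  finally show ?thesis .
qed

text \<open>Conjugate by elements that tend to the identity and move the base point off all walls.\<close>
lemma mconv_off_walls:
  assumes conv: "mconv \<Gamma> H" and \<Gamma>: "\<And>n. discrete_mats (\<Gamma> n)" "\<And>n. \<Gamma> n \<subseteq> refl_gen (\<Gamma> n)"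
  shows "\<exists>\<Gamma>'. mconv \<Gamma>' H \<and> (\<forall>n. reflection_mats (\<Gamma>' n))"
proof -
  have "\<exists>C. C \<in> unimod \<and> norm (C - mone) < 1 / real (Suc n) \<and> (\<forall>R\<in>\<Gamma> n. refl_mat R \<longrightarrow> hgt R C \<noteq> 0)" for n
    using exists_off_walls[of "\<Gamma> n" "1 / real (Suc n)"] discrete_mats.countable[OF \<Gamma>(1)] by simp
  then obtain C where C: "\<And>n. C n \<in> unimod" "\<And>n. norm (C n - mone) < 1 / real (Suc n)"
    "\<And>n R. R \<in> \<Gamma> n \<Longrightarrow> refl_mat R \<Longrightarrow> hgt R (C n) \<noteq> 0" by metis
  have "(\<lambda>n. norm (C n - mone)) \<longlonglongrightarrow> 0"
    by (rule tendsto_sandwich[OF _ _ tendsto_const LIMSEQ_inverse_real_of_nat])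
       (use C(2) in \<open>auto simp: inverse_eq_divide intro!: always_eventually less_imp_le\<close>)
  then have lim: "C \<longlonglongrightarrow> mone" by (simp add: tendsto_norm_zero_iff LIM_zero_iff)
  have cj1: "cj mone H = H" by (simp add: cj_def)
  have "mconv (\<lambda>n. cj (C n) (\<Gamma> n)) H"
    using mconv_cj[OF conv C(1) lim] by (simp add: cj1)
  moreover have "reflection_mats (cj (C n) (\<Gamma> n))" for n
  proof -
    interpret d: discrete_mats "cj (C n) (\<Gamma> n)" using \<Gamma>(1) C(1) by (rule discrete_mats_cj)
    show ?thesis
    proof
      fix R assume R: "R \<in> cj (C n) (\<Gamma> n)" "refl_mat R"
      let ?R = "C n \<odot> R \<odot> minv (C n)"
      have "hgt ?R (C n) \<noteq> 0" using C(3)[of ?R n] R refl_mat_conj'[OF R(2) C(1)] by (simp add: cj_iff)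
      then show "hgt R mone \<noteq> 0" using hgt_conj[OF C(1), of n ?R mone] C(1)[of n]
        by (auto simp: mmul_assoc unimod_def)
    qed (use d.finite_ball generated_cj[OF C(1) \<Gamma>(2)] in auto)
  qed
  ultimately show ?thesis by (intro exI[of _ "\<lambda>n. cj (C n) (\<Gamma> n)"]) auto
qed

lemma limit_small_commute:
  assumes conv: "mconv \<Gamma> H" and \<Gamma>: "\<And>n. discrete_mats (\<Gamma> n)"
    and A: "A \<in> H" "norm (A - mone) < 1/20" and B: "B \<in> H" "norm (B - mone) < 1/20"
  shows "A \<odot> B = B \<odot> A"
proof -
  obtain a where a: "\<And>n. a n \<in> \<Gamma> n" "a \<longlonglongrightarrow> A" using mconv_approx[OF conv A(1)] by blast
  obtain b where b: "\<And>n. b n \<in> \<Gamma> n" "b \<longlonglongrightarrow> B" using mconv_approx[OF conv B(1)] by blast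
  have "(\<lambda>n. norm (a n - mone)) \<longlonglongrightarrow> norm (A - mone)" "(\<lambda>n. norm (b n - mone)) \<longlonglongrightarrow> norm (B - mone)"
    by (intro tendsto_intros a b)+
  then have "eventually (\<lambda>n. norm (a n - mone) < 1/20) sequentially"
    "eventually (\<lambda>n. norm (b n - mone) < 1/20) sequentially"
    using A(2) B(2) by (blast dest: order_tendstoD(2))+
  then have ev: "eventually (\<lambda>n. a n \<odot> b n = b n \<odot> a n) sequentially"
    by eventually_elim (use discrete_mats.small_elements_commute[OF \<Gamma> a(1) _ b(1)] in auto)
  have "(\<lambda>n. a n \<odot> b n) \<longlonglongrightarrow> A \<odot> B" "(\<lambda>n. b n \<odot> a n) \<longlonglongrightarrow> B \<odot> A"
    by (intro tendsto_mmul a b)+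
  then show ?thesis using LIMSEQ_unique[OF Lim_transform_eventually[OF _ ev]] by blast
qed

section \<open>Limits that are not discrete\<close>

lemma strict_mono_choice:
  assumes "\<And>j N. \<exists>n>N. P j n"
  shows "\<exists>r::nat \<Rightarrow> nat. strict_mono r \<and> (\<forall>j. P j (r j))"
proof -
  have "\<exists>r. \<forall>j. P j (r j) \<and> r j < r (Suc j)"
    using assms by (intro dependent_nat_choice) blast+
  then show ?thesis by (auto intro!: strict_monoI_Suc)
qed

lemma bounded_subseq:
  fixes f :: "nat \<Rightarrow> 'a::heine_borel"
  assumes "bounded (range f)"
  obtains s l where "strict_mono s" "(\<lambda>n. f (s n)) \<longlonglongrightarrow> l"
  using bounded_imp_convergent_subsequence[OF assms] by (auto simp: comp_def)

text \<open>Nontrivial elements of the approximating groups that tend to the identity each admit a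
  reflection lowering their norm. These reflections stay bounded, and a limit L of them has norm at
  most that of the identity, so by the sign rule the square of its height at i is at most 0.\<close>

lemma limit_wall_through_base:
  assumes conv: "mconv \<Gamma> H" and \<Gamma>: "\<And>n. reflection_mats (\<Gamma> n)"
    and nd: "\<And>\<epsilon>. \<epsilon> > 0 \<Longrightarrow> \<exists>A\<in>H. A \<noteq> mone \<and> A \<noteq> - mone \<and> norm (A - mone) < \<epsilon>"
  shows "\<exists>R\<in>H. refl_mat R \<and> hgt R mone = 0"
proof -
  have "\<exists>n>N. \<exists>M\<in>\<Gamma> n. M \<noteq> mone \<and> M \<noteq> - mone \<and> norm (M - mone) < 1 / real (Suc j)" for j N
  proof -
    obtain A where A: "A \<in> H" "A \<noteq> mone" "A \<noteq> - mone" "norm (A - mone) < 1 / real (Suc j)"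
      using nd[of "1 / real (Suc j)"] by auto
    obtain a where a: "\<And>n. a n \<in> \<Gamma> n" "a \<longlonglongrightarrow> A" using mconv_approx[OF conv A(1)] by blast
    have "(\<lambda>n. norm (a n - mone)) \<longlonglongrightarrow> norm (A - mone)" by (intro tendsto_intros a)
    then have "eventually (\<lambda>n. norm (a n - mone) < 1 / real (Suc j)) sequentially"
      using A(4) by (rule order_tendstoD(2))
    moreover have "eventually (\<lambda>n. a n \<noteq> mone) sequentially" "eventually (\<lambda>n. a n \<noteq> - mone) sequentially"
      using a(2) A by (auto intro: tendsto_imp_eventually_ne)
    ultimately have "eventually (\<lambda>n. a n \<noteq> mone \<and> a n \<noteq> - mone \<and> norm (a n - mone) < 1 / real (Suc j)) sequentially"
      by eventually_elim blast
    then obtain n0 where n0: "\<And>n. n \<ge> n0 \<Longrightarrow> a n \<noteq> mone \<and> a n \<noteq> - mone \<and> norm (a n - mone) < 1 / real (Suc j)"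
      unfolding eventually_sequentially by blast
    then show ?thesis using a(1) by (intro exI[of _ "Suc (max n0 N)"] conjI bexI[of _ "a (Suc (max n0 N))"]) auto
  qed
  from strict_mono_choice[of "\<lambda>j n. \<exists>M\<in>\<Gamma> n. M \<noteq> mone \<and> M \<noteq> - mone \<and> norm (M - mone) < 1 / real (Suc j)", OF this]
  obtain r where r: "strict_mono r"
    "\<And>j. \<exists>M\<in>\<Gamma> (r j). M \<noteq> mone \<and> M \<noteq> - mone \<and> norm (M - mone) < 1 / real (Suc j)"
    by blast
  then obtain M where M: "\<And>j. M j \<in> \<Gamma> (r j)" "\<And>j. M j \<noteq> mone" "\<And>j. M j \<noteq> - mone"
    "\<And>j. norm (M j - mone) < 1 / real (Suc j)" by metis
  have "(\<lambda>n. norm (M n - mone)) \<longlonglongrightarrow> 0"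
    by (rule tendsto_sandwich[OF _ _ tendsto_const LIMSEQ_inverse_real_of_nat])
       (use M(4) in \<open>auto simp: inverse_eq_divide intro!: always_eventually less_imp_le\<close>)
  then have Mlim: "M \<longlonglongrightarrow> mone" by (simp add: tendsto_norm_zero_iff LIM_zero_iff)
  have "\<exists>R\<in>\<Gamma> (r j). refl_mat R \<and> norm (R \<odot> M j) < norm (M j)" for j
    using reflection_mats.all_descend[OF \<Gamma> M(1)[of j]] M(2,3)[of j] by (cases rule: descends.cases) auto
  then obtain R where R: "\<And>j. R j \<in> \<Gamma> (r j)" "\<And>j. refl_mat (R j)" "\<And>j. norm (R j \<odot> M j) < norm (M j)"
    by metis
  have Mu: "M j \<in> unimod" for j using M(1)[of j] \<Gamma>[of "r j"]
    by (meson mat_group.unimod reflection_mats.axioms(1))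
  have "norm (R j) \<le> 9" for j
  proof -
    have "norm (M j) \<le> 3"
    proof -
      have "1 / real (Suc j) \<le> 1" by simp
      then have "norm (M j - mone) \<le> 1" using M(4)[of j] by linarith
      then show ?thesis using norm_near_one[of "M j" 1] by simp
    qed
    have "R j = R j \<odot> M j \<odot> minv (M j)" using Mu by (simp add: mmul_assoc)
    then have "norm (R j) \<le> norm (R j \<odot> M j) * norm (minv (M j))" by (metis norm_mmul)
    also have "\<dots> \<le> 3 * 3"
      using R(3)[of j] \<open>norm (M j) \<le> 3\<close> norm_minv[OF Mu] by (intro mult_mono) auto
    finally show ?thesis by simp
  qed
  then have "bounded (range R)" by (auto simp: bounded_iff)
  then obtain s L where s: "strict_mono s" "(\<lambda>n. R (s n)) \<longlonglongrightarrow> L" by (rule bounded_subseq)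
  have "L \<in> H"
    by (rule mconv_limit[OF conv, of "\<lambda>n. r (s n)" "\<lambda>n. R (s n)"])
       (use r(1) s R in \<open>auto simp: strict_mono_def\<close>)
  moreover have L: "refl_mat L" by (rule refl_mat_limit[OF _ s(2)]) (rule R)
  moreover have "hgt L mone = 0"
  proof -
    have Ms: "(\<lambda>n. M (s n)) \<longlonglongrightarrow> mone" using LIMSEQ_subseq_LIMSEQ[OF Mlim s(1)] by (simp add: comp_def)
    have "norm (L \<odot> mone) \<le> norm mone"
    proof (rule LIMSEQ_le)
      show "(\<lambda>n. norm (R (s n) \<odot> M (s n))) \<longlonglongrightarrow> norm (L \<odot> mone)"
        by (intro tendsto_norm tendsto_mmul s Ms)
      show "(\<lambda>n. norm (M (s n))) \<longlonglongrightarrow> norm mone" by (intro tendsto_norm Ms)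
    qed (use R(3) less_imp_le in blast)
    then have "(norm (L \<odot> mone))\<^sup>2 \<le> (norm mone)\<^sup>2" by (intro power_mono) auto
    then have "hgt L mone * hgt L mone \<le> 0" using norm_refl_mmul[OF L, of mone] by linarith
    then show ?thesis by (metis mult_eq_0_iff order_antisym zero_le_square)
  qed
  ultimately show ?thesis by blast
qed

text \<open>The test matrices move i to i, 1 + i and 4 i, and the heights of a traceless matrix at
  these three points determine it.\<close>

lemma exists_nonsymmetric_conj:
  assumes "X \<noteq> 0" "mtr X = 0"
  shows "\<exists>K\<in>unimod. hgt (minv K \<odot> X \<odot> K) mone \<noteq> 0"
proof (rule ccontr)
  obtain a b c d where X: "X = (a, b, c, d)" by (cases X)
  have d: "d = - a" using assms by (simp add: X)
  assume no: "\<not> ?thesis"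
  have 0: "hgt X K = 0" if "K \<in> unimod" for K
    using no hgt_conj[OF that, of X mone] that by (auto simp: unimod_def)
  have "c - b = 0" using 0[of mone] by (simp add: X)
  moreover have "c * 1 + (d - a) * 1 - b * 1 + c = 0"
    using 0[of "(1, 1, 0, 1)"] by (simp add: X unimod_def)
  moreover have "c * 4 - b / 4 = 0"
    using 0[of "(2, 0, 0, 1/2)"] by (simp add: X unimod_def power2_eq_square)
  ultimately have "b = 0" "c = 0" "a = 0" using d by auto
  then show False using assms d by (simp add: X zero_prod_def)
qed

text \<open>The small elements of a non-discrete limit all commute, so their traceless parts span a
  line, and this line is preserved by the whole limit group. A wall through a generic point is then
  orthogonal to the line.\<close>
lemma limit_orthogonal_reflection:
  assumes conv: "mconv \<Gamma> H" and \<Gamma>: "\<And>n. discrete_mats (\<Gamma> n)" "\<And>n. \<Gamma> n \<subseteq> refl_gen (\<Gamma> n)"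
    and H: "mat_group H"
    and nd: "\<And>\<epsilon>. \<epsilon> > 0 \<Longrightarrow> \<exists>A\<in>H. A \<noteq> mone \<and> A \<noteq> - mone \<and> norm (A - mone) < \<epsilon>"
  shows "\<exists>X. X \<noteq> 0 \<and> (\<forall>B\<in>H. norm (B - mone) < 1/20 \<longrightarrow> (\<exists>t. tl_part B = t *\<^sub>R X)) \<and>
    (\<exists>R\<in>H. refl_mat R \<and> mtr (R \<odot> X) = 0)"
proof -
  interpret H: mat_group H by fact
  have nz: "tl_part A \<noteq> 0" if "A \<in> H" "A \<noteq> mone" "A \<noteq> - mone" for A
  proof
    assume "tl_part A = 0"
    then have A: "A = (mtr A / 2) *\<^sub>R mone" using decompose_tl_part[of A] by simp
    then have "mdet A = (mtr A / 2)\<^sup>2" by (metis mdet.simps mone_def scaleR_Pair mult.right_neutral mult_zero_right power2_eq_square diff_zero real_scaleR_def)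
    moreover have "mdet A = 1 \<or> mdet A = - 1" using that(1) H.subset by (auto simp: unimod_def)
    ultimately have "(mtr A / 2)\<^sup>2 = 1" using zero_le_power2[of "mtr A / 2"] by linarith
    then have "mtr A / 2 = 1 \<or> mtr A / 2 = - 1" by (rule power2_eq_1_iff[THEN iffD1])
    then show False using A that by (metis scaleR_one scaleR_minus1_left)
  qed
  obtain A where A: "A \<in> H" "A \<noteq> mone" "A \<noteq> - mone" "norm (A - mone) < 1/20" using nd[of "1/20"] by auto
  let ?X = "tl_part A"
  have X: "?X \<noteq> 0" using nz A by blast
  have par: "\<exists>t. tl_part B = t *\<^sub>R ?X" if "B \<in> H" "norm (B - mone) < 1/20" for B
    using commute_imp_parallel[OF limit_small_commute[OF conv \<Gamma>(1) A(1,4) that] X] .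
  have eig: "\<exists>t. h \<odot> ?X \<odot> minv h = t *\<^sub>R ?X" if h: "h \<in> H" for h
  proof -
    have hu: "h \<in> unimod" using h by auto
    \<comment> \<open>Small enough that both \<open>B\<close> and its conjugate by \<open>h\<close>
      come within 1/20 of the identity, where all traceless parts are multiples of that of
      \<open>A\<close>.\<close>
    define \<epsilon> where "\<epsilon> = 1 / (20 * (norm h * norm h + 1))"
    have pos: "norm h * norm h + 1 > 0" by (simp add: add_nonneg_pos)
    then have "\<epsilon> > 0" by (simp add: \<epsilon>_def)
    then obtain B where B: "B \<in> H" "B \<noteq> mone" "B \<noteq> - mone" "norm (B - mone) < \<epsilon>" using nd by blast
    have "20 * \<epsilon> * (norm h * norm h + 1) = 1" using pos by (simp add: \<epsilon>_def)
    then have e: "20 * \<epsilon> * (norm h * norm h) + 20 * \<epsilon> = 1" by (simp add: algebra_simps)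
    have "\<epsilon> * (norm h * norm h) \<ge> 0" using \<open>\<epsilon> > 0\<close> by simp
    then have "\<epsilon> \<le> 1/20" using e by linarith
    then have Bs: "norm (B - mone) < 1/20" using B by linarith
    have "h \<odot> B \<odot> minv h - mone = h \<odot> (B - mone) \<odot> minv h" using hu by (simp add: mmul_distrib mmul_assoc)
    then have "norm (h \<odot> B \<odot> minv h - mone) \<le> norm (h \<odot> (B - mone)) * norm (minv h)" by (metis norm_mmul)
    also have "\<dots> \<le> norm h * norm (B - mone) * norm h"
      using norm_mmul[of h "B - mone"] norm_minv[OF hu] by (simp add: mult_right_mono)
    also have "\<dots> = norm (B - mone) * (norm h * norm h)" by simp
    also have "\<dots> \<le> \<epsilon> * (norm h * norm h)" using B by (intro mult_right_mono) auto
    also have "\<dots> < 1/20" using e \<open>\<epsilon> > 0\<close> by linarith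
    finally obtain u where u: "tl_part (h \<odot> B \<odot> minv h) = u *\<^sub>R ?X"
      using par[of "h \<odot> B \<odot> minv h"] h B by auto
    obtain t where t: "tl_part B = t *\<^sub>R ?X" using par[OF B(1) Bs] by blast
    have "t \<noteq> 0" using t nz[OF B(1-3)] by auto
    have "t *\<^sub>R (h \<odot> ?X \<odot> minv h) = u *\<^sub>R ?X" using u t hu by (simp add: tl_part_conj)
    then have "(1 / t) *\<^sub>R t *\<^sub>R (h \<odot> ?X \<odot> minv h) = (1 / t) *\<^sub>R u *\<^sub>R ?X" by simp
    then show ?thesis using \<open>t \<noteq> 0\<close> by (intro exI[of _ "u / t"]) simp
  qed
  \<comment> \<open>The base point is moved to a place where the height of the traceless part of
    \<open>A\<close> is not 0, so that a mirror through it cannot be proportional to that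
    part.\<close>
  obtain K where K: "K \<in> unimod" "hgt (minv K \<odot> ?X \<odot> K) mone \<noteq> 0"
    using exists_nonsymmetric_conj[OF X] by auto
  have "mconv (\<lambda>n. cj K (\<Gamma> n)) (cj K H)" using K(1) by (intro mconv_cj[OF conv]) auto
  then obtain \<Gamma>' where \<Gamma>': "mconv \<Gamma>' (cj K H)" "\<And>n. reflection_mats (\<Gamma>' n)"
    using mconv_off_walls[of "\<lambda>n. cj K (\<Gamma> n)" "cj K H"] discrete_mats_cj[OF \<Gamma>(1) K(1)]
      generated_cj[OF K(1) \<Gamma>(2)] by blast
  have "\<exists>B\<in>cj K H. B \<noteq> mone \<and> B \<noteq> - mone \<and> norm (B - mone) < \<epsilon>" if "\<epsilon> > 0" for \<epsilon>
  proof -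
    have kp: "norm K > 0" using norm_unimod_ge[OF K(1)] by (smt (verit) real_sqrt_gt_zero)
    then have "\<epsilon> / (norm K * norm K) > 0" using that by simp
    then obtain B where B: "B \<in> H" "B \<noteq> mone" "B \<noteq> - mone" "norm (B - mone) < \<epsilon> / (norm K * norm K)"
      using nd by blast
    let ?B = "minv K \<odot> B \<odot> K"
    have undo: "K \<odot> ?B \<odot> minv K = B" using K(1) by (simp add: mmul_assoc)
    have "?B - mone = minv K \<odot> (B - mone) \<odot> K" using K(1) by (simp add: mmul_distrib mmul_assoc)
    then have "norm (?B - mone) \<le> norm (minv K \<odot> (B - mone)) * norm K" by (metis norm_mmul)
    also have "\<dots> \<le> norm K * norm (B - mone) * norm K"
      using norm_mmul[of "minv K" "B - mone"] norm_minv[OF K(1)] by (simp add: mult_right_mono)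
    also have "\<dots> = norm (B - mone) * (norm K * norm K)" by simp
    also have "\<dots> < \<epsilon>" using B(4) kp by (simp add: pos_less_divide_eq)
    finally have "norm (?B - mone) < \<epsilon>" .
    moreover have "?B \<noteq> mone" "?B \<noteq> - mone" using undo B(2,3) K(1) by auto
    moreover have "?B \<in> cj K H" using B(1) K(1) by (simp add: conj_in_cj)
    ultimately show ?thesis by blast
  qed
  from limit_wall_through_base[OF \<Gamma>' this]
  obtain R where R: "R \<in> cj K H" "refl_mat R" "hgt R mone = 0" by blast
  let ?R = "K \<odot> R \<odot> minv K"
  have R': "?R \<in> H" "refl_mat ?R" using R K(1) by (auto simp: cj_iff intro: refl_mat_conj')
  \<comment> \<open>R X R equals tr (R X) R - X and is also a multiple of X. A nonzero trace would
    make R proportional to X, but at the chosen base point R has height 0 and X has not.\<close>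
  have "mtr (?R \<odot> ?X) = 0"
  proof (rule ccontr)
    assume m: "mtr (?R \<odot> ?X) \<noteq> 0"
    obtain t where "?R \<odot> ?X \<odot> ?R = t *\<^sub>R ?X" using eig[OF R'(1)] refl_mat_minv[OF R'(2)] by auto
    then have e: "mtr (?R \<odot> ?X) *\<^sub>R ?R - ?X = t *\<^sub>R ?X"
      using refl_mat_sandwich[OF R'(2), of ?X] by simp
    have "mtr (?R \<odot> ?X) *\<^sub>R ?R = (mtr (?R \<odot> ?X) *\<^sub>R ?R - ?X) + ?X" by simp
    also have "\<dots> = (t + 1) *\<^sub>R ?X" unfolding e by (simp add: scaleR_left_distrib)
    finally have "mtr (?R \<odot> ?X) *\<^sub>R ?R = (t + 1) *\<^sub>R ?X" .
    then have "(1 / mtr (?R \<odot> ?X)) *\<^sub>R mtr (?R \<odot> ?X) *\<^sub>R ?R = (1 / mtr (?R \<odot> ?X)) *\<^sub>R (t + 1) *\<^sub>R ?X" by simp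
    then obtain k where k: "?R = k *\<^sub>R ?X" using m by simp
    then have "minv K \<odot> ?R \<odot> K = k *\<^sub>R (minv K \<odot> ?X \<odot> K)" by simp
    then have Rk: "R = k *\<^sub>R (minv K \<odot> ?X \<odot> K)" using K(1) by (simp add: mmul_assoc)
    then have "k * hgt (minv K \<odot> ?X \<odot> K) mone = 0" using R(3) hgt_linear(2) by metis
    then have "R = 0" using K(2) Rk by simp
    then show False using R(2) by (simp add: refl_mat_def zero_prod_def)
  qed
  then show ?thesis using X par R' by blast
qed

section \<open>Generation of the limit by its reflections\<close>

lemma refl_gen_minus: "M \<in> refl_gen \<Gamma> \<Longrightarrow> - M \<in> refl_gen \<Gamma>"
proof (induction rule: refl_gen.induct)
  case (one M) then show ?case by (intro refl_gen.one) auto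
next
  case (mul R M) then show ?case using refl_gen.mul[of R \<Gamma> "- M"] by simp
qed

lemma refl_gen_mmul: "A \<in> refl_gen \<Gamma> \<Longrightarrow> B \<in> refl_gen \<Gamma> \<Longrightarrow> A \<odot> B \<in> refl_gen \<Gamma>"
proof (induction rule: refl_gen.induct)
  case (one M) then show ?case using refl_gen_minus[of B \<Gamma>] by (elim disjE) simp_all
next
  case (mul R M) then show ?case using refl_gen.mul[of R \<Gamma> "M \<odot> B"] by (simp add: mmul_assoc)
qed

lemma refl_gen_subset: "mat_group H \<Longrightarrow> M \<in> refl_gen H \<Longrightarrow> M \<in> H"
proof -
  assume "mat_group H"
  then interpret mat_group H .
  show "M \<in> refl_gen H \<Longrightarrow> M \<in> H" by (induction rule: refl_gen.induct) auto
qed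

text \<open>If \<open>refl_gen H\<close> is open in H, then along the decreasing chain of products of reflections in
  the approximating group two consecutive members are close to elements of the same coset.\<close>
lemma limit_generated_if_open:
  assumes conv: "mconv \<Gamma> H" and \<Gamma>: "\<And>n. reflection_mats (\<Gamma> n)" and H: "mat_group H"
    and \<epsilon>: "\<epsilon> > 0" and op: "\<And>B. B \<in> H \<Longrightarrow> norm (B - mone) < \<epsilon> \<Longrightarrow> B \<in> refl_gen H"
  shows "H \<subseteq> refl_gen H"
proof (rule subsetI, rule ccontr)
  interpret H: mat_group H by fact
  fix M assume M: "M \<in> H" "M \<notin> refl_gen H"
  obtain m where m: "\<And>n. m n \<in> \<Gamma> n" "m \<longlonglongrightarrow> M" using mconv_approx[OF conv M(1)] by blast
  have "Bseq m" using m(2) convergentI convergent_imp_Bseq by blast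
  then obtain C where C: "C > 0" "\<And>n. norm (m n) \<le> C" by (auto simp: Bseq_def)
  \<comment> \<open>\<open>C\<close> bounds the norms along every descent in question, and an
    element within 2 \<eta> of such a member has norm at most C + 2. With this \<eta> their quotient
    is within \<epsilon> of the identity.\<close>
  define \<eta> where "\<eta> = min 1 (\<epsilon> / (2 * (C + 3)))"
  have \<eta>: "\<eta> > 0" "\<eta> \<le> 1" "\<eta> * (2 * (C + 3)) \<le> \<epsilon>"
  proof -
    have p: "2 * (C + 3) > 0" using C(1) by simp
    then show "\<eta> > 0" "\<eta> \<le> 1" using \<epsilon> by (auto simp: \<eta>_def)
    have "\<eta> \<le> \<epsilon> / (2 * (C + 3))" by (simp add: \<eta>_def)
    then show "\<eta> * (2 * (C + 3)) \<le> \<epsilon>" using p by (simp only: pos_le_divide_eq)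
  qed
  define good where "good N \<longleftrightarrow> (\<exists>h\<in>refl_gen H. norm (N - h) < \<eta>)" for N
  have near: "N \<in> refl_gen H" if N: "N \<in> H" "h \<in> refl_gen H" "norm (N - h) < 2 * \<eta>" "norm N \<le> C" for N h
  proof -
    have h: "h \<in> H" using refl_gen_subset[OF H N(2)] .
    then have hu: "h \<in> unimod" by auto
    have "norm h \<le> norm N + norm (N - h)" using norm_triangle_ineq4[of N "N - h"] by simp
    then have "norm h \<le> C + 2" using N \<eta> by linarith
    have "N \<odot> minv h - mone = (N - h) \<odot> minv h" using hu by (simp add: mmul_distrib)
    then have "norm (N \<odot> minv h - mone) \<le> norm (N - h) * norm h" using norm_mmul norm_minv[OF hu] by metis
    also have "\<dots> \<le> 2 * \<eta> * (C + 2)" using N \<open>norm h \<le> C + 2\<close> C(1) \<eta> by (intro mult_mono) auto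
    also have "\<dots> < \<epsilon>" using \<eta> C by (simp add: algebra_simps)
    finally have "N \<odot> minv h \<in> refl_gen H" using op N h by auto
    then have "N \<odot> minv h \<odot> h \<in> refl_gen H" using N(2) by (rule refl_gen_mmul)
    then show ?thesis using hu by (simp add: mmul_assoc)
  qed
  \<comment> \<open>A descent starts far from \<open>refl_gen H\<close> and ends at the identity up
    to sign, which belongs to it. So at some step a reflection \<open>R\<close> carries a member
    \<open>N\<close> into the neighbourhood.\<close>
  have step: "\<exists>N\<in>\<Gamma> n. \<exists>R\<in>\<Gamma> n. refl_mat R \<and> norm N \<le> norm K \<and> norm (R \<odot> N) \<le> norm N \<and> \<not> good N \<and> good (R \<odot> N)"
    if "K \<in> \<Gamma> n" "\<not> good K" for n K
  proof -
    interpret reflection_mats "\<Gamma> n" by (rule \<Gamma>)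
    from all_descend[OF that(1)] that show ?thesis
    proof (induction rule: descends.induct)
      case (one K)
      then have "K \<in> refl_gen H" by (auto intro: refl_gen.one)
      then have "good K" using \<eta>(1) unfolding good_def by (intro bexI[of _ K]) auto
      then show ?case using one by blast
    next
      case (step R K)
      show ?case
      proof (cases "good (R \<odot> K)")
        case True
        then show ?thesis using step by (intro bexI[of _ K] bexI[of _ R]) auto
      next
        case False
        then obtain N R' where "N \<in> \<Gamma> n" "R' \<in> \<Gamma> n" "refl_mat R'" "norm N \<le> norm (R \<odot> K)"
          "norm (R' \<odot> N) \<le> norm N" "\<not> good N" "good (R' \<odot> N)"
          using step mul by blast
        then show ?thesis using step(3) by (intro bexI[of _ N] bexI[of _ R']) auto
      qed
    qed
  qed
  have limC: "norm L \<le> C" if "(\<lambda>n. f n) \<longlonglongrightarrow> L" "\<And>n. norm (f n) \<le> C" for f and L :: mat2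
    using LIMSEQ_le_const2[OF tendsto_norm[OF that(1)], of C] that(2) by blast
  have ev_good: "L \<in> refl_gen H"
    if "f \<longlonglongrightarrow> L" "L \<in> H" "norm L \<le> C" "\<And>k. good (f k)" for f L
  proof -
    have "eventually (\<lambda>k. dist (f k) L < \<eta>) sequentially" using that(1) \<eta>(1) by (rule tendstoD)
    then obtain k where k: "dist (f k) L < \<eta>" by (auto simp: eventually_sequentially)
    have "good (f k)" by (rule that)
    then obtain h where h: "h \<in> refl_gen H" "norm (f k - h) < \<eta>" unfolding good_def by blast
    have "norm (L - h) \<le> norm (f k - h) + dist (f k) L"
      using norm_triangle_ineq4[of "f k - h" "f k - L"] by (simp add: dist_norm)
    then have "norm (L - h) < 2 * \<eta>" using h k by linarith
    then show ?thesis using near h that by blast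
  qed
  have nlim: "eventually (\<lambda>n. \<not> good (m n)) sequentially"
  proof -
    have "eventually (\<lambda>n. dist (m n) M < \<eta>) sequentially" using m(2) \<eta>(1) by (rule tendstoD)
    then show ?thesis
    proof eventually_elim
      case (elim n)
      show ?case
      proof
        assume "good (m n)"
        then obtain h where h: "h \<in> refl_gen H" "norm (m n - h) < \<eta>" unfolding good_def by blast
        have "norm (M - h) \<le> norm (m n - h) + dist (m n) M"
          using norm_triangle_ineq4[of "m n - h" "m n - M"] by (simp add: dist_norm)
        then have "norm (M - h) < 2 * \<eta>" using h elim by linarith
        then show False using near[OF M(1) h(1) _ limC[OF m(2) C(2)]] M(2) by blast
      qed
    qed
  qed
  then obtain n0 where n0: "\<And>n. n \<ge> n0 \<Longrightarrow> \<not> good (m n)" unfolding eventually_sequentially by blast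
  have "\<exists>N R. N \<in> \<Gamma> (n + n0) \<and> R \<in> \<Gamma> (n + n0) \<and> refl_mat R \<and> norm N \<le> C \<and> norm (R \<odot> N) \<le> C \<and>
      \<not> good N \<and> good (R \<odot> N)" for n
  proof -
    obtain N R where "N\<in>\<Gamma> (n + n0)" "R\<in>\<Gamma> (n + n0)" "refl_mat R" "norm N \<le> norm (m (n + n0))"
      "norm (R \<odot> N) \<le> norm N" "\<not> good N" "good (R \<odot> N)"
      using step[OF m(1)[of "n + n0"] n0] by auto
    then show ?thesis using C(2)[of "n + n0"] by (intro exI[of _ N] exI[of _ R]) auto
  qed
  then obtain N R where NR: "\<And>n. N n \<in> \<Gamma> (n + n0)" "\<And>n. R n \<in> \<Gamma> (n + n0)" "\<And>n. refl_mat (R n)"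
    "\<And>n. norm (N n) \<le> C" "\<And>n. norm (R n \<odot> N n) \<le> C" "\<And>n. \<not> good (N n)" "\<And>n. good (R n \<odot> N n)" by metis
  have Nu: "N n \<in> unimod" for n using NR(1)[of n] \<Gamma>[of "n + n0"]
    by (meson mat_group.unimod reflection_mats.axioms(1))
  have "norm (R n) \<le> C * C" for n
  proof -
    have "R n = R n \<odot> N n \<odot> minv (N n)" using Nu by (simp add: mmul_assoc)
    then have "norm (R n) \<le> norm (R n \<odot> N n) * norm (minv (N n))" by (metis norm_mmul)
    also have "\<dots> \<le> C * C" using NR(4,5)[of n] norm_minv[OF Nu] C(1) by (intro mult_mono) auto
    finally show ?thesis .
  qed
  moreover have "norm (N n, R n) \<le> norm (N n) + norm (R n)" for n by (rule norm_Pair_le)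
  ultimately have "norm (N n, R n) \<le> C + C * C" for n
    using NR(4) by (meson add_mono order_trans)
  then have "bounded (range (\<lambda>n. (N n, R n)))" unfolding bounded_iff by blast
  then obtain s L where s: "strict_mono s" "(\<lambda>n. (N (s n), R (s n))) \<longlonglongrightarrow> L" by (rule bounded_subseq)
  define LN LR where "LN = fst L" "LR = snd L"
  have lim: "(\<lambda>n. N (s n)) \<longlonglongrightarrow> LN" "(\<lambda>n. R (s n)) \<longlonglongrightarrow> LR"
    using tendsto_fst[OF s(2)] tendsto_snd[OF s(2)] by (simp_all add: LN_LR_def)
  have sm: "strict_mono (\<lambda>n. s n + n0)" using s(1) by (auto simp: strict_mono_def)
  have LN: "LN \<in> H" by (rule mconv_limit[OF conv sm _ lim(1)]) (rule NR)
  have LR: "LR \<in> H" by (rule mconv_limit[OF conv sm _ lim(2)]) (rule NR)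
  have rLR: "refl_mat LR" by (rule refl_mat_limit[OF _ lim(2)]) (rule NR)
  have limRN: "(\<lambda>n. R (s n) \<odot> N (s n)) \<longlonglongrightarrow> LR \<odot> LN" by (intro tendsto_mmul lim)
  \<comment> \<open>The products are near \<open>refl_gen H\<close>, so their limit belongs to it.
    Cancelling the limit reflection puts \<open>LN\<close> there as well, although it is the limit
    of elements that stay away from \<open>refl_gen H\<close>.\<close>
  have "LR \<odot> LN \<in> refl_gen H"
    by (rule ev_good[OF limRN]) (use LR LN limC[OF limRN] NR in auto)
  then have "LR \<odot> (LR \<odot> LN) \<in> refl_gen H" by (rule refl_gen.mul[OF LR rLR])
  then have LNg: "LN \<in> refl_gen H" using rLR by simp
  have "eventually (\<lambda>n. dist (N (s n)) LN < \<eta>) sequentially" using lim(1) \<eta>(1) by (rule tendstoD)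
  then obtain k where "dist (N (s k)) LN < \<eta>" by (auto simp: eventually_sequentially)
  then have "good (N (s k))" unfolding good_def using LNg by (auto simp: dist_norm)
  then show False using NR(6) by blast
qed

theorem limit_refl_generated:
  assumes conv: "mconv \<Gamma> H" and \<Gamma>: "\<And>n. discrete_mats (\<Gamma> n)" "\<And>n. \<Gamma> n \<subseteq> refl_gen (\<Gamma> n)"
    and H: "mat_group H"
  shows "H \<subseteq> refl_gen H"
proof -
  interpret H: mat_group H by fact
  obtain \<Gamma>' where \<Gamma>': "mconv \<Gamma>' H" "\<And>n. reflection_mats (\<Gamma>' n)"
    using mconv_off_walls[OF conv \<Gamma>] by blast
  have "\<exists>\<epsilon>>0. \<forall>B\<in>H. norm (B - mone) < \<epsilon> \<longrightarrow> B \<in> refl_gen H"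
  proof (cases "\<forall>\<epsilon>>0. \<exists>A\<in>H. A \<noteq> mone \<and> A \<noteq> - mone \<and> norm (A - mone) < \<epsilon>")
    case True
    then obtain X R where X: "\<And>B. B \<in> H \<Longrightarrow> norm (B - mone) < 1/20 \<Longrightarrow> \<exists>t. tl_part B = t *\<^sub>R X"
      and R: "R \<in> H" "refl_mat R" "mtr (R \<odot> X) = 0"
      using limit_orthogonal_reflection[OF conv \<Gamma> H] by blast
    have "B \<in> refl_gen H" if B: "B \<in> H" "norm (B - mone) < 1/20" for B
    proof -
      obtain t where t: "tl_part B = t *\<^sub>R X" using X[OF B] by blast
      \<comment> \<open>\<open>R\<close> is orthogonal to \<open>X\<close>, so R B is traceless. It
        is therefore a reflection in \<open>H\<close>, and B = R (R B) is a product of two.\<close>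
      have "R \<odot> B = (mtr B / 2) *\<^sub>R R + t *\<^sub>R (R \<odot> X)"
        using arg_cong[OF decompose_tl_part[of B], of "\<lambda>Y. R \<odot> Y"] by (simp add: mmul_distrib t)
      then have "mtr (R \<odot> B) = 0" using R by (simp add: refl_mat_def)
      moreover have "mdet B = 1" using near_one_det_tr[of B] B by auto
      ultimately have RB: "refl_mat (R \<odot> B)" using R by (simp add: refl_mat_def)
      have "R \<odot> (R \<odot> B \<odot> mone) \<in> refl_gen H"
        by (intro refl_gen.mul RB R refl_gen.one disjI1 refl H.mul B)
      then show ?thesis using R by simp
    qed
    then show ?thesis by (intro exI[of _ "1/20"]) auto
  next
    case False
    then obtain \<epsilon> where "\<epsilon> > 0" "\<And>A. A \<in> H \<Longrightarrow> norm (A - mone) < \<epsilon> \<Longrightarrow> A = mone \<or> A = - mone" by blast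
    then show ?thesis using refl_gen.one by (intro exI[of _ \<epsilon>]) blast
  qed
  then obtain \<epsilon> where "\<epsilon> > 0" "\<And>B. B \<in> H \<Longrightarrow> norm (B - mone) < \<epsilon> \<Longrightarrow> B \<in> refl_gen H" by blast
  then show ?thesis by (rule limit_generated_if_open[OF \<Gamma>' H])
qed

section \<open>Isometries of the half-plane as matrices\<close>

definition hcosh :: "complex \<Rightarrow> complex \<Rightarrow> real" where
  "hcosh z w = 1 + (cmod (z - w))\<^sup>2 / (2 * Im z * Im w)"

text \<open>Coordinates in the hyperboloid model.\<close>
definition emb :: "complex \<Rightarrow> real \<times> real \<times> real" where
  "emb z = (((Re z)\<^sup>2 + (Im z)\<^sup>2) / Im z, Re z / Im z, 1 / Im z)"

fun act :: "mat2 \<Rightarrow> real \<times> real \<times> real \<Rightarrow> real \<times> real \<times> real" where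
  "act (a, b, c, d) (u, v, w) =
     (a\<^sup>2 * u + 2 * a * b * v + b\<^sup>2 * w, a * c * u + (a * d + b * c) * v + b * d * w,
      c\<^sup>2 * u + 2 * c * d * v + d\<^sup>2 * w)"

text \<open>The same formula is the Moebius transformation of z if the determinant is 1, and of the
  conjugate of z if it is -1. Outside the half-plane the map is the identity, as \<^const>\<open>isom\<close> requires.\<close>
fun mob :: "mat2 \<Rightarrow> complex \<Rightarrow> complex" where
  "mob (a, b, c, d) z =
     (if z \<in> H2 then
        Complex ((a * c * ((Re z)\<^sup>2 + (Im z)\<^sup>2) + (a * d + b * c) * Re z + b * d) / ((c * Re z + d)\<^sup>2 + (c * Im z)\<^sup>2))
          (Im z / ((c * Re z + d)\<^sup>2 + (c * Im z)\<^sup>2))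
      else z)"

lemma mob_outside [simp]: "z \<notin> H2 \<Longrightarrow> mob M z = z"
  by (cases M) simp

lemma act_mmul: "act (A \<odot> B) X = act A (act B X)"
  by (cases A; cases B; cases X) (simp add: power2_eq_square algebra_simps)

lemma emb_inj: "z \<in> H2 \<Longrightarrow> w \<in> H2 \<Longrightarrow> emb z = emb w \<Longrightarrow> z = w"
  by (auto simp: emb_def H2_def complex_eq_iff)

lemma mob_den_pos:
  assumes "(a, b, c, d) \<in> unimod" "z \<in> H2"
  shows "(c * Re z + d)\<^sup>2 + (c * Im z)\<^sup>2 > 0"
proof (cases "c = 0")
  case True
  then show ?thesis using assms by (auto simp: unimod_def)
next
  case False
  then show ?thesis using assms by (intro add_nonneg_pos) (auto simp: H2_def)
qed

lemma mob_in_H2: "M \<in> unimod \<Longrightarrow> z \<in> H2 \<Longrightarrow> mob M z \<in> H2"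
  using mob_den_pos[of _ _ _ _ z] by (cases M) (auto simp: H2_def)

lemma emb_mob:
  assumes "M \<in> unimod" "z \<in> H2"
  shows "emb (mob M z) = act M (emb z)"
proof -
  obtain a b c d where M: "M = (a, b, c, d)" by (cases M)
  define x y where "x = Re z" "y = Im z"
  define D where "D = (c * x + d)\<^sup>2 + (c * y)\<^sup>2"
  define N where "N = a * c * (x\<^sup>2 + y\<^sup>2) + (a * d + b * c) * x + b * d"
  have y: "y > 0" using assms by (simp add: H2_def x_y_def)
  have D: "D > 0" using mob_den_pos assms unfolding M D_def x_y_def by blast
  have det: "(a * d - b * c)\<^sup>2 = 1" using unimodD[OF assms(1)] by (simp add: M power2_eq_square)
  have m: "mob M z = Complex (N / D) (y / D)" using assms(2) by (simp add: M N_def D_def x_y_def)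
  have key: "N\<^sup>2 + y\<^sup>2 = ((a * x + b)\<^sup>2 + (a * y)\<^sup>2) * D"
    using det unfolding N_def D_def by algebra
  have "((N / D)\<^sup>2 + (y / D)\<^sup>2) / (y / D) = (N\<^sup>2 + y\<^sup>2) / (D * y)"
    using D y by (simp add: power2_eq_square field_simps)
  also have "\<dots> = ((a * x + b)\<^sup>2 + (a * y)\<^sup>2) / y" unfolding key using D y by simp
  also have "\<dots> = a\<^sup>2 * ((x\<^sup>2 + y\<^sup>2) / y) + 2 * a * b * (x / y) + b\<^sup>2 * (1 / y)"
    using y by (simp add: power2_eq_square field_simps)
  finally have 1: "((N / D)\<^sup>2 + (y / D)\<^sup>2) / (y / D) = \<dots>" .
  have 2: "N / D / (y / D) = a * c * ((x\<^sup>2 + y\<^sup>2) / y) + (a * d + b * c) * (x / y) + b * d * (1 / y)"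
    using D y by (simp add: N_def field_simps)
  have 3: "1 / (y / D) = c\<^sup>2 * ((x\<^sup>2 + y\<^sup>2) / y) + 2 * c * d * (x / y) + d\<^sup>2 * (1 / y)"
    using y by (simp add: D_def power2_eq_square field_simps)
  show ?thesis unfolding m unfolding emb_def M complex.sel x_y_def[symmetric] 1 2 3 by simp
qed

lemma mob_mmul:
  assumes "A \<in> unimod" "B \<in> unimod"
  shows "mob (A \<odot> B) z = mob A (mob B z)"
proof (cases "z \<in> H2")
  case True
  show ?thesis
    by (rule emb_inj) (use assms True in \<open>auto simp: mob_in_H2 emb_mob act_mmul\<close>)
qed auto

lemma mob_mone [simp]: "mob mone z = z"
  by (cases "z \<in> H2") (auto simp: mone_def complex_eq_iff)

lemma mob_mone_id: "mob mone = id" by auto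

lemma mob_minus [simp]: "mob (- M) = mob M"
  by (rule ext) (cases M, auto simp: power2_eq_square algebra_simps)

lemma mob_minv [simp]: "M \<in> unimod \<Longrightarrow> mob (minv M) (mob M z) = z" "M \<in> unimod \<Longrightarrow> mob M (mob (minv M) z) = z"
  by (simp_all flip: mob_mmul)

text \<open>The Lorentzian form of the hyperboloid model: the polarisation of u w - v^2, which has
  the value 1 on the image of \<open>emb\<close>.\<close>

fun form :: "real \<times> real \<times> real \<Rightarrow> real \<times> real \<times> real \<Rightarrow> real" where
  "form (u, v, w) (u', v', w') = (u * w' + u' * w - 2 * v * v') / 2"

lemma hcosh_form:
  assumes "z \<in> H2" "w \<in> H2" shows "hcosh z w = form (emb z) (emb w)"
proof -
  have y: "Im z > 0" "Im w > 0" using assms by (auto simp: H2_def)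
  then show ?thesis unfolding hcosh_def emb_def form.simps cmod_power2
    by (simp add: power2_eq_square field_simps)
qed

lemma form_act: "M \<in> unimod \<Longrightarrow> form (act M X) (act M Y) = form X Y"
proof -
  assume "M \<in> unimod"
  then have *: "mdet M * mdet M = 1" by (rule unimodD)
  obtain a b c d where M: "M = (a, b, c, d)" by (cases M)
  obtain u v w where X: "X = (u, v, w)" by (cases X)
  obtain u' v' w' where Y: "Y = (u', v', w')" by (cases Y)
  have "form (act M X) (act M Y) = mdet M * mdet M * form X Y"
    unfolding M X Y by (simp add: power2_eq_square field_simps)
  then show ?thesis using * by simp
qed

lemma hcosh_mob: "M \<in> unimod \<Longrightarrow> z \<in> H2 \<Longrightarrow> w \<in> H2 \<Longrightarrow> hcosh (mob M z) (mob M w) = hcosh z w"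
  by (simp add: hcosh_form mob_in_H2 emb_mob form_act)

lemma hcosh_ge_1: "z \<in> H2 \<Longrightarrow> w \<in> H2 \<Longrightarrow> hcosh z w \<ge> 1"
  by (simp add: hcosh_def H2_def)

lemma hcosh_refl [simp]: "hcosh z z = 1"
  by (simp add: hcosh_def)

lemma hcosh_eq_1: "z \<in> H2 \<Longrightarrow> w \<in> H2 \<Longrightarrow> hcosh z w = 1 \<longleftrightarrow> z = w"
  by (auto simp: hcosh_def H2_def)

text \<open>\<open>2 sinh\<close> of the signed distance from z to the axis of a reflection matrix.\<close>
fun wall :: "mat2 \<Rightarrow> complex \<Rightarrow> real" where
  "wall (a, b, c, d) z = (c * ((Re z)\<^sup>2 + (Im z)\<^sup>2) + (d - a) * Re z - b) / Im z"

lemma wall_emb: "emb z = (u, v, w) \<Longrightarrow> wall (a, b, c, d) z = c * u + (d - a) * v - b * w"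
  by (auto simp: emb_def add_divide_distrib diff_divide_distrib distrib_left)

lemma hcosh_refl_mat:
  assumes R: "refl_mat R" and z: "z \<in> H2" "w \<in> H2"
  shows "hcosh z (mob R w) = hcosh z w + wall R z * wall R w / 2"
proof -
  obtain a b c d where M: "R = (a, b, c, d)" by (cases R)
  have r: "a = - d" "d * d + b * c = 1" using R by (auto simp: M refl_mat_iff)
  obtain u v k where X: "emb z = (u, v, k)" by (cases "emb z")
  obtain u' v' k' where Y: "emb w = (u', v', k')" by (cases "emb w")
  have "form (u, v, k) (act R (u', v', k')) =
      form (u, v, k) (u', v', k') + (c * u + (d - a) * v - b * k) * (c * u' + (d - a) * v' - b * k') / 2"
  proof -
    have "2 * form (u, v, k) (act R (u', v', k')) =
      2 * form (u, v, k) (u', v', k') + (c * u + (d - a) * v - b * k) * (c * u' + (d - a) * v' - b * k')"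
      using r unfolding M act.simps form.simps by algebra
    moreover have "x = y + t / 2" if "2 * x = 2 * y + t" for x y t :: real using that by simp
    ultimately show ?thesis by blast
  qed
  moreover have "wall R z = c * u + (d - a) * v - b * k" "wall R w = c * u' + (d - a) * v' - b * k'"
    unfolding M by (rule wall_emb[OF X] wall_emb[OF Y])+
  ultimately show ?thesis using R z
    by (simp add: hcosh_form mob_in_H2 emb_mob X Y del: act.simps form.simps)
qed

lemma mob_refl_fixes_iff:
  assumes R: "refl_mat R" and z: "z \<in> H2"
  shows "mob R z = z \<longleftrightarrow> wall R z = 0"
proof -
  have "mob R z = z \<longleftrightarrow> hcosh z (mob R z) = 1"
    using R z hcosh_eq_1[of z "mob R z"] mob_in_H2[of R z] by auto
  also have "\<dots> \<longleftrightarrow> wall R z = 0" using hcosh_refl_mat[OF R z z] by simp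
  finally show ?thesis .
qed

lemma mob_refl_involution [simp]: "refl_mat R \<Longrightarrow> mob R (mob R z) = z"
  by (simp flip: mob_mmul)

lemma bisector_reflection:
  assumes z: "z \<in> H2" "w \<in> H2" "z \<noteq> w"
  shows "\<exists>R. refl_mat R \<and> mob R z = w \<and> mob R w = z \<and> (\<forall>p\<in>H2. hcosh p z = hcosh p w \<longrightarrow> mob R p = p)"
proof -
  obtain u v k where X: "emb z = (u, v, k)" by (cases "emb z")
  obtain u' v' k' where Y: "emb w = (u', v', k')" by (cases "emb w")
  have q: "u * k - v\<^sup>2 = 1" if "emb z = (u, v, k)" "z \<in> H2" for z u v k
  proof -
    have "((Re z)\<^sup>2 + (Im z)\<^sup>2) / Im z * (1 / Im z) - (Re z / Im z)\<^sup>2 = 1"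
      using that by (simp add: H2_def power2_eq_square field_simps)
    then show ?thesis using that by (auto simp: emb_def)
  qed
  define h where "h = hcosh z w"
  have h: "h > 1" using z hcosh_ge_1[of z w] hcosh_eq_1[of z w] by (simp add: h_def order_less_le)
  have h2: "2 * h = u * k' + u' * k - 2 * v * v'" using z by (simp add: h_def hcosh_form X Y)
  define s where "s = sqrt (2 * h - 2)"
  have s: "s > 0" "s\<^sup>2 = 2 * h - 2" using h by (auto simp: s_def)
  \<comment> \<open>The difference of the two hyperboloid points, read as a traceless matrix and
    scaled to determinant -1. Its wall function at a point is thus proportional to the difference of
    the \<open>hcosh\<close> values to \<open>z\<close> and \<open>w\<close>.\<close>
  define R where "R = ((v - v') / s, (u' - u) / s, (k - k') / s, (v' - v) / s)"
  have "(v' - v)\<^sup>2 + (u' - u) * (k - k') = 2 * h - 2"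
    using q[OF X z(1)] q[OF Y z(2)] h2 by algebra
  then have "(v' - v) / s * ((v' - v) / s) + (u' - u) / s * ((k - k') / s) = 1"
    using s h by (simp add: power2_eq_square add_divide_distrib[symmetric] flip: times_divide_times_eq)
  then have R: "refl_mat R" unfolding R_def refl_mat_iff by (auto simp: minus_divide_left)
  have wallR: "wall R p = 2 * (hcosh p z - hcosh p w) / s" if "p \<in> H2" for p
  proof -
    obtain a b c where P: "emb p = (a, b, c)" by (cases "emb p")
    have "wall R p = ((k - k') * a + 2 * (v' - v) * b - (u' - u) * c) / s"
      unfolding R_def wall_emb[OF P] using s(1) by (simp add: field_simps)
    moreover have "(k - k') * a + 2 * (v' - v) * b - (u' - u) * c = 2 * (hcosh p z - hcosh p w)"
      using that z by (simp add: hcosh_form P X Y field_simps)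
    ultimately show ?thesis by simp
  qed
  have eq: "hcosh p (mob R z) = hcosh p w" if "p \<in> H2" for p
  proof -
    have "hcosh p (mob R z) = hcosh p z + (hcosh p z - hcosh p w) * (2 * (1 - h)) / (s * s)"
    proof -
      have "2 * x / s * (2 * (1 - h) / s) / 2 = x * (2 * (1 - h)) / (s * s)" for x by simp
      then show ?thesis
        using hcosh_refl_mat[OF R that z(1)] wallR[OF that] wallR[OF z(1)] hcosh_refl[of z]
        by (simp only: h_def)
    qed
    also have "s * s = - (2 * (1 - h))" using s by (simp add: power2_eq_square)
    also have "(hcosh p z - hcosh p w) * (2 * (1 - h)) / (- (2 * (1 - h))) = - (hcosh p z - hcosh p w)"
    proof -
      have "x * k / - k = - x" if "k \<noteq> 0" for x k :: real using that by simp
      moreover have "2 * (1 - h) \<noteq> 0" using h by simp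
      ultimately show ?thesis by blast
    qed
    finally show ?thesis by simp
  qed
  have mz: "mob R z \<in> H2" using R z by (simp add: mob_in_H2)
  have "hcosh (mob R z) w = 1" using eq[OF mz] by simp
  then have "mob R z = w" using hcosh_eq_1[OF mz z(2)] by simp
  moreover from this have "mob R w = z" using R by (metis mob_refl_involution)
  moreover have "mob R p = p" if "p \<in> H2" "hcosh p z = hcosh p w" for p
    using mob_refl_fixes_iff[OF R that(1)] wallR[OF that(1)] that by simp
  ultimately show ?thesis using R by blast
qed

lemma hdist_hcosh: "hdist z w = arcosh (hcosh z w)"
  by (simp add: hdist_def hcosh_def)

lemma hdist_eq_iff:
  "z \<in> H2 \<Longrightarrow> w \<in> H2 \<Longrightarrow> z' \<in> H2 \<Longrightarrow> w' \<in> H2 \<Longrightarrow> hdist z w = hdist z' w' \<longleftrightarrow> hcosh z w = hcosh z' w'"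
  using cosh_arcosh_real[OF hcosh_ge_1] unfolding hdist_hcosh by metis

lemma isom_in_H2: "f \<in> isom \<Longrightarrow> z \<in> H2 \<Longrightarrow> f z \<in> H2"
  by (auto simp: isom_def)

lemma isom_hcosh: "f \<in> isom \<Longrightarrow> z \<in> H2 \<Longrightarrow> w \<in> H2 \<Longrightarrow> hcosh (f z) (f w) = hcosh z w"
  using hdist_eq_iff[of "f z" "f w" z w] by (auto simp: isom_def)

lemma mob_isom: "M \<in> unimod \<Longrightarrow> mob M \<in> isom"
proof -
  assume M: "M \<in> unimod"
  have "z \<in> mob M ` H2" if "z \<in> H2" for z
    using that M by (intro image_eqI[of _ _ "mob (minv M) z"]) (auto simp: mob_in_H2)
  then have "mob M ` H2 = H2" using M by (auto simp: mob_in_H2)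
  then show ?thesis using M unfolding isom_def by (auto simp: hdist_hcosh hcosh_mob)
qed

text \<open>The hyperboloid points of i, 2 i and 1 + i are linearly independent, so the values of
  the form with them determine a vector.\<close>

lemma three_points_determine:
  assumes z: "z \<in> H2" "w \<in> H2"
    and eq: "hcosh \<i> z = hcosh \<i> w" "hcosh (2 * \<i>) z = hcosh (2 * \<i>) w" "hcosh (1 + \<i>) z = hcosh (1 + \<i>) w"
  shows "z = w"
proof (rule emb_inj[OF z])
  have 1: "\<i> \<in> H2" "2 * \<i> \<in> H2" "1 + \<i> \<in> H2" by (auto simp: H2_def)
  have e: "emb \<i> = (1, 0, 1)" "emb (2 * \<i>) = (2, 0, 1/2)" "emb (1 + \<i>) = (2, 1, 1)"
    by (auto simp: emb_def)
  obtain u v k where X: "emb z = (u, v, k)" by (cases "emb z")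
  obtain u' v' k' where Y: "emb w = (u', v', k')" by (cases "emb w")
  show "emb z = emb w" using eq 1 z by (simp add: hcosh_form e X Y)
qed

text \<open>Every isometry is a product of at most three reflections.\<close>
lemma isom_imp_mob:
  assumes f: "f \<in> isom" shows "\<exists>M\<in>unimod. f = mob M"
proof -
  \<comment> \<open>A fixed point of \<open>g\<close> is equidistant from \<open>p\<close> and
    \<open>g p\<close>, so the reflection exchanging these two also fixes it. Correcting one point
    after another therefore loses nothing.\<close>
  have step: "\<exists>M\<in>unimod. mob M (g p) = p \<and> (\<forall>q\<in>H2. g q = q \<longrightarrow> mob M q = q)"
    if g: "\<And>z. z \<in> H2 \<Longrightarrow> g z \<in> H2" "\<And>z w. z \<in> H2 \<Longrightarrow> w \<in> H2 \<Longrightarrow> hcosh (g z) (g w) = hcosh z w"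
      and p: "p \<in> H2" for g p
  proof (cases "g p = p")
    case True
    then show ?thesis by (intro bexI[of _ mone]) auto
  next
    case False
    obtain R where R: "refl_mat R" "mob R (g p) = p" "\<And>q. q \<in> H2 \<Longrightarrow> hcosh q (g p) = hcosh q p \<Longrightarrow> mob R q = q"
      using bisector_reflection[OF g(1)[OF p] p False] by blast
    have "mob R q = q" if "q \<in> H2" "g q = q" for q
      using R(3)[OF that(1)] g(2)[OF that(1) p] that(2) by simp
    then show ?thesis using R by (intro bexI[of _ R]) auto
  qed
  have pts: "\<i> \<in> H2" "2 * \<i> \<in> H2" "1 + \<i> \<in> H2" by (auto simp: H2_def)
  note f' = isom_in_H2[OF f] isom_hcosh[OF f]
  obtain A where A: "A \<in> unimod" "mob A (f \<i>) = \<i>" using step[OF f' pts(1)] by blast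
  define g where "g z = mob A (f z)" for z
  have g: "\<And>z. z \<in> H2 \<Longrightarrow> g z \<in> H2" "\<And>z w. z \<in> H2 \<Longrightarrow> w \<in> H2 \<Longrightarrow> hcosh (g z) (g w) = hcosh z w"
    using A f' by (auto simp: g_def mob_in_H2 hcosh_mob)
  have gi: "g \<i> = \<i>" using A by (simp add: g_def)
  obtain B where B: "B \<in> unimod" "mob B (g (2 * \<i>)) = 2 * \<i>" "mob B \<i> = \<i>"
    using step[OF g pts(2)] gi pts(1) by blast
  define h where "h z = mob B (g z)" for z
  have h: "\<And>z. z \<in> H2 \<Longrightarrow> h z \<in> H2" "\<And>z w. z \<in> H2 \<Longrightarrow> w \<in> H2 \<Longrightarrow> hcosh (h z) (h w) = hcosh z w"
    using B g by (auto simp: h_def mob_in_H2 hcosh_mob)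
  have hi: "h \<i> = \<i>" "h (2 * \<i>) = 2 * \<i>" using B gi by (auto simp: h_def)
  obtain C where C: "C \<in> unimod" "mob C (h (1 + \<i>)) = 1 + \<i>" "mob C \<i> = \<i>" "mob C (2 * \<i>) = 2 * \<i>"
    using step[OF h pts(3)] hi pts(1,2) by blast
  define k where "k z = mob C (h z)" for z
  have k: "\<And>z. z \<in> H2 \<Longrightarrow> k z \<in> H2" "\<And>z w. z \<in> H2 \<Longrightarrow> w \<in> H2 \<Longrightarrow> hcosh (k z) (k w) = hcosh z w"
    using C h by (auto simp: k_def mob_in_H2 hcosh_mob)
  have ki: "k \<i> = \<i>" "k (2 * \<i>) = 2 * \<i>" "k (1 + \<i>) = 1 + \<i>" using C hi by (auto simp: k_def)
  have kid: "k z = z" if "z \<in> H2" for z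
    using three_points_determine[OF k(1)[OF that] that] k(2)[OF pts(1) that] k(2)[OF pts(2) that]
      k(2)[OF pts(3) that] ki by simp
  let ?M = "C \<odot> (B \<odot> A)"
  have M: "?M \<in> unimod" using A B C by simp
  have "mob ?M (f z) = z" if "z \<in> H2" for z
    using kid[OF that] A B C by (simp add: k_def h_def g_def mob_mmul)
  then have "f z = mob (minv ?M) z" if "z \<in> H2" for z
    using M that by (metis mob_minv(1))
  moreover have "f z = mob (minv ?M) z" if "z \<notin> H2" for z using f that by (auto simp: isom_def)
  ultimately have "f = mob (minv ?M)" by blast
  then show ?thesis using M by (intro bexI[of _ "minv ?M"]) auto
qed

lemma isom_eq: "isom = mob ` unimod"
  using isom_imp_mob mob_isom by blast

lemma mob_eq_id_imp:
  assumes "M \<in> unimod" "mob M \<i> = \<i>" "mob M (2 * \<i>) = 2 * \<i>" "mob M (1 + \<i>) = 1 + \<i>"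
  shows "M = mone \<or> M = - mone"
proof -
  obtain a b c d where M: "M = (a, b, c, d)" by (cases M)
  have e: "emb \<i> = (1, 0, 1)" "emb (2 * \<i>) = (2, 0, 1/2)" "emb (1 + \<i>) = (2, 1, 1)"
    by (auto simp: emb_def)
  have pts: "\<i> \<in> H2" "2 * \<i> \<in> H2" "1 + \<i> \<in> H2" by (auto simp: H2_def)
  have "act M (emb \<i>) = emb \<i>" "act M (emb (2 * \<i>)) = emb (2 * \<i>)" "act M (emb (1 + \<i>)) = emb (1 + \<i>)"
    using emb_mob[OF assms(1)] pts assms by metis+
  then have "a\<^sup>2 + b\<^sup>2 = 1" "a\<^sup>2 * 2 + b\<^sup>2 / 2 = 2" "c\<^sup>2 + d\<^sup>2 = 1" "c\<^sup>2 * 2 + d\<^sup>2 / 2 = 1 / 2"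
    "a * c * 2 + (a * d + b * c) + b * d = 1"
    unfolding e M by (simp_all add: algebra_simps)
  then have "b\<^sup>2 = 0" "c\<^sup>2 = 0" "a\<^sup>2 = 1" by linarith+
  then have "b = 0" "c = 0" "a = 1 \<or> a = - 1" by (auto simp: power2_eq_1_iff)
  then show ?thesis using \<open>a * c * 2 + _ + _ = 1\<close> by (auto simp: M mone_def)
qed

lemma mob_eq_iff:
  assumes "A \<in> unimod" "B \<in> unimod"
  shows "mob A = mob B \<longleftrightarrow> A = B \<or> A = - B"
proof
  assume eq: "mob A = mob B"
  let ?C = "minv B \<odot> A"
  have C: "?C \<in> unimod" using assms by simp
  have "mob ?C z = z" for z using assms eq by (simp add: mob_mmul)
  then have "?C = mone \<or> ?C = - mone" using mob_eq_id_imp[OF C] by blast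
  then have "B \<odot> ?C = B \<or> B \<odot> ?C = - B" by auto
  then show "A = B \<or> A = - B" using assms by simp
qed auto

section \<open>Reflections and geodesic lines\<close>

lemma geodesic_line_subset: "l \<in> geodesic_lines \<Longrightarrow> l \<subseteq> H2"
  by (auto simp: geodesic_lines_def)

lemma geodesic_line_two_points:
  assumes "l \<in> geodesic_lines" obtains p q where "p \<in> l" "q \<in> l" "p \<noteq> q"
proof -
  consider a where "l = {z \<in> H2. Re z = a}" | c r where "r > 0" "l = {z \<in> H2. cmod (z - complex_of_real c) = r}"
    using assms by (auto simp: geodesic_lines_def)
  then show ?thesis
  proof cases
    case 1
    show ?thesis by (rule that[of "Complex a 1" "Complex a 2"]) (auto simp: 1 H2_def)
  next
    case 2
    have "cmod (Complex (c + 3 / 5 * r) (4 / 5 * r) - complex_of_real c) = r"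
      using 2 by (simp add: cmod_def power_mult_distrib power_divide)
    then show ?thesis using 2(1)
      by (intro that[of "Complex c r" "Complex (c + 3 / 5 * r) (4 / 5 * r)"])
         (auto simp: 2(2) H2_def cmod_def)
  qed
qed

lemma wall_is_geodesic_line:
  assumes "refl_mat R" shows "{z \<in> H2. wall R z = 0} \<in> geodesic_lines"
proof -
  obtain a b c d where M: "R = (a, b, c, d)" by (cases R)
  have r: "a = - d" "d * d + b * c = 1" using assms by (auto simp: M refl_mat_iff)
  have w: "wall R z = 0 \<longleftrightarrow> c * ((Re z)\<^sup>2 + (Im z)\<^sup>2) + 2 * d * Re z = b" if "z \<in> H2" for z
    using that by (auto simp: M r H2_def)
  show ?thesis
  proof (cases "c = 0")
    case True
    then have d: "d \<noteq> 0" using r by auto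
    have "{z \<in> H2. wall R z = 0} = {z \<in> H2. Re z = b / (2 * d)}"
      using w d by (auto simp: True field_simps)
    then show ?thesis unfolding geodesic_lines_def by blast
  next
    case False
    have "c * ((Re z)\<^sup>2 + (Im z)\<^sup>2) + 2 * d * Re z = b \<longleftrightarrow> cmod (z - complex_of_real (- d / c)) = 1 / \<bar>c\<bar>" for z
    proof -
      have "cmod (z - complex_of_real (- d / c)) = 1 / \<bar>c\<bar> \<longleftrightarrow> (cmod (z - complex_of_real (- d / c)))\<^sup>2 = (1 / \<bar>c\<bar>)\<^sup>2"
        by (metis abs_ge_zero divide_nonneg_nonneg norm_ge_zero power2_eq_imp_eq zero_le_one)
      also have "\<dots> \<longleftrightarrow> (Re z + d / c)\<^sup>2 + (Im z)\<^sup>2 = 1 / c\<^sup>2"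
        by (simp add: cmod_power2 power_divide)
      also have "\<dots> \<longleftrightarrow> c\<^sup>2 * ((Re z + d / c)\<^sup>2 + (Im z)\<^sup>2) = 1"
        using False by (simp add: eq_divide_eq mult.commute)
      also have "c\<^sup>2 * ((Re z + d / c)\<^sup>2 + (Im z)\<^sup>2) = c * (c * ((Re z)\<^sup>2 + (Im z)\<^sup>2) + 2 * d * Re z) + d * d"
        using False by (simp add: power2_eq_square field_simps)
      also have "\<dots> = 1 \<longleftrightarrow> c * (c * ((Re z)\<^sup>2 + (Im z)\<^sup>2) + 2 * d * Re z) = c * b"
        by (intro iffI; use r(2) mult.commute[of b c] in linarith)
      also have "\<dots> \<longleftrightarrow> c * ((Re z)\<^sup>2 + (Im z)\<^sup>2) + 2 * d * Re z = b" using False by simp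
      finally show ?thesis by blast
    qed
    then have "{z \<in> H2. wall R z = 0} = {z \<in> H2. cmod (z - complex_of_real (- d / c)) = 1 / \<bar>c\<bar>}"
      using w by auto
    moreover have "1 / \<bar>c\<bar> > 0" using False by simp
    ultimately show ?thesis unfolding geodesic_lines_def by blast
  qed
qed

text \<open>Cayley-Hamilton: M^2 = tr (M) M - det (M) 1. If the square is scalar and the trace is
  not 0, then \<open>M\<close> is itself scalar.\<close>

lemma unimod_sq_scalar:
  assumes "M \<in> unimod" "M \<odot> M = mone \<or> M \<odot> M = - mone" "M \<noteq> mone" "M \<noteq> - mone"
  shows "mtr M = 0"
proof (rule ccontr)
  obtain a b c d where M: "M = (a, b, c, d)" by (cases M)
  assume nz: "mtr M \<noteq> 0"
  have "a * b + b * d = 0" "c * a + d * c = 0" "a * a + b * c = d * d + c * b" "a * a + b * c = 1 \<or> a * a + b * c = - 1"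
    using assms(2) by (auto simp: M mone_def mult.commute[of c b])
  moreover from this have "b * (a + d) = 0" "c * (a + d) = 0" "(a - d) * (a + d) = 0" by algebra+
  moreover have "a + d \<noteq> 0" using nz by (simp add: M)
  ultimately have "b = 0" "c = 0" "a = d" "a * a = 1 \<or> a * a = - 1" by auto
  then have "a * a = 1" using zero_le_square[of a] by linarith
  then have "a = 1 \<or> a = - 1" by (simp add: square_eq_1_iff)
  then show False using assms \<open>b = 0\<close> \<open>c = 0\<close> \<open>a = d\<close> by (auto simp: M mone_def)
qed

text \<open>Traceless matrices of determinant 1 are half-turns. Computing the only possible fixed
  point shows that they cannot fix a geodesic pointwise, which leaves determinant -1 for
  reflections.\<close>

lemma half_turn_fixed_point:
  assumes "M = (a, b, c, - a)" "mdet M = 1" "z \<in> H2" "mob M z = z"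
  shows "c \<noteq> 0 \<and> z = Complex (a / c) (1 / \<bar>c\<bar>)"
proof -
  have det: "- a * a - b * c = 1" using assms by simp
  have c: "c \<noteq> 0"
  proof
    assume "c = 0"
    then have "a * a = - 1" using det by simp
    then show False using zero_le_square[of a] by linarith
  qed
  have M: "M \<in> unimod" using assms by (simp add: unimod_def)
  define x y where "x = Re z" "y = Im z"
  have y: "y > 0" using assms by (simp add: x_y_def H2_def)
  define D where "D = (c * x - a)\<^sup>2 + (c * y)\<^sup>2"
  have "D > 0" using mob_den_pos[of a b c "- a" z] M assms by (simp add: D_def x_y_def)
  have "Re (mob M z) = x" "Im (mob M z) = y" using assms(4) by (simp_all add: x_y_def)
  then have e: "(a * c * (x\<^sup>2 + y\<^sup>2) + (- a * a + b * c) * x - b * a) / D = x" "y / D = y"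
    using assms(1,3) by (simp_all add: D_def x_y_def)
  then have D1: "D = 1" using \<open>D > 0\<close> y by (simp add: field_simps)
  then have e1: "a * c * (x\<^sup>2 + y\<^sup>2) + (- a * a + b * c) * x - b * a = x" using e by simp
  have e2: "(c * x - a)\<^sup>2 + (c * y)\<^sup>2 = 1" using D1 by (simp add: D_def)
  have "2 * (c * x - a) = 0" using det e1 e2 by algebra
  then have cx: "c * x = a" by simp
  then have "x = a / c" using c by (simp add: field_simps)
  moreover have "(c * y)\<^sup>2 = 1" using e2 cx by simp
  then have "\<bar>c * y\<bar> = 1" by (auto simp: power2_eq_1_iff)
  then have "\<bar>c\<bar> * y = 1" using y by (simp add: abs_mult)
  then have "y = 1 / \<bar>c\<bar>" using c by (simp add: field_simps)
  ultimately show ?thesis using c by (auto simp: x_y_def complex_eq_iff)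
qed

lemma reflections_eq: "reflections = mob ` {R. refl_mat R}"
proof (intro equalityI subsetI)
  fix r assume r: "r \<in> reflections"
  then obtain l where l: "l \<in> geodesic_lines" "\<And>z. z \<in> l \<Longrightarrow> r z = z" and rr: "r \<in> isom" "r \<noteq> id" "r \<circ> r = id"
    by (auto simp: reflections_def)
  obtain M where M: "M \<in> unimod" "r = mob M" using isom_imp_mob[OF rr(1)] by blast
  have "mob (M \<odot> M) = mob mone"
    using rr(3) M by (auto simp: fun_eq_iff mob_mmul)
  then have MM: "M \<odot> M = mone \<or> M \<odot> M = - mone" using mob_eq_iff[of "M \<odot> M" mone] M by auto
  have ne: "M \<noteq> mone" "M \<noteq> - mone" using rr(2) M(2) by (auto simp: mob_mone_id)
  have tr: "mtr M = 0" by (rule unimod_sq_scalar[OF M(1) MM ne])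
  have "mdet M \<noteq> 1"
  proof
    assume d: "mdet M = 1"
    obtain a b c d where Me: "M = (a, b, c, d)" by (cases M)
    then have "M = (a, b, c, - a)" using tr by simp
    note hf = half_turn_fixed_point[OF this \<open>mdet M = 1\<close>]
    obtain p q where "p \<in> l" "q \<in> l" "p \<noteq> q" using geodesic_line_two_points[OF l(1)] .
    then show False using hf[of p] hf[of q] l geodesic_line_subset[OF l(1)] M(2) by auto
  qed
  then have "refl_mat M" using tr M(1) by (auto simp: refl_mat_def unimod_def)
  then show "r \<in> mob ` {R. refl_mat R}" using M by blast
next
  fix r assume "r \<in> mob ` {R. refl_mat R}"
  then obtain R where R: "refl_mat R" "r = mob R" by blast
  have "mob R \<noteq> mob mone"
    using mob_eq_iff[of R mone] R(1) by (auto simp: refl_mat_def)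
  moreover have "mob R \<circ> mob R = id" using R(1) by (auto simp: fun_eq_iff)
  moreover have "mob R z = z" if "z \<in> {z \<in> H2. wall R z = 0}" for z
    using that mob_refl_fixes_iff[OF R(1)] by blast
  ultimately show "r \<in> reflections"
    using wall_is_geodesic_line[OF R(1)] mob_isom[OF refl_mat_unimod[OF R(1)]]
    unfolding reflections_def R(2) mob_mone_id by blast
qed

section \<open>Subgroups of isometries and their matrix preimages\<close>

lemma mob_comp: "A \<in> unimod \<Longrightarrow> B \<in> unimod \<Longrightarrow> mob A \<circ> mob B = mob (A \<odot> B)"
  by (auto simp: fun_eq_iff mob_mmul)

lemma IsomG_simps [simp]: "carrier IsomG = isom" "mult IsomG = (\<circ>)" "one IsomG = id"
  by (auto simp: IsomG_def)

lemma isom_comp: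
  assumes "f \<in> isom" "g \<in> isom" shows "f \<circ> g \<in> isom"
proof -
  obtain A where A: "A \<in> unimod" "f = mob A" using isom_imp_mob[OF assms(1)] by blast
  obtain B where B: "B \<in> unimod" "g = mob B" using isom_imp_mob[OF assms(2)] by blast
  show ?thesis using mob_isom[OF unimod_mul[OF A(1) B(1)]] by (simp only: A(2) B(2) mob_comp[OF A(1) B(1)])
qed

lemma group_IsomG: "group IsomG"
proof (rule groupI)
  fix x assume "x \<in> carrier IsomG"
  then obtain M where M: "M \<in> unimod" "x = mob M" by (auto simp: isom_eq)
  then show "\<exists>y\<in>carrier IsomG. y \<otimes>\<^bsub>IsomG\<^esub> x = \<one>\<^bsub>IsomG\<^esub>"
    by (intro bexI[of _ "mob (minv M)"]) (auto simp: isom_eq mob_comp mob_mone_id)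
next
  show "\<one>\<^bsub>IsomG\<^esub> \<in> carrier IsomG" using mob_isom[of mone] by (simp add: mob_mone_id)
qed (auto simp: isom_comp comp_assoc)

lemma inv_IsomG_mob: "M \<in> unimod \<Longrightarrow> inv\<^bsub>IsomG\<^esub> (mob M) = mob (minv M)"
  by (rule group.inv_equality[OF group_IsomG]) (auto simp: mob_comp mob_mone_id mob_isom)

lemma inv_into_mob: "M \<in> unimod \<Longrightarrow> inv_into UNIV (mob M) = mob (minv M)"
  by (rule inv_equality) auto

definition lift :: "(complex \<Rightarrow> complex) set \<Rightarrow> mat2 set" where
  "lift H = {M \<in> unimod. mob M \<in> H}"

lemma lift_iff: "M \<in> lift H \<longleftrightarrow> M \<in> unimod \<and> mob M \<in> H"
  by (simp add: lift_def)

lemma mat_group_lift: "subgroup H IsomG \<Longrightarrow> mat_group (lift H)"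
proof -
  assume "subgroup H IsomG"
  then interpret subgroup H IsomG .
  show ?thesis
  proof
    fix A assume A: "A \<in> lift H"
    show "minv A \<in> lift H" using A m_inv_closed[of "mob A"] by (simp add: lift_def inv_IsomG_mob)
    fix B assume "B \<in> lift H"
    then show "A \<odot> B \<in> lift H" using A m_closed[of "mob A" "mob B"] by (simp add: lift_def mob_comp)
  qed (use one_closed in \<open>auto simp: lift_def mob_mone_id\<close>)
qed

lemma lift_conj:
  assumes "K \<in> unimod" "H \<subseteq> isom" shows "lift (conj (mob K) H) = cj (minv K) (lift H)"
proof (intro equalityI subsetI)
  fix M assume M: "M \<in> lift (conj (mob K) H)"
  then obtain h where h: "h \<in> H" "mob M = mob K \<circ> h \<circ> mob (minv K)"
    using assms(1) by (auto simp: lift_def conj_def inv_into_mob)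
  obtain A where A: "A \<in> unimod" "h = mob A" using h(1) assms(2) isom_imp_mob by blast
  have Mu: "M \<in> unimod" using M by (simp add: lift_def)
  have "mob (minv K \<odot> M \<odot> K) = mob A"
    using A h(2) assms(1) Mu by (auto simp: fun_eq_iff mob_mmul)
  then show "M \<in> cj (minv K) (lift H)" using A h(1) assms(1) Mu by (simp add: cj_def lift_def)
next
  fix M assume "M \<in> cj (minv K) (lift H)"
  then have M: "minv K \<odot> M \<odot> K \<in> unimod" "mob (minv K \<odot> M \<odot> K) \<in> H" using assms(1) by (auto simp: cj_def lift_def)
  have Mu: "M \<in> unimod" using M(1) unimod_conj_iff[of "minv K" M] assms(1) by simp
  have "mob M = mob K \<circ> mob (minv K \<odot> M \<odot> K) \<circ> mob (minv K)"
    using assms(1) Mu by (auto simp: fun_eq_iff mob_mmul)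
  then show "M \<in> lift (conj (mob K) H)"
    using M Mu assms(1) by (auto simp: lift_def conj_def inv_into_mob)
qed

lemma generate_reflections_lift:
  assumes Y: "Y \<subseteq> reflections"
  shows "lift (generate IsomG Y) \<subseteq> refl_gen (lift (generate IsomG Y))"
proof
  fix M assume M: "M \<in> lift (generate IsomG Y)"
  let ?L = "lift (generate IsomG Y)"
  have "f \<in> generate IsomG Y \<Longrightarrow> \<exists>A\<in>refl_gen ?L. A \<in> unimod \<and> f = mob A" for f
  proof (induction rule: generate.induct)
    case one
    then show ?case by (intro bexI[of _ mone]) (auto simp: mob_mone_id intro: refl_gen.one)
  next
    case (incl h)
    then obtain R where R: "refl_mat R" "h = mob R" using Y reflections_eq by blast
    then have "R \<in> ?L" using generate.incl[OF incl, of IsomG] by (simp add: lift_def)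
    then have "R \<odot> mone \<in> refl_gen ?L" using R by (intro refl_gen.mul refl_gen.one) auto
    then show ?case using R by (intro bexI[of _ R]) auto
  next
    case (inv h)
    then obtain R where R: "refl_mat R" "h = mob R" using Y reflections_eq by blast
    then have "R \<in> ?L" using generate.incl[OF inv, of IsomG] by (simp add: lift_def)
    then have "R \<odot> mone \<in> refl_gen ?L" using R by (intro refl_gen.mul refl_gen.one) auto
    then show ?case using R by (intro bexI[of _ R]) (auto simp: inv_IsomG_mob refl_mat_minv)
  next
    case (eng h1 h2)
    then obtain A B where "A \<in> refl_gen ?L" "A \<in> unimod" "h1 = mob A" "B \<in> refl_gen ?L" "B \<in> unimod" "h2 = mob B"
      by blast
    then show ?case by (intro bexI[of _ "A \<odot> B"] refl_gen_mmul) (auto simp: mob_comp)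
  qed
  from this[of "mob M"] obtain A where A: "A \<in> refl_gen ?L" "A \<in> unimod" "mob M = mob A"
    using M unfolding lift_def by blast
  have "M \<in> unimod" using M by (simp add: lift_def)
  then have "M = A \<or> M = - A" using A mob_eq_iff by blast
  then show "M \<in> refl_gen ?L" using A(1) refl_gen_minus[OF A(1)] by (elim disjE) simp_all
qed

lemma refl_gen_lift_imp_generate:
  assumes H: "subgroup H IsomG" and gen: "lift H \<subseteq> refl_gen (lift H)"
  shows "H = generate IsomG (H \<inter> reflections)"
proof (intro equalityI subsetI)
  interpret subgroup H IsomG by fact
  have *: "M \<in> refl_gen (lift H) \<Longrightarrow> mob M \<in> generate IsomG (H \<inter> reflections) \<and> M \<in> unimod" for M
  proof (induction rule: refl_gen.induct)
    case (one M)
    then show ?case using generate.one[of IsomG "H \<inter> reflections"] by (auto simp: id_def)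
  next
    case (mul R M)
    then have "mob R \<in> H \<inter> reflections" by (auto simp: lift_def reflections_eq)
    then have "mob R \<otimes>\<^bsub>IsomG\<^esub> mob M \<in> generate IsomG (H \<inter> reflections)"
      by (rule generate.eng[OF generate.incl conjunct1[OF mul.IH]])
    then show ?case using mul by (simp add: mob_comp)
  qed
  fix h assume h: "h \<in> H"
  then have "h \<in> isom" using subset by auto
  then obtain M where M: "M \<in> unimod" "h = mob M" using isom_imp_mob by blast
  then have "M \<in> lift H" using h by (simp add: lift_def)
  then show "h \<in> generate IsomG (H \<inter> reflections)" using * gen M(2) by blast
next
  interpret subgroup H IsomG by fact
  fix h assume "h \<in> generate IsomG (H \<inter> reflections)"
  then show "h \<in> H"
  proof (induction rule: generate.induct)
    case (eng h1 h2)
    then show ?case using m_closed by blast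
  qed (use one_closed m_inv_closed in \<open>auto simp: id_def\<close>)
qed

section \<open>The space of closed subgroups\<close>

lemma continuous_on_mob: "continuous_on unimod mob"
proof (rule continuous_on_coordinatewise_then_product)
  fix z
  show "continuous_on unimod (\<lambda>M. mob M z)"
  proof (cases "z \<in> H2")
    case True
    let ?a = "\<lambda>M::mat2. fst M" and ?b = "\<lambda>M::mat2. fst (snd M)" and ?c = "\<lambda>M::mat2. fst (snd (snd M))"
      and ?d = "\<lambda>M::mat2. snd (snd (snd M))"
    let ?D = "\<lambda>M. (?c M * Re z + ?d M)\<^sup>2 + (?c M * Im z)\<^sup>2"
    have eq: "mob M z = Complex ((?a M * ?c M * ((Re z)\<^sup>2 + (Im z)\<^sup>2) + (?a M * ?d M + ?b M * ?c M) * Re z + ?b M * ?d M) / ?D M)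
       (Im z / ?D M)" for M
      by (cases M) (simp add: True)
    have "?D M \<noteq> 0" if "M \<in> unimod" for M
    proof -
      have "?D M > 0" using mob_den_pos[of "?a M" "?b M" "?c M" "?d M" z] that True by (simp only: prod.collapse)
      then show ?thesis by linarith
    qed
    then show ?thesis unfolding eq by (intro continuous_intros) auto
  next
    case False
    then show ?thesis by simp
  qed
qed

lemma closed_unimod: "closed unimod"
proof -
  have eq: "mdet A = fst A * snd (snd (snd A)) - fst (snd A) * fst (snd (snd A))" for A
    by (cases A) simp
  have "unimod = {A. (mdet A)\<^sup>2 = 1}" by (auto simp: unimod_def power2_eq_1_iff)
  moreover have "closed {A. (mdet A)\<^sup>2 = 1}" unfolding eq by (intro closed_Collect_eq continuous_intros)
  ultimately show ?thesis by simp
qed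

lemma closed_lift:
  assumes "closedin Gtop H" shows "closed (lift H)"
proof -
  obtain T where T: "closed T" "H = T \<inter> isom"
    using assms by (auto simp: Gtop_def closedin_subtopology)
  have "closed (unimod \<inter> mob -` T)"
    by (rule continuous_closed_preimage[OF continuous_on_mob closed_unimod T(1)])
  moreover have "lift H = unimod \<inter> mob -` T" using mob_isom by (auto simp: lift_def T(2))
  ultimately show ?thesis by simp
qed

lemma compactin_mob:
  assumes "compact K" "K \<subseteq> unimod" shows "compactin Gtop (mob ` K)"
  unfolding Gtop_def compactin_subtopology compactin_euclidean_iff
proof
  show "compact (mob ` K)"
    by (rule compact_continuous_image[OF continuous_on_subset[OF continuous_on_mob assms(2)] assms(1)])
  show "mob ` K \<subseteq> isom" using assms(2) mob_isom by blast
qed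

text \<open>Makes the passage from matrices to isometries proper: a bound on the displacement of i
  is a bound on the matrix.\<close>

lemma norm_eq_hcosh:
  assumes "M \<in> unimod" shows "(norm M)\<^sup>2 = 2 * hcosh \<i> (mob M \<i>)"
proof -
  obtain a b c d where M: "M = (a, b, c, d)" by (cases M)
  have i: "\<i> \<in> H2" "emb \<i> = (1, 0, 1)" by (auto simp: H2_def emb_def)
  show ?thesis using assms i by (simp add: hcosh_form mob_in_H2 emb_mob M norm_mat2 del: mob.simps)
qed

text \<open>Isometries carry the topology of pointwise convergence, and convergence at i, 2 i and 1
  + i suffices. The displacement of i bounds the matrices, and a limit of them agrees with
  \<open>A\<close> at the three points, so it is A or -A.\<close>

lemma openin_mob:
  assumes U: "open U" shows "openin Gtop (mob ` (U \<inter> unimod))"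
proof -
  define e :: "(complex \<Rightarrow> complex) \<Rightarrow> complex \<times> complex \<times> complex" where "e f = (f \<i>, f (2 * \<i>), f (1 + \<i>))" for f
  have e: "continuous_on UNIV e" unfolding e_def by (intro continuous_intros continuous_on_product_coordinates)
  have i: "\<i> \<in> H2" by (simp add: H2_def)
  have near: "\<exists>\<epsilon>>0. \<forall>M\<in>unimod. dist (e (mob M)) (e (mob A)) < \<epsilon> \<longrightarrow> M \<in> U \<or> - M \<in> U"
    if A: "A \<in> U" "A \<in> unimod" for A
  proof (rule ccontr)
    assume contra: "\<not> ?thesis"
    have "\<exists>M. M \<in> unimod \<and> dist (e (mob M)) (e (mob A)) < 1 / real (Suc n) \<and> M \<notin> U \<and> - M \<notin> U" for n
    proof -
      have "1 / real (Suc n) > 0" by simp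
      then show ?thesis using contra by blast
    qed
    then obtain M where M: "\<And>n. M n \<in> unimod" "\<And>n. dist (e (mob (M n))) (e (mob A)) < 1 / real (Suc n)"
      "\<And>n. M n \<notin> U" "\<And>n. - M n \<notin> U" by metis
    have "(\<lambda>n. dist (e (mob (M n))) (e (mob A))) \<longlonglongrightarrow> 0"
      by (rule tendsto_sandwich[OF _ _ tendsto_const LIMSEQ_inverse_real_of_nat])
         (use M(2) in \<open>auto simp: inverse_eq_divide intro!: always_eventually less_imp_le\<close>)
    then have lim: "(\<lambda>n. e (mob (M n))) \<longlonglongrightarrow> e (mob A)" by (rule tendsto_dist_iff[THEN iffD2])
    have "(\<lambda>n. mob (M n) \<i>) \<longlonglongrightarrow> mob A \<i>" using tendsto_fst[OF lim] by (simp add: e_def)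
    moreover have "Im (mob A \<i>) > 0" using mob_in_H2[OF A(2) i] by (simp add: H2_def)
    ultimately have "(\<lambda>n. hcosh \<i> (mob (M n) \<i>)) \<longlonglongrightarrow> hcosh \<i> (mob A \<i>)"
      unfolding hcosh_def by (intro tendsto_intros) auto
    then have "(\<lambda>n. (norm (M n))\<^sup>2) \<longlonglongrightarrow> 2 * hcosh \<i> (mob A \<i>)"
      unfolding norm_eq_hcosh[OF M(1)] by (intro tendsto_intros)
    then have "Bseq (\<lambda>n. (norm (M n))\<^sup>2)" using convergentI convergent_imp_Bseq by blast
    then obtain C where C: "C > 0" "\<And>n. norm ((norm (M n))\<^sup>2) \<le> C" by (auto simp: Bseq_def)
    have "norm (M n) \<le> sqrt C" for n using C(2)[of n] by (intro real_le_rsqrt) simp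
    then have "bounded (range M)" by (auto simp: bounded_iff)
    then obtain s L where s: "strict_mono s" "(\<lambda>n. M (s n)) \<longlonglongrightarrow> L" by (rule bounded_subseq)
    have L: "L \<in> unimod" using closed_sequentially[OF closed_unimod _ s(2)] M(1) by blast
    have "(\<lambda>n. mob (M (s n))) \<longlonglongrightarrow> mob L"
      by (rule continuous_on_tendsto_compose[OF continuous_on_mob s(2) L]) (simp add: M(1))
    from continuous_on_tendsto_compose[OF e this]
    have 1: "(\<lambda>n. e (mob (M (s n)))) \<longlonglongrightarrow> e (mob L)" by simp
    have 2: "(\<lambda>n. e (mob (M (s n)))) \<longlonglongrightarrow> e (mob A)"
      using LIMSEQ_subseq_LIMSEQ[OF lim s(1)] by (simp add: comp_def)
    have "e (mob L) = e (mob A)" using LIMSEQ_unique[OF 1 2] .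
    then have *: "mob L \<i> = mob A \<i>" "mob L (2 * \<i>) = mob A (2 * \<i>)" "mob L (1 + \<i>) = mob A (1 + \<i>)"
      by (simp_all add: e_def del: mob.simps)
    have "minv A \<odot> L = mone \<or> minv A \<odot> L = - mone"
      by (rule mob_eq_id_imp) (use L A * in \<open>simp_all add: mob_mmul\<close>)
    then have "A \<odot> (minv A \<odot> L) = A \<or> A \<odot> (minv A \<odot> L) = - A" by auto
    then have LA: "L = A \<or> - L = A" using A(2) by auto
    have "L \<in> - U" by (rule closed_sequentially[OF closed_Compl[OF U] _ s(2)]) (use M(3) in simp)
    moreover have "- L \<in> - U"
      by (rule closed_sequentially[OF closed_Compl[OF U] _ tendsto_minus[OF s(2)]]) (use M(4) in simp)
    ultimately show False using LA A(1) by auto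
  qed
  show ?thesis
  proof (subst openin_subopen, intro ballI)
    fix f assume "f \<in> mob ` (U \<inter> unimod)"
    then obtain A where A: "A \<in> U" "A \<in> unimod" "f = mob A" by blast
    obtain \<epsilon> where \<epsilon>: "\<epsilon> > 0" "\<And>M. M \<in> unimod \<Longrightarrow> dist (e (mob M)) (e (mob A)) < \<epsilon> \<Longrightarrow> M \<in> U \<or> - M \<in> U"
      using near[OF A(1,2)] by blast
    let ?V = "isom \<inter> (e -` ball (e f) \<epsilon>)"
    have "open (e -` ball (e f) \<epsilon>)" using e by (simp add: open_vimage)
    then have "openin Gtop ?V" unfolding Gtop_def openin_subtopology open_openin[symmetric] by blast
    moreover have "f \<in> ?V" using A mob_isom \<epsilon>(1) by simp
    moreover have "?V \<subseteq> mob ` (U \<inter> unimod)"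
    proof
      fix g assume g: "g \<in> ?V"
      then obtain M where M: "M \<in> unimod" "g = mob M" using isom_imp_mob by blast
      then have "M \<in> U \<or> - M \<in> U" using \<epsilon>(2)[of M] g by (simp add: A(3) dist_commute)
      then show "g \<in> mob ` (U \<inter> unimod)"
      proof
        assume "M \<in> U"
        then show ?thesis using M by blast
      next
        assume "- M \<in> U"
        moreover have "- M \<in> unimod" "mob (- M) = g" using M by simp_all
        ultimately show ?thesis by blast
      qed
    qed
    ultimately show "\<exists>T. openin Gtop T \<and> f \<in> T \<and> T \<subseteq> mob ` (U \<inter> unimod)" by blast
  qed
qed

lemma openin_chabauty_hit:
  assumes "open U" shows "openin chabauty {H \<in> SubG. \<exists>M\<in>lift H. M \<in> U}"
proof -
  have "{H \<in> SubG. \<exists>M\<in>lift H. M \<in> U} = SubG \<inter> {H. H \<inter> mob ` (U \<inter> unimod) \<noteq> {}}"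
    by (auto simp: lift_def)
  moreover have "openin (topology_generated_by
        ({{H. H \<inter> K = {}} | K. compactin Gtop K} \<union> {{H. H \<inter> U \<noteq> {}} | U. openin Gtop U}))
     {H. H \<inter> mob ` (U \<inter> unimod) \<noteq> {}}"
    by (rule topology_generated_by_Basis) (use openin_mob[OF assms] in blast)
  ultimately show ?thesis unfolding chabauty_def by (simp add: openin_subtopology_Int2)
qed

lemma openin_chabauty_miss:
  assumes "compact K" "K \<subseteq> unimod" shows "openin chabauty {H \<in> SubG. \<forall>M\<in>lift H. M \<notin> K}"
proof -
  have "{H \<in> SubG. \<forall>M\<in>lift H. M \<notin> K} = SubG \<inter> {H. H \<inter> mob ` K = {}}"
    using assms(2) by (auto simp: lift_def)
  moreover have "openin (topology_generated_by
        ({{H. H \<inter> K = {}} | K. compactin Gtop K} \<union> {{H. H \<inter> U \<noteq> {}} | U. openin Gtop U}))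
     {H. H \<inter> mob ` K = {}}"
    by (rule topology_generated_by_Basis) (use compactin_mob[OF assms] in blast)
  ultimately show ?thesis unfolding chabauty_def by (simp add: openin_subtopology_Int2)
qed

lemma topspace_chabauty: "topspace chabauty = SubG"
proof -
  have "UNIV \<in> {{H. H \<inter> K = {}} | K. compactin Gtop K}"
    by (rule CollectI) (intro exI[of _ "{}"], auto)
  then have "topspace (topology_generated_by
        ({{H. H \<inter> K = {}} | K. compactin Gtop K} \<union> {{H. H \<inter> U \<noteq> {}} | U. openin Gtop U})) = UNIV"
    unfolding topology_generated_by_topspace by blast
  then show ?thesis unfolding chabauty_def by simp
qed

lemma SubG_subgroup: "H \<in> SubG \<Longrightarrow> subgroup H IsomG"
  by (simp add: SubG_def)

lemma SubG_mat_group: "H \<in> SubG \<Longrightarrow> mat_group (lift H)"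
  by (simp add: SubG_def mat_group_lift)

lemma SubG_closed_lift: "H \<in> SubG \<Longrightarrow> closed (lift H)"
  by (simp add: SubG_def closed_lift)

lemma mone_in_lift: "H \<in> SubG \<Longrightarrow> mone \<in> lift H"
  using SubG_mat_group mat_group.one by blast

text \<open>These distances supply the continuous functions against which weak limits are tested.
  Lying below a bound means hitting an open set; lying above one is a union of conditions of missing
  a compact neighbourhood of \<open>K\<close>.\<close>

lemma continuous_map_setdist_lift:
  assumes K: "compact K" "K \<noteq> {}"
  shows "continuous_map chabauty euclideanreal (\<lambda>H. setdist K (lift H))"
  unfolding continuous_map_upper_lower_semicontinuous_lt
proof (intro conjI allI)
  fix a
  have "{H \<in> topspace chabauty. setdist K (lift H) < a} = {H \<in> SubG. \<exists>M\<in>lift H. M \<in> {M. infdist M K < a}}"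
  proof (intro Collect_cong conj_cong)
    fix H assume H: "H \<in> SubG"
    show "setdist K (lift H) < a \<longleftrightarrow> (\<exists>M\<in>lift H. M \<in> {M. infdist M K < a})"
    proof
      assume "setdist K (lift H) < a"
      then obtain x y where xy: "x \<in> K" "y \<in> lift H" "dist x y < a"
        using setdist_ltE K(2) mone_in_lift[OF H] by blast
      then have "infdist y K < a" using infdist_le[OF xy(1), of y] by (simp add: dist_commute)
      then show "\<exists>M\<in>lift H. M \<in> {M. infdist M K < a}" using xy by blast
    next
      assume "\<exists>M\<in>lift H. M \<in> {M. infdist M K < a}"
      then obtain M where M: "M \<in> lift H" "infdist M K < a" by blast
      have "setdist (lift H) K \<le> setdist {M} K" using setdist_le_sing[OF M(1)] .
      then show "setdist K (lift H) < a" using M(2) by (simp add: infdist_eq_setdist setdist_sym)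
    qed
  qed (simp add: topspace_chabauty)
  moreover have "open {M. infdist M K < a}" by (intro open_Collect_less continuous_intros)
  ultimately show "openin chabauty {H \<in> topspace chabauty. setdist K (lift H) < a}"
    using openin_chabauty_hit[of "{M. infdist M K < a}"] by simp
next
  fix a
  let ?S = "{H \<in> topspace chabauty. setdist K (lift H) > a}"
  show "openin chabauty ?S"
  proof (cases "a < 0")
    case True
    then have "?S = topspace chabauty" by (auto intro: less_le_trans[OF _ setdist_pos_le])
    then show ?thesis by simp
  next
    case False
    let ?C = "\<lambda>b. {M. infdist M K \<le> b} \<inter> unimod"
    have "?S = (\<Union>b\<in>{a<..}. {H \<in> SubG. \<forall>M\<in>lift H. M \<notin> ?C b})"
    proof (intro equalityI subsetI)
      fix H assume H: "H \<in> ?S"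
      define b where "b = (a + setdist K (lift H)) / 2"
      have b: "a < b" "b < setdist K (lift H)" using H by (auto simp: b_def)
      have "infdist M K > b" if "M \<in> lift H" for M
        using setdist_le_sing[OF that, of K] b(2) by (simp add: infdist_eq_setdist setdist_sym)
      then have "\<forall>M\<in>lift H. M \<notin> ?C b" by (auto simp: not_le)
      then show "H \<in> (\<Union>b\<in>{a<..}. {H \<in> SubG. \<forall>M\<in>lift H. M \<notin> ?C b})"
        using H b(1) by (auto simp: topspace_chabauty)
    next
      fix H assume "H \<in> (\<Union>b\<in>{a<..}. {H \<in> SubG. \<forall>M\<in>lift H. M \<notin> ?C b})"
      then obtain b where b: "a < b" "H \<in> SubG" "\<And>M. M \<in> lift H \<Longrightarrow> M \<notin> ?C b" by blast
      have "b \<le> dist x y" if "x \<in> K" "y \<in> lift H" for x y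
      proof -
        have "infdist y K > b" using b(3)[OF that(2)] that(2) by (auto simp: lift_def not_le)
        then show ?thesis using infdist_le[OF that(1), of y] by (simp add: dist_commute)
      qed
      then have "b \<le> setdist K (lift H)" using K(2) mone_in_lift[OF b(2)] by (auto intro!: le_setdistI)
      then show "H \<in> ?S" using b by (simp add: topspace_chabauty)
    qed
    moreover have "openin chabauty {H \<in> SubG. \<forall>M\<in>lift H. M \<notin> ?C b}" if "b > a" for b
    proof (rule openin_chabauty_miss)
      show "compact (?C b)" using compact_infdist_le[OF K(2,1), of b] that False closed_unimod by (intro compact_Int_closed) auto
    qed auto
    ultimately show ?thesis by (auto intro!: openin_Union)
  qed
qed

section \<open>Invariance of the hyperbolic area\<close>

text \<open>Identifies Lebesgue measure on the complex plane with that on \<open>real^2\<close>,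
  where the Jacobian of the inversion is a matrix determinant.\<close>

definition vec_complex :: "real^2 \<Rightarrow> complex" where
  "vec_complex v = Complex (v $ 1) (v $ 2)"

lemma vec_complex_measurable [measurable]: "vec_complex \<in> borel \<rightarrow>\<^sub>M borel"
  unfolding vec_complex_def complex_eq
  by (intro borel_measurable_continuous_onI continuous_intros)

lemma lborel_complex: "(lborel :: complex measure) = distr (lborel :: (real^2) measure) borel vec_complex"
proof (rule lborel_eqI)
  fix l u :: complex assume le: "\<And>b. b \<in> Basis \<Longrightarrow> l \<bullet> b \<le> u \<bullet> b"
  have le': "Re l \<le> Re u" "Im l \<le> Im u" using le[of 1] le[of \<i>] by (auto simp: Basis_complex_def inner_complex_def)
  let ?l = "vector [Re l, Im l] :: real^2" and ?u = "vector [Re u, Im u] :: real^2"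
  have eq: "vec_complex -` box l u = box ?l ?u"
    by (auto simp: box_def vec_complex_def Basis_complex_def inner_complex_def Basis_vec_def inner_axis forall_2 vector_2)
  have B: "Basis = {axis 1 1, axis 2 1 :: real^2}" by (auto simp: Basis_vec_def) (metis exhaust_2)
  have ne: "axis 1 1 \<noteq> (axis 2 1 :: real^2)" by (simp add: axis_eq_axis)
  have "emeasure (distr lborel borel vec_complex) (box l u) = emeasure lborel (box ?l ?u)"
    by (subst emeasure_distr) (simp_all add: eq)
  also have "\<dots> = (\<Prod>b\<in>Basis. (?u - ?l) \<bullet> b)"
    by (rule emeasure_lborel_box) (use le' ne in \<open>auto simp: B inner_axis\<close>)
  also have "\<dots> = (Re u - Re l) * (Im u - Im l)"
    using ne by (simp add: B inner_axis)
  also have "\<dots> = (\<Prod>b\<in>Basis. (u - l) \<bullet> b)"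
    by (simp add: Basis_complex_def inner_complex_def)
  finally show "emeasure (distr lborel borel vec_complex) (box l u) = (\<Prod>b\<in>Basis. (u - l) \<bullet> b)" .
qed simp

text \<open>The map z / |z|^2, the reflection in the unit circle. On the half-plane it is
  \<open>mob (0, 1, 1, 0)\<close>.\<close>

definition inversion :: "real^2 \<Rightarrow> real^2" where "inversion v = (1 / (v \<bullet> v)) *\<^sub>R v"

lemma inner_vec2: "v \<bullet> w = v $ 1 * w $ 1 + v $ 2 * w $ (2::2)" for v w :: "real^2"
  by (simp add: inner_vec_def sum_2)

lemma inversion_involution: "v \<noteq> 0 \<Longrightarrow> inversion (inversion v) = v"
  by (simp add: inversion_def)

lemma inversion_derivative:
  assumes "v \<noteq> 0"
  shows "(inversion has_derivative (\<lambda>h. (1 / (v \<bullet> v)) *\<^sub>R h - (2 * (v \<bullet> h) / (v \<bullet> v)\<^sup>2) *\<^sub>R v)) (at v within S)"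
proof -
  have "v \<bullet> v \<noteq> 0" using assms by simp
  then show ?thesis unfolding inversion_def
    by (auto intro!: derivative_eq_intros simp: fun_eq_iff inner_commute power2_eq_square field_simps)
qed

text \<open>With q = v . v, the derivative is 1/q times the Euclidean reflection in the line
  orthogonal to \<open>v\<close>.\<close>

lemma inversion_det:
  assumes "v \<noteq> (0 :: real^2)"
  shows "\<bar>det (matrix (\<lambda>h. (1 / (v \<bullet> v)) *\<^sub>R h - (2 * (v \<bullet> h) / (v \<bullet> v)\<^sup>2) *\<^sub>R v))\<bar> = 1 / (v \<bullet> v)\<^sup>2"
proof -
  define q where "q = v \<bullet> v"
  have q: "q > 0" "q = v $ 1 * v $ 1 + v $ 2 * v $ 2" using assms by (simp_all add: q_def inner_vec2[symmetric])
  let ?A = "matrix (\<lambda>h. (1 / q) *\<^sub>R h - (2 * (v \<bullet> h) / q\<^sup>2) *\<^sub>R v)"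
  have "det ?A = (1 / q - 2 * v $ 1 * v $ 1 / q\<^sup>2) * (1 / q - 2 * v $ 2 * v $ 2 / q\<^sup>2) -
      (2 * v $ 2 * v $ 1 / q\<^sup>2) * (2 * v $ 1 * v $ 2 / q\<^sup>2)"
    unfolding det_2 matrix_def by (simp add: axis_def inner_vec2)
  also have "\<dots> = (q * q - 2 * q * (v $ 1 * v $ 1 + v $ 2 * v $ 2)) / (q\<^sup>2 * q\<^sup>2)"
    using q(1) by (simp add: field_simps power2_eq_square)
  also have "\<dots> = - (1 / q\<^sup>2)" unfolding q(2)[symmetric] using q(1) by (simp add: field_simps power2_eq_square)
  finally show ?thesis by (simp add: q_def)
qed

definition hdens :: "real^2 \<Rightarrow> real" where "hdens v = 1 / (v $ 2)\<^sup>2"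

lemma hdens_measurable [measurable]: "hdens \<in> borel_measurable borel"
  unfolding hdens_def by measurable

lemma inversion_measurable [measurable]: "inversion \<in> borel \<rightarrow>\<^sub>M borel"
  unfolding inversion_def by measurable

text \<open>The inversion divides the second coordinate by v . v, so the density is multiplied by (v
  . v)^2, which cancels the Jacobian.\<close>

lemma inversion_has_integral_iff:
  assumes S: "S \<in> sets borel" "S \<subseteq> {v. v $ 2 > 0}"
  shows "(hdens has_integral b) S \<longleftrightarrow> (hdens has_integral b) (inversion ` S)"
proof -
  have nz: "v \<noteq> 0" if "v \<in> S" for v using S(2) that by auto
  have inj: "inj_on inversion S" by (metis inj_onI inversion_involution nz)
  let ?g' = "\<lambda>v h. (1 / (v \<bullet> v)) *\<^sub>R h - (2 * (v \<bullet> h) / (v \<bullet> v)\<^sup>2) *\<^sub>R v"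
  have eq: "\<bar>det (matrix (?g' v))\<bar> * hdens (inversion v) = hdens v" if "v \<in> S" for v
    using nz[OF that] unfolding inversion_det[OF nz[OF that]]
    by (simp add: hdens_def inversion_def power_divide)
  have "(\<lambda>x. \<bar>det (matrix (?g' x))\<bar> *\<^sub>R (vec (hdens (inversion x)) :: real^1)) absolutely_integrable_on S \<and>
        integral S (\<lambda>x. \<bar>det (matrix (?g' x))\<bar> *\<^sub>R (vec (hdens (inversion x)) :: real^1)) = vec b
     \<longleftrightarrow> (\<lambda>x. vec (hdens x) :: real^1) absolutely_integrable_on (inversion ` S) \<and>
        integral (inversion ` S) (\<lambda>x. vec (hdens x) :: real^1) = vec b"
    by (rule has_absolute_integral_change_of_variables)
       (use S inj inversion_derivative nz in auto)
  then have 1: "(\<lambda>x. \<bar>det (matrix (?g' x))\<bar> * hdens (inversion x)) absolutely_integrable_on S \<and>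
        integral S (\<lambda>x. \<bar>det (matrix (?g' x))\<bar> * hdens (inversion x)) = b
     \<longleftrightarrow> hdens absolutely_integrable_on (inversion ` S) \<and> integral (inversion ` S) hdens = b"
    unfolding absolutely_integrable_on_1_iff integral_on_1_eq by (simp add: vec_eq_iff)
  have 2: "(\<lambda>x. \<bar>det (matrix (?g' x))\<bar> * hdens (inversion x)) absolutely_integrable_on S \<longleftrightarrow> hdens absolutely_integrable_on S"
    unfolding set_integrable_def by (intro Bochner_Integration.integrable_cong) (auto simp: eq indicator_def)
  have 3: "integral S (\<lambda>x. \<bar>det (matrix (?g' x))\<bar> * hdens (inversion x)) = integral S hdens"
    by (rule integral_cong) (rule eq)
  have 4: "hdens absolutely_integrable_on T \<longleftrightarrow> hdens integrable_on T" for T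
    by (rule absolutely_integrable_on_iff_nonneg) (simp add: hdens_def)
  show ?thesis using 1 unfolding 2 3 4 by (auto simp: has_integral_iff)
qed

lemma inversion_image_measurable:
  assumes "S \<in> sets borel" "S \<subseteq> {v. v $ 2 > 0}" shows "inversion ` S \<in> sets borel"
proof -
  have nz: "v \<noteq> 0" if "v $ 2 > 0" for v :: "real^2" using that by auto
  have p: "inversion v $ 2 > 0" if "v $ 2 > 0" for v
    using that nz[OF that] by (simp add: inversion_def)
  have "inversion ` S = inversion -` S \<inter> {v. v $ 2 > 0}"
  proof (intro equalityI subsetI)
    fix w assume "w \<in> inversion ` S"
    then obtain v where v: "v \<in> S" "w = inversion v" by blast
    then have "v $ 2 > 0" using assms(2) by auto
    then show "w \<in> inversion -` S \<inter> {v. v $ 2 > 0}" using v p nz inversion_involution by simp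
  next
    fix w assume "w \<in> inversion -` S \<inter> {v. v $ 2 > 0}"
    then show "w \<in> inversion ` S" using nz inversion_involution by (intro image_eqI[of _ _ "inversion w"]) auto
  qed
  moreover have "inversion -` S \<in> sets borel" using measurable_sets[OF inversion_measurable assms(1)] by simp
  moreover have "{v :: real^2. v $ 2 > 0} \<in> sets borel" by measurable
  ultimately show ?thesis by simp
qed

text \<open>\<open>has_integral\<close> speaks of finite values only. Using the equivalence in both
  directions shows that the integrals are also infinite together.\<close>

lemma nn_integral_hdens_eq:
  assumes S: "S \<in> sets borel" and T: "T \<in> sets borel"
    and iff: "\<And>b. (hdens has_integral b) S \<longleftrightarrow> (hdens has_integral b) T"
  shows "(\<integral>\<^sup>+v. ennreal (indicator S v * hdens v) \<partial>lborel) = (\<integral>\<^sup>+v. ennreal (indicator T v * hdens v) \<partial>lborel)"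
proof -
  have main: "(\<integral>\<^sup>+v. ennreal (indicator T v * hdens v) \<partial>lborel) = (\<integral>\<^sup>+v. ennreal (indicator S v * hdens v) \<partial>lborel)"
    if fin: "(\<integral>\<^sup>+v. ennreal (indicator S v * hdens v) \<partial>lborel) \<noteq> \<infinity>"
      and S: "S \<in> sets borel" and T: "T \<in> sets borel"
      and iff: "\<And>b. (hdens has_integral b) S \<longleftrightarrow> (hdens has_integral b) T" for S T
  proof -
    have ind: "(\<lambda>v. indicator A v * hdens v) = (\<lambda>v. if v \<in> A then hdens v else 0)" for A
      by (auto simp: indicator_def)
    obtain r where r: "(\<integral>\<^sup>+v. ennreal (indicator S v * hdens v) \<partial>lborel) = ennreal r" "r \<ge> 0"
      using fin by (cases "\<integral>\<^sup>+v. ennreal (indicator S v * hdens v) \<partial>lborel") auto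
    have nn: "0 \<le> indicator A v * hdens v" for A v by (simp add: hdens_def)
    have "((\<lambda>v. indicator S v * hdens v) has_integral r) UNIV"
      by (rule nn_integral_has_integral[OF _ nn r]) (use S in measurable)
    then have "(hdens has_integral r) S" unfolding ind has_integral_restrict_UNIV .
    then have "(hdens has_integral r) T" using iff by blast
    then have "((\<lambda>v. indicator T v * hdens v) has_integral r) UNIV" unfolding ind has_integral_restrict_UNIV .
    moreover have "(\<lambda>v. indicator T v * hdens v) \<in> borel_measurable borel" using T by measurable
    ultimately have "(\<integral>\<^sup>+v. ennreal (indicator T v * hdens v) \<partial>lborel) = ennreal r"
      by (intro nn_integral_has_integral_lborel nn)
    then show ?thesis using r by simp
  qed
  let ?I = "\<lambda>S. \<integral>\<^sup>+v. ennreal (indicator S v * hdens v) \<partial>lborel"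
  show ?thesis
  proof (cases "?I S = \<infinity>")
    case True
    show ?thesis
    proof (cases "?I T = \<infinity>")
      case False
      then have "?I S = ?I T" using main[OF _ T S] iff by blast
      then show ?thesis .
    qed (simp only: True)
  next
    case False
    then have "?I T = ?I S" using main[OF _ S T] iff by blast
    then show ?thesis by (rule sym)
  qed
qed

definition hmeas :: "complex measure" where
  "hmeas = density lborel (\<lambda>z. ennreal (1 / (Im z)\<^sup>2))"

lemma sets_hmeas [measurable_cong, simp]: "sets hmeas = sets borel"
  by (simp add: hmeas_def)

lemma harea_hmeas: "harea A = emeasure hmeas A"
  by (simp add: harea_def hmeas_def)

lemma harea_inversion:
  assumes A: "A \<in> sets borel" "A \<subseteq> H2"
  shows "mob (0, 1, 1, 0) ` A \<in> sets borel \<and> harea (mob (0, 1, 1, 0) ` A) = harea A"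
proof -
  let ?J = "mob (0, 1, 1, 0)" and ?S = "vec_complex -` A"
  have S: "?S \<in> sets borel" "?S \<subseteq> {v. v $ 2 > 0}"
    using measurable_sets[OF vec_complex_measurable A(1)] A(2) by (auto simp: vec_complex_def H2_def)
  have J: "vec_complex (inversion v) = ?J (vec_complex v)" if "v $ 2 > 0" for v
    using that by (simp add: vec_complex_def inversion_def H2_def inner_vec2 power2_eq_square complex_eq_iff)
  have surj: "\<exists>v. z = vec_complex v" for z
    by (intro exI[of _ "vector [Re z, Im z]"]) (simp add: vec_complex_def)
  have inj: "v = w" if "vec_complex v = vec_complex w" for v w
    using that by (simp add: vec_complex_def vec_eq_iff forall_2)
  have pre: "vec_complex -` (?J ` A) = inversion ` ?S"
  proof (intro equalityI subsetI)
    fix w assume "w \<in> vec_complex -` (?J ` A)"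
    then obtain z where z: "z \<in> A" "vec_complex w = ?J z" by blast
    obtain v where v: "z = vec_complex v" using surj by blast
    then have "v \<in> ?S" using z by simp
    then have "vec_complex (inversion v) = vec_complex w" using J S z v by auto
    then have "w = inversion v" using inj by metis
    then show "w \<in> inversion ` ?S" using \<open>v \<in> ?S\<close> by blast
  next
    fix w assume "w \<in> inversion ` ?S"
    then obtain v where v: "v \<in> ?S" "w = inversion v" by blast
    then have "vec_complex w = ?J (vec_complex v)" using J S by auto
    then show "w \<in> vec_complex -` (?J ` A)" using v by auto
  qed
  have u: "(0, 1, 1, 0) \<in> unimod" by (simp add: unimod_def)
  have h: "harea B = (\<integral>\<^sup>+v. ennreal (indicator (vec_complex -` B) v * hdens v) \<partial>lborel)"
    if B: "B \<in> sets borel" for B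
  proof -
    have "harea B = (\<integral>\<^sup>+z. ennreal (1 / (Im z)\<^sup>2) * indicator B z \<partial>lborel)"
      unfolding harea_def using B by (subst emeasure_density) auto
    also have "\<dots> = (\<integral>\<^sup>+v. ennreal (1 / (Im (vec_complex v))\<^sup>2) * indicator B (vec_complex v) \<partial>lborel)"
      by (subst lborel_complex, subst nn_integral_distr) (use B in auto)
    also have "\<dots> = (\<integral>\<^sup>+v. ennreal (indicator (vec_complex -` B) v * hdens v) \<partial>lborel)"
      by (intro nn_integral_cong) (auto simp: indicator_def hdens_def vec_complex_def)
    finally show ?thesis .
  qed
  have JA: "?J ` A \<in> sets borel"
  proof -
    let ?c = "\<lambda>z. vector [Re z, Im z] :: real^2"
    have cc: "vec_complex (?c z) = z" for z by (simp add: vec_complex_def)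
    have "continuous_on UNIV ?c"
      unfolding continuous_on_componentwise[where f="?c"]
      by (auto simp: Basis_vec_def inner_axis forall_2 intro!: continuous_intros)
    then have cm: "?c \<in> borel \<rightarrow>\<^sub>M borel" by (rule borel_measurable_continuous_onI)
    have "?c -` (vec_complex -` (?J ` A)) \<in> sets borel"
      unfolding pre using measurable_sets[OF cm inversion_image_measurable[OF S]]
      by (simp only: space_borel Int_UNIV_right)
    moreover have "?c -` (vec_complex -` B) = B" for B using cc by auto
    ultimately show ?thesis by (simp only:)
  qed
  have "harea (?J ` A) = harea A"
    unfolding h[OF JA] h[OF A(1)] pre
    by (rule nn_integral_hdens_eq[OF inversion_image_measurable[OF S] S(1) inversion_has_integral_iff[OF S, symmetric]])
  then show ?thesis using JA by blast
qed

section \<open>Affine maps, and area under arbitrary isometries\<close>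

lemma nn_integral_affine:
  assumes [measurable]: "f \<in> borel_measurable borel" and sk: "s \<noteq> 0" "k \<noteq> 0"
  shows "(\<integral>\<^sup>+z. f z \<partial>lborel) = ennreal \<bar>s * k\<bar> * (\<integral>\<^sup>+z. f (Complex (p + s * Re z) (k * Im z)) \<partial>lborel)"
proof -
  define c :: "complex \<Rightarrow> real" where "c j = (if j = 1 then s else k)" for j
  have T: "complex_of_real p + (\<Sum>j\<in>Basis. (c j * (z \<bullet> j)) *\<^sub>R j) = Complex (p + s * Re z) (k * Im z)" for z
    by (simp add: Basis_complex_def c_def complex_eq_iff)
  have P: "(\<Prod>j\<in>Basis. \<bar>c j\<bar>) = \<bar>s * k\<bar>"
    by (simp add: Basis_complex_def c_def abs_mult)
  have [measurable]: "(\<lambda>z. Complex (p + s * Re z) (k * Im z)) \<in> borel \<rightarrow>\<^sub>M borel"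
    by (intro borel_measurable_continuous_onI continuous_intros)
  have "(lborel :: complex measure) = density (distr lborel borel (\<lambda>z. Complex (p + s * Re z) (k * Im z))) (\<lambda>_. ennreal \<bar>s * k\<bar>)"
    using lborel_affine_euclidean[of c "complex_of_real p"] sk unfolding T P by (simp add: c_def)
  then have "(\<integral>\<^sup>+z. f z \<partial>lborel) = (\<integral>\<^sup>+z. f z \<partial>density (distr lborel borel (\<lambda>z. Complex (p + s * Re z) (k * Im z))) (\<lambda>_. ennreal \<bar>s * k\<bar>))"
    by simp
  also have "\<dots> = ennreal \<bar>s * k\<bar> * (\<integral>\<^sup>+z. f (Complex (p + s * Re z) (k * Im z)) \<partial>lborel)"
    by (subst nn_integral_density) (auto simp: nn_integral_distr nn_integral_cmult)
  finally show ?thesis .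
qed

lemma harea_eq_nn_integral:
  "B \<in> sets borel \<Longrightarrow> harea B = (\<integral>\<^sup>+z. ennreal (1 / (Im z)\<^sup>2) * indicator B z \<partial>lborel)"
  unfolding harea_def by (subst emeasure_density) auto

text \<open>Serves two purposes: |s| = k gives the invariance of area under affine isometries, and s
  = 1, k = 1/E gives the factor \<open>E\<close> gained by lowering points.\<close>

lemma harea_affine_preimage:
  assumes B: "B \<in> sets borel" and s: "s \<noteq> 0" and k: "k > 0"
  shows "harea B = ennreal (\<bar>s\<bar> / k) * harea {z. Complex (p + s * Re z) (k * Im z) \<in> B}"
proof -
  let ?T = "\<lambda>z. Complex (p + s * Re z) (k * Im z)"
  have T [measurable]: "?T \<in> borel \<rightarrow>\<^sub>M borel"
    by (intro borel_measurable_continuous_onI continuous_intros)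
  have pre: "{z. ?T z \<in> B} \<in> sets borel" using measurable_sets[OF T B] by (simp add: vimage_def)
  have dens: "ennreal (1 / (Im (?T z))\<^sup>2) * indicator B (?T z) = ennreal (1 / k\<^sup>2) * (ennreal (1 / (Im z)\<^sup>2) * indicator {z. ?T z \<in> B} z)" for z
    by (auto simp: indicator_def power_mult_distrib simp flip: ennreal_mult')
  have "harea B = ennreal \<bar>s * k\<bar> * (\<integral>\<^sup>+z. ennreal (1 / (Im (?T z))\<^sup>2) * indicator B (?T z) \<partial>lborel)"
    unfolding harea_eq_nn_integral[OF B]
    by (rule nn_integral_affine) (use s k B in auto)
  also have "\<dots> = ennreal \<bar>s * k\<bar> * (ennreal (1 / k\<^sup>2) * harea {z. ?T z \<in> B})"
    unfolding dens harea_eq_nn_integral[OF pre] using pre by (subst nn_integral_cmult) auto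
  also have "\<dots> = ennreal (\<bar>s * k\<bar> * (1 / k\<^sup>2)) * harea {z. ?T z \<in> B}"
    by (subst ennreal_mult) (auto simp: mult.assoc)
  also have "\<bar>s * k\<bar> * (1 / k\<^sup>2) = \<bar>s\<bar> / k" using k by (simp add: abs_mult power2_eq_square)
  finally show ?thesis .
qed

definition area_pres :: "mat2 \<Rightarrow> bool" where
  "area_pres M \<longleftrightarrow> (\<forall>A\<in>sets borel. A \<subseteq> H2 \<longrightarrow> mob M ` A \<in> sets borel \<and> harea (mob M ` A) = harea A)"

lemma area_pres_mmul:
  assumes "area_pres A" "area_pres B" "A \<in> unimod" "B \<in> unimod" shows "area_pres (A \<odot> B)"
  unfolding area_pres_def
proof (intro ballI impI)
  fix S assume S: "S \<in> sets borel" "S \<subseteq> H2"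
  have "mob B ` S \<subseteq> H2" using S(2) mob_in_H2[OF assms(4)] by blast
  moreover have "mob (A \<odot> B) ` S = mob A ` mob B ` S" using assms(3,4) by (simp add: image_image mob_mmul)
  ultimately show "mob (A \<odot> B) ` S \<in> sets borel \<and> harea (mob (A \<odot> B) ` S) = harea S"
    using assms(1,2) S unfolding area_pres_def by metis
qed

lemma area_pres_affine:
  assumes u: "(a, b, 0, d) \<in> unimod" shows "area_pres (a, b, 0, d)"
  unfolding area_pres_def
proof (intro ballI impI)
  fix S assume S: "S \<in> sets borel" "S \<subseteq> H2"
  let ?M = "(a, b, 0, d)"
  have ad: "a * d = 1 \<or> a * d = - 1" using u by (simp add: unimod_def)
  then have nz: "a \<noteq> 0" "d \<noteq> 0" by auto
  define s k p where "s = a / d" "k = 1 / d\<^sup>2" "p = b / d"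
  have s: "s \<noteq> 0" "\<bar>s\<bar> = k" "k > 0"
  proof -
    have "\<bar>a\<bar> * \<bar>d\<bar> = 1" using ad by (auto simp flip: abs_mult)
    then have "\<bar>a\<bar> = 1 / \<bar>d\<bar>" using nz by (simp add: field_simps)
    then show "\<bar>s\<bar> = k" by (simp add: s_k_p_def power2_eq_square)
    show "s \<noteq> 0" "k > 0" using nz by (auto simp: s_k_p_def)
  qed
  have m: "mob ?M z = Complex (p + s * Re z) (k * Im z)" if "z \<in> H2" for z
    using that nz by (simp add: s_k_p_def complex_eq_iff field_simps power2_eq_square)
  let ?T = "\<lambda>z. Complex (p + s * Re z) (k * Im z)"
  let ?I = "\<lambda>z. Complex ((Re z - p) / s) (Im z / k)"
  have img: "mob ?M ` S = {z. ?I z \<in> S}"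
  proof (intro equalityI subsetI)
    fix w assume "w \<in> mob ?M ` S"
    then obtain z where "z \<in> S" "w = ?T z" using m S(2) by blast
    then show "w \<in> {z. ?I z \<in> S}" using s by simp
  next
    fix w assume w: "w \<in> {z. ?I z \<in> S}"
    then have 1: "mob ?M (?I w) = w" using m[of "?I w"] S(2) s by (auto simp: complex_eq_iff)
    have "?I w \<in> S" using w by simp
    from imageI[OF this, of "mob ?M"] show "w \<in> mob ?M ` S" unfolding 1 .
  qed
  have "?I \<in> borel \<rightarrow>\<^sub>M borel" by (intro borel_measurable_continuous_onI continuous_intros) (use s in auto)
  then have meas: "mob ?M ` S \<in> sets borel" unfolding img using measurable_sets[of ?I borel borel S] S by (simp add: vimage_def)
  have "{z. ?T z \<in> mob ?M ` S} = S" unfolding img using s by auto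
  then have "harea (mob ?M ` S) = ennreal (\<bar>s\<bar> / k) * harea S"
    using harea_affine_preimage[OF meas s(1,3), of p] by simp
  then show "mob ?M ` S \<in> sets borel \<and> harea (mob ?M ` S) = harea S" using meas s by simp
qed

text \<open>Bruhat decomposition: if the lower left entry is not 0, the matrix is an upper
  triangular one times the inversion times a translation.\<close>

lemma area_pres_unimod:
  assumes M: "M \<in> unimod" shows "area_pres M"
proof -
  obtain a b c d where Me: "M = (a, b, c, d)" by (cases M)
  show ?thesis
  proof (cases "c = 0")
    case True
    then show ?thesis using area_pres_affine M Me by simp
  next
    case False
    define e where "e = a * d - b * c"
    have e: "e = 1 \<or> e = - 1" using M by (simp add: Me unimod_def e_def)
    let ?A = "(- e / c, a, 0, c)" and ?J = "(0, 1, 1, 0)" and ?B = "(1, d / c, 0, 1)"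
    have u: "?A \<in> unimod" "?J \<in> unimod" "?B \<in> unimod" using e False by (auto simp: unimod_def)
    have Meq: "M = ?A \<odot> (?J \<odot> ?B)" using False unfolding Me by (simp add: e_def field_simps)
    have J: "area_pres ?J" using harea_inversion by (simp add: area_pres_def del: mob.simps)
    show ?thesis unfolding Meq
      by (rule area_pres_mmul[OF area_pres_affine[OF u(1)] area_pres_mmul[OF J area_pres_affine[OF u(3)] u(2,3)] u(1) unimod_mul[OF u(2,3)]])
  qed
qed

lemma harea_mob:
  assumes "M \<in> unimod" "A \<in> sets borel" "A \<subseteq> H2"
  shows "mob M ` A \<in> sets borel" "harea (mob M ` A) = harea A"
  using area_pres_unimod[OF assms(1)] assms(2,3) by (auto simp: area_pres_def)

section \<open>Deep points and tiles\<close>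

lemma hgt_wall: "M \<in> unimod \<Longrightarrow> hgt R M = wall R (mob M \<i>)"
proof -
  assume M: "M \<in> unimod"
  obtain a b c d where R: "R = (a, b, c, d)" by (cases R)
  obtain p q r s where Me: "M = (p, q, r, s)" by (cases M)
  have "\<i> \<in> H2" "emb \<i> = (1, 0, 1)" by (auto simp: H2_def emb_def)
  then have "emb (mob M \<i>) = (p\<^sup>2 + q\<^sup>2, p * r + q * s, r\<^sup>2 + s\<^sup>2)" using M by (simp add: emb_mob Me del: mob.simps)
  from wall_emb[OF this] show ?thesis by (simp add: R Me algebra_simps)
qed

lemma H2_transitive:
  assumes "z \<in> H2" shows "\<exists>K\<in>unimod. mob K \<i> = z"
proof -
  define t where "t = sqrt (Im z)"
  have t: "t > 0" "t * t = Im z" using assms by (auto simp: t_def H2_def)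
  let ?K = "(t, Re z / t, 0, 1 / t)"
  have "?K \<in> unimod" using t by (simp add: unimod_def)
  moreover have "mob ?K \<i> = z" using t assms by (auto simp: H2_def complex_eq_iff power2_eq_square)
  ultimately show ?thesis by blast
qed

lemma wall_conj:
  assumes K: "K \<in> unimod" and z: "z \<in> H2"
  shows "wall (minv K \<odot> R \<odot> K) z = mdet K * wall R (mob K z)"
proof -
  obtain M where M: "M \<in> unimod" "mob M \<i> = z" using H2_transitive[OF z] by blast
  show ?thesis
    using hgt_conj[OF K, of R M] hgt_wall[OF M(1), of "minv K \<odot> R \<odot> K"] hgt_wall[of "K \<odot> M" R] K M
    by (simp add: mob_mmul)
qed

text \<open>As \<open>wall\<close> is 2 sinh of a signed distance, the threshold k = E - 1/E means
  distance more than ln E from every mirror of \<open>H\<close>.\<close>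

definition deep :: "real \<Rightarrow> (complex \<Rightarrow> complex) set \<Rightarrow> complex \<Rightarrow> bool" where
  "deep k H z \<longleftrightarrow> (\<forall>R\<in>lift H. refl_mat R \<longrightarrow> \<bar>wall R z\<bar> > k)"

definition sim :: "(complex \<Rightarrow> complex) set \<Rightarrow> complex \<Rightarrow> complex \<Rightarrow> bool" where
  "sim H z w \<longleftrightarrow> (\<forall>R\<in>lift H. refl_mat R \<longrightarrow> wall R z * wall R w > 0)"

text \<open>The chamber of \<open>z\<close> cut out by the mirrors of \<open>H\<close>. It is empty
  if \<open>z\<close> lies on a mirror, since then even \<open>sim H z z\<close> fails.\<close>

definition tile :: "(complex \<Rightarrow> complex) set \<Rightarrow> complex \<Rightarrow> complex set" where
  "tile H z = {w \<in> H2. sim H z w}"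

lemma sim_sym: "sim H z w \<longleftrightarrow> sim H w z"
  by (simp add: sim_def mult.commute)

lemma sim_trans: "sim H z w \<Longrightarrow> sim H w v \<Longrightarrow> sim H z v"
  unfolding sim_def
proof (intro ballI impI)
  fix R
  assume "\<forall>R\<in>lift H. refl_mat R \<longrightarrow> 0 < wall R z * wall R w"
    "\<forall>R\<in>lift H. refl_mat R \<longrightarrow> 0 < wall R w * wall R v" "R \<in> lift H" "refl_mat R"
  then have "0 < wall R z * wall R w" "0 < wall R w * wall R v" by blast+
  then show "0 < wall R z * wall R v" by (auto simp: zero_less_mult_iff)
qed

lemma tile_eq: "sim H z w \<Longrightarrow> tile H z = tile H w"
  unfolding tile_def by (auto intro: sim_trans simp: sim_sym[of H w z] dest: sim_trans sim_sym[THEN iffD1])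

lemma deep_imp_sim_refl: "deep k H z \<Longrightarrow> k \<ge> 0 \<Longrightarrow> sim H z z"
  unfolding deep_def sim_def
proof (intro ballI impI)
  fix R assume "\<forall>R\<in>lift H. refl_mat R \<longrightarrow> \<bar>wall R z\<bar> > k" "k \<ge> 0" "R \<in> lift H" "refl_mat R"
  then have "\<bar>wall R z\<bar> > 0" by fastforce
  then show "0 < wall R z * wall R z" by (auto simp: zero_less_mult_iff)
qed

lemma lift_conj_iff:
  assumes "K \<in> unimod" "H \<subseteq> isom"
  shows "R \<in> lift (conj (mob K) H) \<longleftrightarrow> minv K \<odot> R \<odot> K \<in> lift H"
  using assms by (simp add: lift_conj cj_def)

lemma ball_lift_conj:
  assumes "K \<in> unimod" "H \<subseteq> isom"
  shows "(\<forall>R\<in>lift (conj (mob K) H). refl_mat R \<longrightarrow> Q R) \<longleftrightarrow>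
    (\<forall>R\<in>lift H. refl_mat R \<longrightarrow> Q (K \<odot> R \<odot> minv K))"
proof safe
  fix R assume "\<forall>R\<in>lift (conj (mob K) H). refl_mat R \<longrightarrow> Q R" "R \<in> lift H" "refl_mat R"
  moreover have "minv K \<odot> (K \<odot> R \<odot> minv K) \<odot> K = R" using assms(1) by (simp add: mmul_assoc)
  ultimately show "Q (K \<odot> R \<odot> minv K)"
    using lift_conj_iff[OF assms, of "K \<odot> R \<odot> minv K"] refl_mat_conj'[OF _ assms(1)] by simp
next
  fix R assume "\<forall>R\<in>lift H. refl_mat R \<longrightarrow> Q (K \<odot> R \<odot> minv K)" "R \<in> lift (conj (mob K) H)" "refl_mat R"
  moreover have "K \<odot> (minv K \<odot> R \<odot> K) \<odot> minv K = R" using assms(1) by (simp add: mmul_assoc)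
  ultimately show "Q R"
    using lift_conj_iff[OF assms, of R] refl_mat_conj[OF _ assms(1), of R] by force
qed

lemma wall_conj':
  assumes "K \<in> unimod" "z \<in> H2"
  shows "wall (K \<odot> R \<odot> minv K) (mob K z) = mdet K * wall R z"
  using wall_conj[of "minv K" "mob K z" R] assms by (simp add: mob_in_H2 mdet_minv)

lemma deep_conj:
  assumes K: "K \<in> unimod" "H \<subseteq> isom" and z: "z \<in> H2"
  shows "deep k (conj (mob K) H) (mob K z) \<longleftrightarrow> deep k H z"
proof -
  have "\<bar>mdet K * x\<bar> = \<bar>x\<bar>" for x using K(1) by (auto simp: unimod_def abs_mult)
  then show ?thesis unfolding deep_def ball_lift_conj[OF K] wall_conj'[OF K(1) z] by simp
qed

lemma sim_conj:
  assumes K: "K \<in> unimod" "H \<subseteq> isom" and z: "z \<in> H2" "w \<in> H2"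
  shows "sim (conj (mob K) H) (mob K z) (mob K w) \<longleftrightarrow> sim H z w"
proof -
  have e: "mdet K * x * (mdet K * y) = x * y" for x y using K(1) by (auto simp: unimod_def)
  show ?thesis unfolding sim_def ball_lift_conj[OF K] wall_conj'[OF K(1) z(1)] wall_conj'[OF K(1) z(2)] e ..
qed

lemma tile_conj:
  assumes K: "K \<in> unimod" "H \<subseteq> isom" and z: "z \<in> H2"
  shows "tile (conj (mob K) H) (mob K z) = mob K ` tile H z"
proof (intro equalityI subsetI)
  fix w assume "w \<in> tile (conj (mob K) H) (mob K z)"
  then have w: "w \<in> H2" "sim (conj (mob K) H) (mob K z) (mob K (mob (minv K) w))"
    using K(1) by (auto simp: tile_def)
  have "mob (minv K) w \<in> H2" using w(1) K(1) by (simp add: mob_in_H2)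
  then have "mob (minv K) w \<in> tile H z" using w(2) sim_conj[OF K z] by (simp add: tile_def)
  then show "w \<in> mob K ` tile H z" using K(1) by (intro image_eqI[of _ _ "mob (minv K) w"]) auto
next
  fix w assume "w \<in> mob K ` tile H z"
  then obtain v where "v \<in> H2" "sim H z v" "w = mob K v" by (auto simp: tile_def)
  then show "w \<in> tile (conj (mob K) H) (mob K z)"
    using sim_conj[OF K z] mob_in_H2[OF K(1)] by (auto simp: tile_def)
qed

text \<open>Lowering a point by the factor s turns its wall function P + Q into P s + Q / s. The
  bound on P Q expresses that the signed distance to a mirror changes at most as fast as the point
  moves, so a distance above ln E stays positive after a move by ln E.\<close>

lemma push_sign:
  fixes P Q E :: real
  assumes PQ: "P * Q \<ge> - 1" and E: "E \<ge> 1" and s: "P + Q > E - 1 / E"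
  shows "P * E + Q / E > 0"
proof -
  have E1: "1 / E \<le> 1" "1 / E > 0" using E by simp_all
  have pos: "P + Q > 0" using s E1 E by linarith
  consider "P \<ge> 0" "Q \<ge> 0" | "P \<ge> 0" "Q < 0" | "P < 0" by linarith
  then show ?thesis
  proof cases
    case 1
    then consider "P > 0" | "Q > 0" using pos by linarith
    then show ?thesis
    proof cases
      assume "P > 0"
      then have "P * E > 0" "Q / E \<ge> 0" using 1 E by simp_all
      then show ?thesis by linarith
    next
      assume "Q > 0"
      then have "P * E \<ge> 0" "Q / E > 0" using 1 E by simp_all
      then show ?thesis by linarith
    qed
  next
    case 2
    have "P * 1 \<le> P * E" using 2 E by (intro mult_left_mono) auto
    moreover have "Q * 1 \<le> Q * (1 / E)" using 2 E1 by (intro mult_left_mono_neg) auto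
    ultimately show ?thesis using pos by simp
  next
    case 3
    define p where "p = - P"
    have p: "p > 0" "Q > p + E - 1 / E" using 3 s by (auto simp: p_def)
    have Q: "p * Q \<le> 1" using PQ by (simp add: p_def)
    have "Q > p * E * E"
    proof (rule ccontr)
      assume n: "\<not> ?thesis"
      show False
      proof (cases "p * E > 1")
        case True
        then have "p > 1 / E" using E by (simp add: field_simps)
        then have "Q > E" using p by linarith
        then have "p * Q > p * E" using p(1) by simp
        then show False using True Q by linarith
      next
        case False
        have "1 / E \<le> E" using E E1 by linarith
        then have "(p * E) * (E - 1 / E) \<le> 1 * (E - 1 / E)" using False by (intro mult_right_mono) auto
        moreover have "(p * E) * (E - 1 / E) = p * E * E - p" using E by (simp add: field_simps)
        ultimately have "p * E * E - p \<le> E - 1 / E" by (simp only: mult_1)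
        then show False using p n by linarith
      qed
    qed
    then have "Q / E > p * E" using E by (simp add: field_simps)
    then show ?thesis by (simp add: p_def)
  qed
qed

lemma deep_push:
  assumes H: "deep (E - 1 / E) H z" and E: "E \<ge> 1" and z: "z \<in> H2"
  shows "sim H z (Complex (Re z) (Im z / E))"
  unfolding sim_def
proof (intro ballI impI)
  fix R assume R: "R \<in> lift H" "refl_mat R"
  obtain a b c d where Re: "R = (a, b, c, d)" by (cases R)
  have r: "a = - d" "d * d + b * c = 1" using R by (auto simp: Re refl_mat_iff)
  define x y where "x = Re z" "y = Im z"
  have y: "y > 0" using z by (simp add: x_y_def H2_def)
  define A where "A = c * x\<^sup>2 + 2 * d * x - b"
  \<comment> \<open>\<open>P\<close> is the term that grows and \<open>Q\<close> the term that
    shrinks in absolute value as the point is lowered; the normalisation of the determinant gives P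
    Q = (c x + d)^2 - 1.\<close>
  define P Q where "P = A / y" "Q = c * y"
  have "P * Q = (c * x + d)\<^sup>2 - 1"
  proof -
    have "P * Q = c * A" using y by (simp add: P_Q_def)
    also have "\<dots> = (c * x + d)\<^sup>2 - 1" unfolding A_def using r by algebra
    finally show ?thesis .
  qed
  then have PQ: "P * Q \<ge> - 1" by simp
  have w1: "wall R z = P + Q"
    using y r by (simp add: Re P_Q_def A_def x_y_def[symmetric] power2_eq_square field_simps)
  have w2: "wall R (Complex (Re z) (Im z / E)) = P * E + Q / E"
    using y E r by (simp add: Re P_Q_def A_def x_y_def[symmetric] power2_eq_square field_simps)
  have "\<bar>P + Q\<bar> > E - 1 / E" using H R w1 unfolding deep_def by auto
  then consider "P + Q > E - 1 / E" | "- P + - Q > E - 1 / E" by linarith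
  then have "(P + Q) * (P * E + Q / E) > 0"
  proof cases
    case 1
    have "1 / E \<le> 1" using E by simp
    then have "P + Q > 0" using 1 E by linarith
    then show ?thesis using push_sign[OF PQ E 1] by simp
  next
    case 2
    have "1 / E \<le> 1" using E by simp
    then have "P + Q < 0" using 2 E by linarith
    moreover have "- P * E + - Q / E > 0" using push_sign[of "- P" "- Q" E] PQ E 2 by simp
    then have "P * E + Q / E < 0" by simp
    ultimately show ?thesis by (simp add: mult_neg_neg)
  qed
  then show "wall R z * wall R (Complex (Re z) (Im z / E)) > 0" using w1 w2 by simp
qed

text \<open>The linear isoperimetric inequality: moving the deep part of a tile downwards by the
  hyperbolic distance \<open>ln E\<close> keeps it inside the tile and multiplies its area by E.\<close>
lemma harea_deep_part:
  assumes z: "z \<in> H2" and E: "E \<ge> 1" and T: "tile H z \<in> sets borel"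
  shows "harea {w \<in> tile H z. deep (E - 1 / E) H w} \<le> ennreal (1 / E) * harea (tile H z)"
proof -
  have "{w \<in> tile H z. deep (E - 1 / E) H w} \<subseteq> {w. Complex (0 + 1 * Re w) (1 / E * Im w) \<in> tile H z}"
  proof safe
    fix w assume w: "w \<in> tile H z" "deep (E - 1 / E) H w"
    then have "w \<in> H2" "sim H z w" by (auto simp: tile_def)
    moreover have "sim H w (Complex (Re w) (Im w / E))" by (rule deep_push[OF w(2) E \<open>w \<in> H2\<close>])
    ultimately show "Complex (0 + 1 * Re w) (1 / E * Im w) \<in> tile H z"
      using sim_trans E by (auto simp: tile_def H2_def)
  qed
  moreover have "{w. Complex (0 + 1 * Re w) (1 / E * Im w) \<in> tile H z} \<in> sets borel"
  proof -
    have m: "(\<lambda>w. Complex (0 + 1 * Re w) (1 / E * Im w)) \<in> borel \<rightarrow>\<^sub>M borel"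
      by (intro borel_measurable_continuous_onI continuous_intros)
    show ?thesis using measurable_sets[OF m T] by (simp add: vimage_def)
  qed
  ultimately have "harea {w \<in> tile H z. deep (E - 1 / E) H w} \<le> harea {w. Complex (0 + 1 * Re w) (1 / E * Im w) \<in> tile H z}"
    unfolding harea_hmeas by (intro emeasure_mono) auto
  also have "\<dots> = ennreal (1 / E) * harea (tile H z)"
  proof -
    have "harea (tile H z) = ennreal E * harea {w. Complex (0 + 1 * Re w) (1 / E * Im w) \<in> tile H z}"
      using harea_affine_preimage[OF T, of 1 "1 / E" 0] E by simp
    then have "ennreal (1 / E) * harea (tile H z) = (ennreal (1 / E) * ennreal E) * harea {w. Complex (0 + 1 * Re w) (1 / E * Im w) \<in> tile H z}"
      by (simp add: mult.assoc)
    also have "ennreal (1 / E) * ennreal E = 1" using E by (simp flip: ennreal_mult)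
    finally show ?thesis by simp
  qed
  finally show ?thesis .
qed

text \<open>The wall function with its denominator \<open>Im z\<close> cleared: continuous jointly
  in matrix and point on the whole space, also off the half-plane.\<close>

definition wpoly :: "mat2 \<times> complex \<Rightarrow> real" where
  "wpoly q = fst (snd (snd (fst q))) * ((Re (snd q))\<^sup>2 + (Im (snd q))\<^sup>2) +
     (snd (snd (snd (fst q))) - fst (fst q)) * Re (snd q) - fst (snd (fst q))"

lemma wall_wpoly: "wall R z = wpoly (R, z) / Im z"
  by (cases R) (simp add: wpoly_def)

lemma continuous_wpoly: "continuous_on A wpoly"
  unfolding wpoly_def by (intro continuous_intros)

text \<open>Conjugating \<open>z\<close> to i turns \<open>R\<close> into a matrix of squared norm 2
  + (wall R z)^2, and for \<open>z\<close> in a compact set the conjugating matrices are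
  bounded.\<close>

lemma bounded_walls_near:
  assumes C: "compact C" "C \<subseteq> H2"
  shows "bounded {R. refl_mat R \<and> (\<exists>z\<in>C. \<bar>wall R z\<bar> \<le> k)}"
proof -
  have "continuous_on C (hcosh \<i>)"
    unfolding hcosh_def by (intro continuous_intros) (use C(2) in \<open>auto simp: H2_def\<close>)
  then have "bounded (hcosh \<i> ` C)" using C(1) compact_continuous_image compact_imp_bounded by blast
  then obtain B where B: "\<And>z. z \<in> C \<Longrightarrow> \<bar>hcosh \<i> z\<bar> \<le> B" by (auto simp: bounded_iff)
  have "norm R \<le> (2 * B) * sqrt (2 + k\<^sup>2)" if R: "refl_mat R" "z \<in> C" "\<bar>wall R z\<bar> \<le> k" for R z
  proof -
    have z: "z \<in> H2" using R C by auto
    obtain K where K: "K \<in> unimod" "mob K \<i> = z" using H2_transitive[OF z] by blast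
    have i: "\<i> \<in> H2" by (simp add: H2_def)
    let ?R = "minv K \<odot> R \<odot> K"
    have u: "?R \<in> unimod" using K R by simp
    have "(norm ?R)\<^sup>2 = 2 * hcosh \<i> (mob ?R \<i>)" by (rule norm_eq_hcosh[OF u])
    also have "mob ?R \<i> = mob (minv K) (mob R z)" using K R by (simp add: mob_mmul)
    also have "hcosh \<i> (mob (minv K) (mob R z)) = hcosh (mob K \<i>) (mob K (mob (minv K) (mob R z)))"
      by (rule hcosh_mob[OF K(1) i, symmetric]) (use K(1) R z in \<open>simp add: mob_in_H2\<close>)
    also have "\<dots> = hcosh z (mob R z)" using K by simp
    also have "\<dots> = 1 + (wall R z)\<^sup>2 / 2" using hcosh_refl_mat[OF R(1) z z] by (simp add: power2_eq_square)
    finally have "(norm ?R)\<^sup>2 \<le> 2 + k\<^sup>2" using R(3) by (simp add: abs_le_square_iff[symmetric])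
    then have 1: "norm ?R \<le> sqrt (2 + k\<^sup>2)" by (rule real_le_rsqrt)
    have "(norm K)\<^sup>2 \<le> 2 * B" using norm_eq_hcosh[OF K(1)] B[OF R(2)] K(2) by simp
    then have 2: "norm K * norm K \<le> 2 * B" by (simp add: power2_eq_square)
    have "R = K \<odot> ?R \<odot> minv K" using K(1) by (simp add: mmul_assoc)
    then have "norm R \<le> norm (K \<odot> ?R) * norm (minv K)" by (metis norm_mmul)
    also have "\<dots> \<le> norm K * norm ?R * norm K" using norm_mmul[of K ?R] norm_minv[OF K(1)] by (simp add: mult_right_mono)
    also have "\<dots> = (norm K * norm K) * norm ?R" by simp
    also have "\<dots> \<le> (2 * B) * sqrt (2 + k\<^sup>2)" 
    proof (rule mult_mono[OF 2 1])
      show "0 \<le> 2 * B" by (rule order_trans[OF _ 2]) simp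
    qed simp
    finally show ?thesis .
  qed
  then show ?thesis unfolding bounded_iff by blast
qed

lemma convex_H2: "convex H2"
proof -
  have "H2 = {z. \<i> \<bullet> z > 0}" by (auto simp: H2_def inner_complex_def)
  also have "convex \<dots>" by (rule convex_halfspace_gt)
  finally show ?thesis .
qed

text \<open>A mirror that does not have \<open>x\<close> and a point of \<open>C\<close> strictly on
  one side meets the Euclidean segment between them, hence a compact convex subset of the
  half-plane.\<close>

lemma bounded_walls_separating:
  assumes C: "compact C" "C \<subseteq> H2" and x: "x \<in> H2"
  shows "bounded {R. refl_mat R \<and> (\<exists>z\<in>C. wpoly (R, x) * wpoly (R, z) \<le> 0)}"
proof (rule bounded_subset)
  let ?C = "convex hull (insert x C)"
  have "compact ?C" using C(1) by (intro compact_convex_hull compact_insert)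
  moreover have "?C \<subseteq> H2" using C(2) x by (intro hull_minimal convex_H2) auto
  ultimately show "bounded {R. refl_mat R \<and> (\<exists>z\<in>?C. \<bar>wall R z\<bar> \<le> 0)}" by (rule bounded_walls_near)
  show "{R. refl_mat R \<and> (\<exists>z\<in>C. wpoly (R, x) * wpoly (R, z) \<le> 0)} \<subseteq> {R. refl_mat R \<and> (\<exists>z\<in>?C. \<bar>wall R z\<bar> \<le> 0)}"
  proof safe
    fix R z assume R: "refl_mat R" "z \<in> C" "wpoly (R, x) * wpoly (R, z) \<le> 0"
    have con: "connected ((\<lambda>w. wpoly (R, w)) ` closed_segment x z)"
      by (intro connected_continuous_image continuous_on_compose2[OF continuous_wpoly] continuous_intros)
         (auto simp: connected_segment)
    have mem: "wpoly (R, x) \<in> (\<lambda>w. wpoly (R, w)) ` closed_segment x z" "wpoly (R, z) \<in> (\<lambda>w. wpoly (R, w)) ` closed_segment x z"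
      by auto
    have "wpoly (R, x) \<le> 0 \<and> 0 \<le> wpoly (R, z) \<or> wpoly (R, z) \<le> 0 \<and> 0 \<le> wpoly (R, x)"
      using R(3) by (auto simp: mult_le_0_iff)
    then have "0 \<in> (\<lambda>w. wpoly (R, w)) ` closed_segment x z"
      using con mem unfolding connected_iff_interval by blast
    then obtain w where w: "w \<in> closed_segment x z" "wpoly (R, w) = 0" by auto
    have "closed_segment x z \<subseteq> ?C"
      using R(2) by (intro closed_segment_subset) (auto intro: hull_inc convex_convex_hull)
    then show "\<exists>z\<in>?C. \<bar>wall R z\<bar> \<le> 0" using w by (intro bexI[of _ w]) (auto simp: wall_wpoly)
  qed
qed

section \<open>Joint measurability of conditions on mirrors\<close>

lemma closed_refl_mats: "closed {R. refl_mat R}"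
proof -
  have "mtr A = fst A + snd (snd (snd A))" "mdet A = fst A * snd (snd (snd A)) - fst (snd A) * fst (snd (snd A))" for A
    by (cases A; simp)+
  then have "{R. refl_mat R} = {A. fst A + snd (snd (snd A)) = 0} \<inter> {A. fst A * snd (snd (snd A)) - fst (snd A) * fst (snd (snd A)) = - 1}"
    by (auto simp: refl_mat_def)
  also have "closed \<dots>" by (intro closed_Int closed_Collect_eq continuous_intros)
  finally show ?thesis .
qed

lemma
  assumes "prob_on_SubG \<nu>"
  shows space_prob_on_SubG: "space \<nu> = SubG"
    and sets_prob_on_SubG: "sets \<nu> = sigma_sets SubG {U. openin chabauty U}"
proof -
  have "{U. openin chabauty U} \<subseteq> Pow SubG"
    using openin_subset[of chabauty] topspace_chabauty by auto
  then have "sets (sigma SubG {U. openin chabauty U}) = sigma_sets SubG {U. openin chabauty U}"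
    by (rule sets_measure_of)
  then show "space \<nu> = SubG" "sets \<nu> = sigma_sets SubG {U. openin chabauty U}"
    using assms by (simp_all add: prob_on_SubG_def borel_of_def topspace_chabauty)
qed

text \<open>Common form of depth and of membership in a tile: \<psi> is positive at all reflections
  of the group. Over a compact set of points only a bounded set of reflections can violate the
  condition, which yields openness in the point and measurability in point and group
  together.\<close>

locale wall_condition =
  fixes \<psi> :: "mat2 \<times> complex \<Rightarrow> real"
  assumes cont: "continuous_on UNIV \<psi>"
    and bnd: "compact C \<Longrightarrow> C \<subseteq> H2 \<Longrightarrow> bounded {R. refl_mat R \<and> (\<exists>z\<in>C. \<psi> (R, z) \<le> 0)}"
begin

definition bad :: "complex set \<Rightarrow> (mat2 \<times> complex) set" where
  "bad C = {q. refl_mat (fst q) \<and> snd q \<in> C \<and> \<psi> q \<le> 0}"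

lemma compact_bad:
  assumes "compact C" "C \<subseteq> H2" shows "compact (bad C)"
proof -
  have "bad C \<subseteq> {R. refl_mat R \<and> (\<exists>z\<in>C. \<psi> (R, z) \<le> 0)} \<times> C" by (auto simp: bad_def)
  then have "bounded (bad C)" using bounded_Times[OF bnd[OF assms] compact_imp_bounded[OF assms(1)]] bounded_subset by blast
  moreover have "bad C = ({R. refl_mat R} \<times> C) \<inter> {q. \<psi> q \<le> 0}" by (auto simp: bad_def)
  moreover have "closed \<dots>"
    by (intro closed_Int closed_Times closed_refl_mats compact_imp_closed[OF assms(1)] closed_Collect_le cont continuous_intros)
  ultimately show ?thesis by (simp add: compact_eq_bounded_closed)
qed

definition good :: "(complex \<Rightarrow> complex) set \<Rightarrow> complex \<Rightarrow> bool" where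
  "good H z \<longleftrightarrow> (\<forall>R\<in>lift H. refl_mat R \<longrightarrow> \<psi> (R, z) > 0)"

lemma good_iff_miss:
  "(\<forall>z\<in>C. good H z) \<longleftrightarrow> (\<forall>R\<in>lift H. R \<notin> fst ` bad C)"
  unfolding good_def bad_def by (force simp: not_le[symmetric])

lemma good_open:
  assumes H: "H \<in> SubG" and z: "z \<in> H2" "good H z"
  shows "\<exists>\<epsilon>>0. cball z \<epsilon> \<subseteq> H2 \<and> (\<forall>w\<in>cball z \<epsilon>. good H w)"
proof -
  have "open H2" unfolding H2_def by (intro open_Collect_less continuous_intros)
  then obtain e where e: "e > 0" "cball z e \<subseteq> H2" using z(1) open_contains_cball by blast
  show ?thesis
  proof (rule ccontr)
    assume contra: "\<not> ?thesis"
    have "\<exists>q. q \<in> bad (cball z (e / Suc n)) \<and> fst q \<in> lift H" for n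
    proof -
      have "cball z (e / Suc n) \<subseteq> cball z e" using e by (intro subset_cball) (simp add: field_simps)
      moreover have "e / Suc n > 0" using e by simp
      ultimately have "\<not> (\<forall>w\<in>cball z (e / Suc n). good H w)" using contra e(2) by (meson order_trans)
      then show ?thesis unfolding good_iff_miss by (auto intro: exI[of _ "(_, _)"])
    qed
    then obtain q where q: "\<And>n. q n \<in> bad (cball z (e / Suc n))" "\<And>n. fst (q n) \<in> lift H" by metis
    have sub: "bad (cball z (e / Suc n)) \<subseteq> bad (cball z e)" for n
    proof -
      have "cball z (e / Suc n) \<subseteq> cball z e" using e by (intro subset_cball) (simp add: field_simps)
      then show ?thesis by (auto simp: bad_def)
    qed
    have "compact (bad (cball z e))" by (rule compact_bad[OF compact_cball e(2)])
    moreover have "\<forall>n. q n \<in> bad (cball z e)" using q(1) sub by blast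
    ultimately obtain l s where l: "l \<in> bad (cball z e)" "strict_mono s" "(q \<circ> s) \<longlonglongrightarrow> l"
      unfolding compact_def by blast
    have lim: "(\<lambda>n. q (s n)) \<longlonglongrightarrow> l" using l(3) by (simp add: comp_def)
    have L: "fst l \<in> lift H"
      by (rule closed_sequentially[OF SubG_closed_lift[OF H] _ tendsto_fst[OF lim]]) (rule q(2))
    have sl: "snd l = z"
    proof -
      have d: "dist z (snd (q (s n))) \<le> e / real (Suc n)" for n
      proof -
        have "dist z (snd (q (s n))) \<le> e / real (Suc (s n))" using q(1)[of "s n"] by (auto simp: bad_def)
        also have "\<dots> \<le> e / real (Suc n)"
          using e seq_suble[OF l(2), of n] by (intro divide_left_mono) auto
        finally show ?thesis .
      qed
      have lim0: "(\<lambda>n. e / real (Suc n)) \<longlonglongrightarrow> 0"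
        using tendsto_mult_right_zero[OF LIMSEQ_inverse_real_of_nat, of e] by (simp add: divide_inverse)
      have "(\<lambda>n. dist z (snd (q (s n)))) \<longlonglongrightarrow> 0"
      proof (rule tendsto_sandwich[OF _ _ tendsto_const lim0])
        show "\<forall>\<^sub>F n in sequentially. 0 \<le> dist z (snd (q (s n)))" by simp
        show "\<forall>\<^sub>F n in sequentially. dist z (snd (q (s n))) \<le> e / real (Suc n)"
          by (rule always_eventually) (rule allI, rule d)
      qed
      moreover have "(\<lambda>n. dist z (snd (q (s n)))) \<longlonglongrightarrow> dist z (snd l)" by (intro tendsto_intros tendsto_snd lim)
      ultimately have "dist z (snd l) = 0" using LIMSEQ_unique by blast
      then show ?thesis by simp
    qed
    have l': "refl_mat (fst l)" "\<psi> l \<le> 0" using l(1) by (simp_all add: bad_def)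
    have "\<psi> (fst l, z) > 0" using z(2) L l'(1) unfolding good_def by blast
    moreover have "(fst l, z) = l" using sl by (simp add: prod_eq_iff)
    ultimately show False using l'(2) by simp
  qed
qed

text \<open>By openness in the point, a good pair lies in a product of a basic open set with the
  groups that miss the compact set of violating reflections over its closure. Countably many such
  products suffice.\<close>

lemma good_measurable:
  assumes \<nu>: "prob_on_SubG \<nu>"
  shows "{q \<in> space (borel \<Otimes>\<^sub>M \<nu>). fst q \<in> H2 \<and> good (snd q) (fst q)} \<in> sets (borel \<Otimes>\<^sub>M \<nu>)"
proof -
  obtain B :: "complex set set" where B: "countable B" "topological_basis B" using ex_countable_basis by auto
  define B' where "B' = {b \<in> B. compact (closure b) \<and> closure b \<subseteq> H2}"
  note sp = space_prob_on_SubG[OF \<nu>] and st = sets_prob_on_SubG[OF \<nu>]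
  have eq: "{q \<in> space (borel \<Otimes>\<^sub>M \<nu>). fst q \<in> H2 \<and> good (snd q) (fst q)} =
    (\<Union>b\<in>B'. b \<times> {H \<in> SubG. \<forall>R\<in>lift H. R \<notin> fst ` bad (closure b)})"
  proof (intro equalityI subsetI)
    fix q assume q: "q \<in> {q \<in> space (borel \<Otimes>\<^sub>M \<nu>). fst q \<in> H2 \<and> good (snd q) (fst q)}"
    then have H: "snd q \<in> SubG" by (auto simp: space_pair_measure sp)
    obtain e where e: "e > 0" "cball (fst q) e \<subseteq> H2" "\<forall>w\<in>cball (fst q) e. good (snd q) w"
      using good_open[OF H] q by blast
    obtain b where b: "b \<in> B" "fst q \<in> b" "b \<subseteq> ball (fst q) e"
      using topological_basisE[OF B(2) open_ball centre_in_ball[THEN iffD2, OF e(1)]] by metis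
    have cl: "closure b \<subseteq> cball (fst q) e"
      using b(3) by (intro closure_minimal) auto
    then have "compact (closure b)" by (intro compact_closure[THEN iffD2] bounded_subset[OF bounded_ball b(3)])
    then have "b \<in> B'" using b(1) cl e(2) by (auto simp: B'_def)
    moreover have "\<forall>R\<in>lift (snd q). R \<notin> fst ` bad (closure b)"
      unfolding good_iff_miss[symmetric] using cl e(3) by blast
    ultimately show "q \<in> (\<Union>b\<in>B'. b \<times> {H \<in> SubG. \<forall>R\<in>lift H. R \<notin> fst ` bad (closure b)})"
      using b(2) H by (intro UN_I[of b]) (auto simp: mem_Times_iff)
  next
    fix q assume "q \<in> (\<Union>b\<in>B'. b \<times> {H \<in> SubG. \<forall>R\<in>lift H. R \<notin> fst ` bad (closure b)})"
    then obtain b where b: "b \<in> B'" "fst q \<in> b" "snd q \<in> SubG" "\<forall>R\<in>lift (snd q). R \<notin> fst ` bad (closure b)"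
      by (auto simp: mem_Times_iff)
    then have "\<forall>z\<in>closure b. good (snd q) z" unfolding good_iff_miss by blast
    moreover have "fst q \<in> closure b" using b(2) closure_subset by blast
    ultimately show "q \<in> {q \<in> space (borel \<Otimes>\<^sub>M \<nu>). fst q \<in> H2 \<and> good (snd q) (fst q)}"
      using b by (auto simp: B'_def space_pair_measure sp mem_Times_iff)
  qed
  have meas: "b \<times> {H \<in> SubG. \<forall>R\<in>lift H. R \<notin> fst ` bad (closure b)} \<in> sets (borel \<Otimes>\<^sub>M \<nu>)" if b: "b \<in> B'" for b
  proof (rule pair_measureI)
    show "b \<in> sets borel" using b topological_basis_open[OF B(2)] by (auto simp: B'_def)
    have "compact (fst ` bad (closure b))" using b compact_bad[of "closure b"]
      by (intro compact_continuous_image continuous_intros) (auto simp: B'_def)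
    moreover have "fst ` bad (closure b) \<subseteq> unimod" by (auto simp: bad_def)
    ultimately have "openin chabauty {H \<in> SubG. \<forall>R\<in>lift H. R \<notin> fst ` bad (closure b)}" by (rule openin_chabauty_miss)
    then show "{H \<in> SubG. \<forall>R\<in>lift H. R \<notin> fst ` bad (closure b)} \<in> sets \<nu>" unfolding st by (intro sigma_sets.Basic) simp
  qed
  have "countable B'" using B(1) by (simp add: B'_def)
  then show ?thesis unfolding eq by (rule sets.countable_UN'') (rule meas)
qed

end

lemma wall_condition_deep: "wall_condition (\<lambda>q. (wpoly q)\<^sup>2 - k\<^sup>2 * (Im (snd q))\<^sup>2)"
proof
  show "continuous_on UNIV (\<lambda>q. (wpoly q)\<^sup>2 - k\<^sup>2 * (Im (snd q))\<^sup>2)"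
    by (intro continuous_intros continuous_wpoly)
  fix C :: "complex set" assume C: "compact C" "C \<subseteq> H2"
  have "{R. refl_mat R \<and> (\<exists>z\<in>C. (wpoly (R, z))\<^sup>2 - k\<^sup>2 * (Im (snd (R, z)))\<^sup>2 \<le> 0)} \<subseteq>
    {R. refl_mat R \<and> (\<exists>z\<in>C. \<bar>wall R z\<bar> \<le> \<bar>k\<bar>)}"
  proof safe
    fix R z assume z: "refl_mat R" "z \<in> C" "(wpoly (R, z))\<^sup>2 - k\<^sup>2 * (Im (snd (R, z)))\<^sup>2 \<le> 0"
    have "Im z > 0" using z C by (auto simp: H2_def)
    have "(wpoly (R, z))\<^sup>2 \<le> (k * Im z)\<^sup>2" using z(3) by (simp add: power_mult_distrib)
    then have "\<bar>wpoly (R, z)\<bar> \<le> \<bar>k\<bar> * Im z" using \<open>Im z > 0\<close> by (simp add: abs_le_square_iff[symmetric] abs_mult)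
    then have "\<bar>wall R z\<bar> \<le> \<bar>k\<bar>" using \<open>Im z > 0\<close> by (simp add: wall_wpoly field_simps)
    then show "\<exists>z\<in>C. \<bar>wall R z\<bar> \<le> \<bar>k\<bar>" using z(2) by blast
  qed
  then show "bounded {R. refl_mat R \<and> (\<exists>z\<in>C. (wpoly (R, z))\<^sup>2 - k\<^sup>2 * (Im (snd (R, z)))\<^sup>2 \<le> 0)}"
    using bounded_subset[OF bounded_walls_near[OF C]] by blast
qed

lemma wall_condition_sim:
  assumes "x \<in> H2" shows "wall_condition (\<lambda>q. wpoly (fst q, x) * wpoly q)"
proof
  show "continuous_on UNIV (\<lambda>q. wpoly (fst q, x) * wpoly q)"
    by (intro continuous_on_mult continuous_wpoly continuous_on_compose2[OF continuous_wpoly[of UNIV]] continuous_intros) auto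
  fix C :: "complex set" assume C: "compact C" "C \<subseteq> H2"
  show "bounded {R. refl_mat R \<and> (\<exists>z\<in>C. wpoly (fst (R, z), x) * wpoly (R, z) \<le> 0)}"
    using bounded_walls_separating[OF C assms] by simp
qed

lemma deep_iff_good:
  assumes "z \<in> H2" "k \<ge> 0"
  shows "deep k H z \<longleftrightarrow> wall_condition.good (\<lambda>q. (wpoly q)\<^sup>2 - k\<^sup>2 * (Im (snd q))\<^sup>2) H z"
proof -
  have z: "Im z > 0" using assms by (simp add: H2_def)
  have "\<bar>wall R z\<bar> > k \<longleftrightarrow> (wpoly (R, z))\<^sup>2 - k\<^sup>2 * (Im (snd (R, z)))\<^sup>2 > 0" for R
  proof -
    have "\<bar>wall R z\<bar> > k \<longleftrightarrow> k * Im z < \<bar>wpoly (R, z)\<bar>" using z by (simp add: wall_wpoly field_simps)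
    also have "\<dots> \<longleftrightarrow> \<bar>k * Im z\<bar> < \<bar>wpoly (R, z)\<bar>" using z assms(2) by (simp add: abs_mult)
    also have "\<dots> \<longleftrightarrow> (k * Im z)\<^sup>2 < (wpoly (R, z))\<^sup>2"
      unfolding linorder_not_le[symmetric] abs_le_square_iff ..
    finally show ?thesis by (simp add: power_mult_distrib)
  qed
  then show ?thesis unfolding deep_def wall_condition.good_def[OF wall_condition_deep] by simp
qed

lemma sim_iff_good:
  assumes "x \<in> H2" "z \<in> H2"
  shows "sim H x z \<longleftrightarrow> wall_condition.good (\<lambda>q. wpoly (fst q, x) * wpoly q) H z"
proof -
  have "Im x * Im z > 0" using assms by (simp add: H2_def)
  then have "wall R x * wall R z > 0 \<longleftrightarrow> wpoly (fst (R, z), x) * wpoly (R, z) > 0" for R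
    by (auto simp: wall_wpoly zero_less_divide_iff)
  then show ?thesis unfolding sim_def wall_condition.good_def[OF wall_condition_sim[OF assms(1)]] by simp
qed

lemma deep_measurable:
  assumes "prob_on_SubG \<nu>" "k \<ge> 0"
  shows "{q \<in> space (borel \<Otimes>\<^sub>M \<nu>). fst q \<in> H2 \<and> deep k (snd q) (fst q)} \<in> sets (borel \<Otimes>\<^sub>M \<nu>)"
proof -
  have "{q \<in> space (borel \<Otimes>\<^sub>M \<nu>). fst q \<in> H2 \<and> deep k (snd q) (fst q)} =
    {q \<in> space (borel \<Otimes>\<^sub>M \<nu>). fst q \<in> H2 \<and> wall_condition.good (\<lambda>q. (wpoly q)\<^sup>2 - k\<^sup>2 * (Im (snd q))\<^sup>2) (snd q) (fst q)}"
    using deep_iff_good[OF _ assms(2)] by blast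
  then show ?thesis using wall_condition.good_measurable[OF wall_condition_deep assms(1)] by simp
qed

lemma tile_measurable:
  assumes "prob_on_SubG \<nu>" "x \<in> H2"
  shows "{q \<in> space (borel \<Otimes>\<^sub>M \<nu>). fst q \<in> tile (snd q) x} \<in> sets (borel \<Otimes>\<^sub>M \<nu>)"
proof -
  have "{q \<in> space (borel \<Otimes>\<^sub>M \<nu>). fst q \<in> tile (snd q) x} =
    {q \<in> space (borel \<Otimes>\<^sub>M \<nu>). fst q \<in> H2 \<and> wall_condition.good (\<lambda>q. wpoly (fst q, x) * wpoly q) (snd q) (fst q)}"
    using sim_iff_good[OF assms(2)] unfolding tile_def by blast
  then show ?thesis using wall_condition.good_measurable[OF wall_condition_sim[OF assms(2)] assms(1)] by simp
qed

lemma open_tile: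
  assumes H: "H \<in> SubG" and x: "x \<in> H2" shows "open (tile H x)"
  unfolding open_contains_cball
proof
  fix z assume z: "z \<in> tile H x"
  then have "z \<in> H2" "wall_condition.good (\<lambda>q. wpoly (fst q, x) * wpoly q) H z"
    using sim_iff_good[OF x] by (auto simp: tile_def)
  from wall_condition.good_open[OF wall_condition_sim[OF x] H this]
  obtain e where e: "e > 0" "cball z e \<subseteq> H2" "\<forall>w\<in>cball z e. wall_condition.good (\<lambda>q. wpoly (fst q, x) * wpoly q) H w"
    by blast
  then have "cball z e \<subseteq> tile H x" using sim_iff_good[OF x] unfolding tile_def by blast
  then show "\<exists>e>0. cball z e \<subseteq> tile H x" using e(1) by blast
qed

section \<open>Tiles of polygon groups\<close>

lemma closed_halfplane_wall:
  assumes "h \<in> closed_halfplanes"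
  shows "\<exists>R. refl_mat R \<and> h = {z \<in> H2. wall R z \<le> 0}"
proof -
  have w1: "wall (- 1, 2 * a, 0, 1) z \<le> 0 \<longleftrightarrow> Re z \<le> a" "wall (1, - 2 * a, 0, - 1) z \<le> 0 \<longleftrightarrow> Re z \<ge> a"
    if "z \<in> H2" for z a
    using that by (auto simp: H2_def divide_le_0_iff)
  have w2: "wall (c / r, r - c\<^sup>2 / r, 1 / r, - c / r) z = ((cmod (z - complex_of_real c))\<^sup>2 - r\<^sup>2) / (r * Im z)"
    if "r > 0" for c r z
  proof -
    have "1 / r * ((Re z)\<^sup>2 + (Im z)\<^sup>2) + (- c / r - c / r) * Re z - (r - c\<^sup>2 / r) =
        ((Re z - c)\<^sup>2 + (Im z)\<^sup>2 - r\<^sup>2) / r"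
      using that by (simp add: power2_eq_square field_simps)
    moreover have "(cmod (z - complex_of_real c))\<^sup>2 = (Re z - c)\<^sup>2 + (Im z)\<^sup>2" by (simp add: cmod_power2)
    ultimately show ?thesis by simp
  qed
  have w3: "wall (c / r, r - c\<^sup>2 / r, 1 / r, - c / r) z \<le> 0 \<longleftrightarrow> cmod (z - complex_of_real c) \<le> r"
    "wall (- (c / r, r - c\<^sup>2 / r, 1 / r, - c / r)) z \<le> 0 \<longleftrightarrow> cmod (z - complex_of_real c) \<ge> r"
    if "z \<in> H2" "r > 0" for z c r
  proof -
    have p: "r * Im z > 0" using that by (simp add: H2_def)
    have m: "wall (- A) z = - wall A z" for A by (cases A) (simp add: minus_divide_left algebra_simps)
    show "wall (c / r, r - c\<^sup>2 / r, 1 / r, - c / r) z \<le> 0 \<longleftrightarrow> cmod (z - complex_of_real c) \<le> r"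
      unfolding w2[OF that(2)] using p that by (simp add: divide_le_0_iff abs_le_square_iff[symmetric])
    show "wall (- (c / r, r - c\<^sup>2 / r, 1 / r, - c / r)) z \<le> 0 \<longleftrightarrow> cmod (z - complex_of_real c) \<ge> r"
      unfolding m w2[OF that(2)] using p that by (simp add: zero_le_divide_iff abs_le_square_iff[symmetric])
  qed
  have r3: "refl_mat (c / r, r - c\<^sup>2 / r, 1 / r, - c / r)" if "r > 0" for c r
    using that by (simp add: refl_mat_iff power2_eq_square field_simps)
  consider a where "h = {z \<in> H2. Re z \<le> a}" | a where "h = {z \<in> H2. Re z \<ge> a}"
    | c r where "r > 0" "h = {z \<in> H2. cmod (z - complex_of_real c) \<le> r}"
    | c r where "r > 0" "h = {z \<in> H2. cmod (z - complex_of_real c) \<ge> r}"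
    using assms unfolding closed_halfplanes_def by blast
  then show ?thesis
  proof cases
    case 1
    show ?thesis by (rule exI[of _ "(- 1, 2 * a, 0, 1)"]) (use w1 in \<open>auto simp: 1 refl_mat_iff simp del: wall.simps\<close>)
  next
    case 2
    show ?thesis by (rule exI[of _ "(1, - 2 * a, 0, - 1)"]) (use w1 in \<open>auto simp: 2 refl_mat_iff simp del: wall.simps\<close>)
  next
    case (3 c r)
    have "h = {z \<in> H2. wall (c / r, r - c\<^sup>2 / r, 1 / r, - c / r) z \<le> 0}" 
      unfolding 3(2) by (intro Collect_cong conj_cong refl) (rule w3(1)[OF _ 3(1), symmetric])
    then show ?thesis using r3[OF 3(1)] by blast
  next
    case (4 c r)
    have "h = {z \<in> H2. wall (- (c / r, r - c\<^sup>2 / r, 1 / r, - c / r)) z \<le> 0}" 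
      unfolding 4(2) by (intro Collect_cong conj_cong refl) (rule w3(2)[OF _ 4(1), symmetric])
    moreover have "refl_mat (- (c / r, r - c\<^sup>2 / r, 1 / r, - c / r))" using r3[OF 4(1), of c] by (simp only: refl_mat_minus)
    ultimately show ?thesis by blast
  qed
qed

lemma hp_boundary_wall:
  assumes "h = {z \<in> H2. wall R z \<le> 0}" "z \<in> hp_boundary h"
  shows "z \<in> H2 \<and> wall R z = 0"
proof -
  have z: "z \<in> H2" "wall R z \<le> 0" "z \<in> closure (H2 - h)" using assms by (auto simp: hp_boundary_def)
  have "closure (H2 - h) \<subseteq> {z. wpoly (R, z) \<ge> 0}"
  proof (rule closure_minimal)
    show "H2 - h \<subseteq> {z. wpoly (R, z) \<ge> 0}"
    proof
      fix w assume "w \<in> H2 - h"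
      then have "wall R w > 0" "Im w > 0" by (auto simp: assms(1) H2_def)
      then show "w \<in> {z. wpoly (R, z) \<ge> 0}" by (simp add: wall_wpoly zero_less_divide_iff)
    qed
    show "closed {z. wpoly (R, z) \<ge> 0}"
      by (intro closed_Collect_le continuous_on_compose2[OF continuous_wpoly[of UNIV]] continuous_intros) auto
  qed
  then have "wpoly (R, z) \<ge> 0" using z(3) by blast
  then have "wall R z \<ge> 0" using z(1) by (simp add: wall_wpoly H2_def)
  then show ?thesis using z by simp
qed

text \<open>From any point the numerator of the wall function strictly increases in some direction:
  horizontally for a vertical mirror, vertically otherwise. An interior point with value at least 0
  would have neighbours with positive value.\<close>

lemma interior_wall_neg:
  assumes R: "refl_mat R" and p: "p \<in> interior {z \<in> H2. wall R z \<le> 0}"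
  shows "wall R p < 0"
proof (rule ccontr)
  obtain a b c d where Re: "R = (a, b, c, d)" by (cases R)
  have r: "a = - d" "d * d + b * c = 1" using R by (auto simp: Re refl_mat_iff)
  obtain e where e: "e > 0" "ball p e \<subseteq> {z \<in> H2. wall R z \<le> 0}" using p mem_interior by blast
  have "p \<in> ball p e" using e(1) by simp
  then have "p \<in> H2" using e(2) by blast
  then have pH: "Im p > 0" by (simp add: H2_def)
  assume "\<not> wall R p < 0"
  then have p0: "wpoly (R, p) \<ge> 0" using pH by (auto simp: wall_wpoly divide_less_0_iff not_less)
  have le: "wpoly (R, w) \<le> 0" if "cmod (p - w) < e" for w
  proof -
    have "w \<in> ball p e" using that by (simp add: dist_norm)
    then have "w \<in> H2" "wall R w \<le> 0" using e(2) by auto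
    then show ?thesis by (auto simp: wall_wpoly H2_def divide_le_0_iff)
  qed
  show False
  proof (cases "c = 0")
    case True
    then have d: "d \<noteq> 0" using r by auto
    define t where "t = (if d > 0 then e / 2 else - e / 2)"
    have "d * t > 0"
    proof (cases "d > 0")
      case False
      then have "d < 0" using d by simp
      then show ?thesis using e(1) by (simp add: t_def mult_neg_pos)
    qed (use e(1) in \<open>simp add: t_def\<close>)
    moreover have "\<bar>t\<bar> < e" using e(1) by (simp add: t_def)
    ultimately have t: "d * t > 0" "\<bar>t\<bar> < e" by blast+
    have "wpoly (R, p + of_real t) = wpoly (R, p) + 2 * (d * t)"
      using r(1) by (simp add: Re True wpoly_def algebra_simps)
    moreover have "wpoly (R, p + of_real t) \<le> 0" by (rule le) (use t in simp)
    ultimately show False using p0 t by linarith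
  next
    case False
    define t where "t = (if c > 0 then min (e / 2) (Im p) else - min (e / 2) (Im p))"
    have t: "\<bar>t\<bar> < e" "\<bar>t\<bar> \<le> Im p" "c * t > 0"
      using False e(1) pH by (auto simp: t_def mult_neg_neg mult_neg_pos)
    have "wpoly (R, p + \<i> * of_real t) = wpoly (R, p) + c * t * (2 * Im p + t)"
      by (simp add: Re wpoly_def power2_eq_square algebra_simps)
    moreover have "2 * Im p + t > 0" using t(2) pH by linarith
    then have "c * t * (2 * Im p + t) > 0" by (rule mult_pos_pos[OF t(3)])
    moreover have "wpoly (R, p + \<i> * of_real t) \<le> 0" by (rule le) (use t in \<open>simp add: norm_mult\<close>)
    ultimately show False using p0 by linarith
  qed
qed

lemma side_reflections_subset: "side_reflections S \<subseteq> reflections"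
  by (auto simp: side_reflections_def)

lemma reflections_subset_isom: "reflections \<subseteq> isom"
  by (auto simp: reflections_def)

lemma subgroup_Gamma: "subgroup (Gamma S) IsomG"
  unfolding Gamma_def
  by (rule group.generate_is_subgroup[OF group_IsomG])
     (use side_reflections_subset reflections_subset_isom in auto)

lemma subgroup_isom: "subgroup H IsomG \<Longrightarrow> H \<subseteq> isom"
  using subgroup.subset by fastforce

lemma lift_conj_self:
  assumes H: "subgroup H IsomG" and M: "M \<in> lift H"
  shows "lift (conj (mob M) H) = lift H"
proof -
  interpret mat_group "lift H" by (rule mat_group_lift[OF H])
  have u: "M \<in> unimod" using M by auto
  have "minv M \<odot> A \<odot> M \<in> lift H \<longleftrightarrow> A \<in> lift H" for A
  proof
    assume "minv M \<odot> A \<odot> M \<in> lift H"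
    then have "M \<odot> (minv M \<odot> A \<odot> M) \<odot> minv M \<in> lift H" using M mul inv by metis
    then show "A \<in> lift H" using u by (simp add: mmul_assoc)
  next
    assume "A \<in> lift H"
    then show "minv M \<odot> A \<odot> M \<in> lift H" using M mul inv by metis
  qed
  then show ?thesis using lift_conj[OF u subgroup_isom[OF H]] u by (simp add: cj_def)
qed

lemma deep_tile_lift_cong:
  "lift H = lift H' \<Longrightarrow> deep k H z \<longleftrightarrow> deep k H' z"
  "lift H = lift H' \<Longrightarrow> tile H z = tile H' z"
  by (auto simp: deep_def tile_def sim_def)

context
  fixes P :: "complex set" and S :: "complex set set"
  assumes cox: "coxeter_polygon P S"
begin

lemma side_wall:
  assumes "h \<in> S"
  shows "\<exists>R\<in>lift (Gamma S). refl_mat R \<and> h = {z \<in> H2. wall R z \<le> 0}"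
proof -
  have "h \<in> closed_halfplanes" using cox assms by (auto simp: coxeter_polygon_def)
  then obtain R where R: "refl_mat R" "h = {z \<in> H2. wall R z \<le> 0}" using closed_halfplane_wall by blast
  have "mob R z = z" if "z \<in> hp_boundary h" for z
    using hp_boundary_wall[OF R(2) that] mob_refl_fixes_iff[OF R(1)] by blast
  moreover have "mob R \<in> reflections" using R(1) reflections_eq by blast
  ultimately have "mob R \<in> side_reflections S" using assms unfolding side_reflections_def by blast
  then have "mob R \<in> Gamma S" unfolding Gamma_def by (rule generate.incl)
  then show ?thesis using R by (intro bexI[of _ R]) (auto simp: lift_def)
qed

lemma polygon_measurable: "P \<in> sets borel"
proof -
  have H2: "H2 \<in> sets borel" unfolding H2_def by (intro borel_open open_Collect_less continuous_intros)
  have "h \<in> sets borel" if "h \<in> S" for h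
  proof -
    obtain R where "h = {z \<in> H2. wall R z \<le> 0}" using side_wall[OF \<open>h \<in> S\<close>] by blast
    then have "h = H2 \<inter> {z. wpoly (R, z) \<le> 0}" by (auto simp: wall_wpoly H2_def divide_le_0_iff)
    moreover have "closed {z. wpoly (R, z) \<le> 0}"
      by (intro closed_Collect_le continuous_on_compose2[OF continuous_wpoly[of UNIV]] continuous_intros) auto
    ultimately show ?thesis using H2 borel_closed by auto
  qed
  moreover have "P = H2 \<inter> \<Inter>S" "finite S" using cox by (auto simp: coxeter_polygon_def)
  moreover have "\<Inter>S \<in> sets borel \<or> S = {}"
    using sets.finite_INT[of S "\<lambda>h. h" borel] calculation by auto
  ultimately show ?thesis using H2 by auto
qed

text \<open>Reflecting in a side that separates the orbit point from an interior point of the polygon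
  decreases the distance to the latter by a definite amount.\<close>
lemma orbit_meets_polygon:
  assumes z: "z \<in> H2" and k: "k > 0" and dp: "deep k (Gamma S) z"
  shows "\<exists>M\<in>lift (Gamma S). mob M z \<in> P"
proof -
  interpret mat_group "lift (Gamma S)" by (rule mat_group_lift[OF subgroup_Gamma])
  have PS: "P = H2 \<inter> \<Inter>S" "finite S" "interior P \<noteq> {}" using cox by (auto simp: coxeter_polygon_def)
  obtain p where p: "p \<in> interior P" using PS(3) by blast
  have pH: "p \<in> H2" using p interior_subset PS(1) by blast
  obtain R where R: "\<And>h. h \<in> S \<Longrightarrow> R h \<in> lift (Gamma S)" "\<And>h. h \<in> S \<Longrightarrow> refl_mat (R h)"
    "\<And>h. h \<in> S \<Longrightarrow> h = {z \<in> H2. wall (R h) z \<le> 0}" using side_wall by metis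
  have neg: "wall (R h) p < 0" if "h \<in> S" for h
  proof (rule interior_wall_neg[OF R(2)[OF that]])
    have "P \<subseteq> h" using PS(1) that by blast
    then show "p \<in> interior {z \<in> H2. wall (R h) z \<le> 0}" 
      using p interior_mono[of P h] unfolding R(3)[OF that, symmetric] by blast
  qed
  have "\<exists>m>0. \<forall>h\<in>S. wall (R h) p \<le> - m"
  proof (cases "S = {}")
    case False
    let ?m = "Min ((\<lambda>h. - wall (R h) p) ` S)"
    have "?m \<in> (\<lambda>h. - wall (R h) p) ` S" using PS(2) False by (intro Min_in) auto
    then have "?m > 0" using neg by auto
    moreover have "?m \<le> - wall (R h) p" if "h \<in> S" for h using PS(2) that by (intro Min_le) auto
    then have "\<forall>h\<in>S. wall (R h) p \<le> - ?m" by fastforce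
    ultimately show ?thesis by blast
  qed (auto intro: exI[of _ 1])
  then obtain m where m: "m > 0" "\<And>h. h \<in> S \<Longrightarrow> wall (R h) p \<le> - m" by blast
  \<comment> \<open>Discreteness is not at hand, so the infimum over the orbit is only approached.
    Reflecting in a violated side gains at least m * k / 2, hence a point this close to the infimum
    violates no side.\<close>
  let ?V = "(\<lambda>M. hcosh p (mob M z)) ` lift (Gamma S)"
  have bdd: "bdd_below ?V"
    by (rule bdd_belowI[of _ 1]) (use z pH in \<open>auto intro!: hcosh_ge_1 mob_in_H2\<close>)
  have "Inf ?V < Inf ?V + m * k / 2" using m k by simp
  then obtain v where v: "v \<in> ?V" "v < Inf ?V + m * k / 2"
    using cInf_lessD[of ?V] one by blast
  then obtain M where M: "M \<in> lift (Gamma S)" "hcosh p (mob M z) < Inf ?V + m * k / 2" by blast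
  have Mu: "M \<in> unimod" using M(1) by (rule unimod)
  then have Mz: "mob M z \<in> H2" using z by (rule mob_in_H2)
  have "deep k (conj (mob M) (Gamma S)) (mob M z)"
    using deep_conj[OF Mu subgroup_isom[OF subgroup_Gamma] z] dp by blast
  then have dM: "deep k (Gamma S) (mob M z)"
    using deep_tile_lift_cong(1)[OF lift_conj_self[OF subgroup_Gamma M(1)]] by blast
  have "mob M z \<in> P"
  proof (rule ccontr)
    assume "mob M z \<notin> P"
    then obtain h where h: "h \<in> S" "mob M z \<notin> h" using PS(1) Mz by blast
    then have "mob M z \<notin> {z \<in> H2. wall (R h) z \<le> 0}" using R(3)[OF h(1)] by blast
    then have "wall (R h) (mob M z) > 0" using Mz by simp
    moreover have "\<bar>wall (R h) (mob M z)\<bar> > k" using dM R(1,2)[OF h(1)] unfolding deep_def by blast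
    ultimately have w: "wall (R h) (mob M z) > k" by simp
    have "m * k \<le> (- wall (R h) p) * wall (R h) (mob M z)"
      using m(1) m(2)[OF h(1)] w k by (intro mult_mono) auto
    moreover have "hcosh p (mob (R h \<odot> M) z) = hcosh p (mob M z) + wall (R h) p * wall (R h) (mob M z) / 2"
      using hcosh_refl_mat[OF R(2)[OF h(1)] pH Mz] M R(2)[OF h(1)] by (simp add: mob_mmul)
    ultimately have "hcosh p (mob (R h \<odot> M) z) < Inf ?V" using M(2) by simp
    moreover have "hcosh p (mob (R h \<odot> M) z) \<in> ?V" using M(1) R(1)[OF h(1)] by blast
    ultimately show False using cInf_lower[OF _ bdd] by fastforce
  qed
  then show ?thesis using M(1) by blast
qed

text \<open>The reflections in the sides belong to the group, so a tile cannot cross a side.\<close>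

lemma tile_subset_polygon:
  assumes z: "z \<in> P" "deep k (Gamma S) z" "k \<ge> 0"
  shows "tile (Gamma S) z \<subseteq> P"
proof
  fix w assume w: "w \<in> tile (Gamma S) z"
  then have wH: "w \<in> H2" "sim (Gamma S) z w" by (auto simp: tile_def)
  have PS: "P = H2 \<inter> \<Inter>S" using cox by (auto simp: coxeter_polygon_def)
  have "w \<in> h" if h: "h \<in> S" for h
  proof -
    obtain R where R: "R \<in> lift (Gamma S)" "refl_mat R" "h = {z \<in> H2. wall R z \<le> 0}" using side_wall[OF h] by blast
    have "z \<in> h" using z(1) PS h by blast
    then have "wall R z \<le> 0" unfolding R(3) by blast
    moreover have "wall R z * wall R w > 0" using wH(2) R unfolding sim_def by blast
    ultimately have "wall R w < 0" by (auto simp: zero_less_mult_iff)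
    then show ?thesis unfolding R(3) using wH(1) by simp
  qed
  then show "w \<in> P" using PS wH(1) by blast
qed

text \<open>Undo the conjugation, then move the deep point into \<open>P\<close> by an element of
  the group: the tile goes into \<open>P\<close>, and area is invariant.\<close>

lemma harea_tile_finite:
  assumes H: "H \<in> SubG" "H = conj (mob K) (Gamma S)" "K \<in> unimod"
    and z: "z \<in> H2" and k: "k > 0" and dp: "deep k H z"
  shows "harea (tile H z) < \<infinity>"
proof -
  define x where "x = mob (minv K) z"
  have x: "x \<in> H2" "mob K x = z" using H(3) z by (auto simp: x_def mob_in_H2)
  note \<Gamma> = subgroup_isom[OF subgroup_Gamma[of S]]
  have dx: "deep k (Gamma S) x" using deep_conj[OF H(3) \<Gamma> x(1), of k] dp H(2) x(2) by simp
  obtain M where M: "M \<in> lift (Gamma S)" "mob M x \<in> P" using orbit_meets_polygon[OF x(1) k dx] by blast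
  have Mu: "M \<in> unimod" using M(1) by (simp add: lift_def)
  have "deep k (Gamma S) (mob M x)"
    using deep_conj[OF Mu \<Gamma> x(1), of k] dx deep_tile_lift_cong(1)[OF lift_conj_self[OF subgroup_Gamma M(1)]] by blast
  then have sub: "tile (Gamma S) (mob M x) \<subseteq> P" using tile_subset_polygon[OF M(2)] k by simp
  have t1: "tile (Gamma S) (mob M x) = mob M ` tile (Gamma S) x"
    using tile_conj[OF Mu \<Gamma> x(1)] deep_tile_lift_cong(2)[OF lift_conj_self[OF subgroup_Gamma M(1)]] by metis
  have t2: "tile H z = mob K ` tile (Gamma S) x" using tile_conj[OF H(3) \<Gamma> x(1)] H(2) x(2) by simp
  let ?N = "M \<odot> minv K"
  have t3: "mob ?N ` tile H z = tile (Gamma S) (mob M x)"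
    unfolding t1 t2 image_image using H(3) Mu by (simp add: mob_mmul)
  have TB: "tile H z \<in> sets borel" using open_tile[OF H(1) z] by (rule borel_open)
  have TH: "tile H z \<subseteq> H2" by (auto simp: tile_def)
  have "harea (tile H z) = harea (mob ?N ` tile H z)" using harea_mob(2)[OF _ TB TH, of ?N] H(3) Mu by simp
  also have "\<dots> \<le> harea P" unfolding t3 harea_hmeas by (rule emeasure_mono[OF sub]) (simp add: polygon_measurable)
  also have "\<dots> < \<infinity>" using cox unfolding coxeter_polygon_def by blast
  finally show ?thesis .
qed

end

section \<open>Continuity of conjugation on closed subgroups\<close>

lemma closedin_if_closed_lift:
  assumes "H \<subseteq> isom" "closed (lift H)" shows "closedin Gtop H"
proof -
  have "isom - H = mob ` (- lift H \<inter> unimod)"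
  proof (intro equalityI subsetI)
    fix f assume f: "f \<in> isom - H"
    then obtain M where M: "M \<in> unimod" "f = mob M" using isom_imp_mob by blast
    then have "M \<notin> lift H" using f by (simp add: lift_def)
    then show "f \<in> mob ` (- lift H \<inter> unimod)" using M by blast
  next
    fix f assume "f \<in> mob ` (- lift H \<inter> unimod)"
    then obtain M where M: "M \<in> unimod" "M \<notin> lift H" "f = mob M" by blast
    then show "f \<in> isom - H" using mob_isom by (simp add: lift_def)
  qed
  moreover have "openin Gtop (mob ` (- lift H \<inter> unimod))"
    by (rule openin_mob) (use assms(2) in \<open>simp add: open_Compl\<close>)
  moreover have "topspace Gtop = isom" by (simp add: Gtop_def)
  ultimately show ?thesis using assms(1) by (simp add: closedin_def)
qed

lemma subgroup_if_mat_group_lift: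
  assumes "H \<subseteq> isom" "mat_group (lift H)" shows "subgroup H IsomG"
proof
  have mat: "\<exists>M. M \<in> lift H \<and> x = mob M" if "x \<in> H" for x
  proof -
    have "x \<in> isom" using that assms(1) by blast
    from isom_imp_mob[OF this] obtain M where "M \<in> unimod" "x = mob M" ..
    then show ?thesis using that by (intro exI[of _ M]) (simp add: lift_def)
  qed
  show "H \<subseteq> carrier IsomG" using assms(1) by simp
  show "\<one>\<^bsub>IsomG\<^esub> \<in> H" using mat_group.one[OF assms(2)] by (simp add: lift_iff mob_mone_id)
  fix x assume "x \<in> H"
  then obtain A where A: "A \<in> lift H" "x = mob A" using mat by blast
  have Au: "A \<in> unimod" using A(1) by (simp add: lift_iff)
  show "inv\<^bsub>IsomG\<^esub> x \<in> H" using mat_group.inv[OF assms(2) A(1)] Au A(2) by (simp add: lift_iff inv_IsomG_mob)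
  fix y assume "y \<in> H"
  then obtain B where B: "B \<in> lift H" "y = mob B" using mat by blast
  have Bu: "B \<in> unimod" using B(1) by (simp add: lift_iff)
  show "x \<otimes>\<^bsub>IsomG\<^esub> y \<in> H" using mat_group.mul[OF assms(2) A(1) B(1)] Au Bu A(2) B(2) by (simp add: lift_iff mob_comp)
qed

lemma conj_subset_isom:
  assumes "K \<in> unimod" "H \<subseteq> isom" shows "conj (mob K) H \<subseteq> isom"
  unfolding conj_def inv_into_mob[OF assms(1)]
  using assms(2) isom_comp mob_isom[OF assms(1)] mob_isom[OF minv_unimod[OF assms(1)]] by blast

lemma continuous_conj: "continuous_on UNIV (\<lambda>M. K \<odot> M \<odot> L)"
  unfolding continuous_on_def by (intro ballI tendsto_mmul tendsto_intros)

lemma SubG_conj: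
  assumes "K \<in> unimod" "H \<in> SubG" shows "conj (mob K) H \<in> SubG"
proof -
  have H: "H \<subseteq> isom" using subgroup_isom[OF SubG_subgroup[OF assms(2)]] .
  have l: "lift (conj (mob K) H) = cj (minv K) (lift H)" by (rule lift_conj[OF assms(1) H])
  have "mat_group (lift (conj (mob K) H))" unfolding l
    by (rule mat_group_cj[OF SubG_mat_group[OF assms(2)]]) (use assms(1) in simp)
  moreover have "closed (lift (conj (mob K) H))"
  proof -
    have "cj (minv K) (lift H) = (\<lambda>M. minv K \<odot> M \<odot> minv (minv K)) -` lift H" by (auto simp: cj_def)
    then show ?thesis unfolding l
      using closed_vimage[OF SubG_closed_lift[OF assms(2)] continuous_conj] by simp
  qed
  ultimately show ?thesis
    using subgroup_if_mat_group_lift closedin_if_closed_lift conj_subset_isom[OF assms(1) H]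
    by (simp add: SubG_def)
qed

text \<open>Properness: on a compact set of isometries the displacement of i, and hence the norm of
  the matrices, is bounded.\<close>

lemma compact_lift:
  assumes "compactin Gtop K" shows "compact (lift K)"
proof -
  have K: "compact K" "K \<subseteq> isom" using assms by (simp_all add: Gtop_def compactin_subtopology)
  have "Hausdorff_space (euclidean :: (complex \<Rightarrow> complex) topology)"
    unfolding euclidean_product_topology[symmetric] Hausdorff_space_product_topology by simp
  then have "closedin Gtop K"
    using compactin_imp_closedin[OF _ assms] by (simp add: Gtop_def Hausdorff_space_subtopology)
  then have "closed (lift K)" by (rule closed_lift)
  moreover have "bounded (lift K)"
  proof -
    have i: "\<i> \<in> H2" by (simp add: H2_def)
    have "continuous_on K (\<lambda>f. f \<i>)" by (rule continuous_on_subset[OF continuous_on_product_coordinates]) simp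
    moreover have "Im (f \<i>) > 0" if "f \<in> K" for f using that K(2) isom_in_H2[OF _ i] by (auto simp: H2_def)
    ultimately have "continuous_on K (\<lambda>f. hcosh \<i> (f \<i>))"
      unfolding hcosh_def by (intro continuous_intros) fastforce+
    then have "bounded ((\<lambda>f. hcosh \<i> (f \<i>)) ` K)" using K(1) compact_continuous_image compact_imp_bounded by blast
    then obtain C where C: "\<And>f. f \<in> K \<Longrightarrow> \<bar>hcosh \<i> (f \<i>)\<bar> \<le> C" by (auto simp: bounded_iff)
    have "norm M \<le> sqrt (2 * C)" if M: "M \<in> lift K" for M
    proof (rule real_le_rsqrt)
      have "M \<in> unimod" "mob M \<in> K" using M by (simp_all add: lift_def)
      then show "(norm M)\<^sup>2 \<le> 2 * C" using norm_eq_hcosh[of M] C[of "mob M"] by simp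
    qed
    then show ?thesis unfolding bounded_iff by blast
  qed
  ultimately show ?thesis by (simp add: compact_eq_bounded_closed)
qed

lemma continuous_map_conj:
  assumes K: "K \<in> unimod"
  shows "continuous_map chabauty chabauty (conj (mob K))"
proof -
  let ?S = "{{H. H \<inter> K = {}} | K. compactin Gtop K} \<union> {{H. H \<inter> U \<noteq> {}} | U. openin Gtop U}"
  have K': "minv K \<in> unimod" using K by simp
  have liftc: "M \<in> lift (conj (mob K) H) \<longleftrightarrow> minv K \<odot> M \<odot> K \<in> lift H" if "H \<in> SubG" for H M
    using lift_conj_iff[OF K subgroup_isom[OF SubG_subgroup[OF that]]] .
  have hit: "conj (mob K) H \<inter> X \<noteq> {} \<longleftrightarrow> (\<exists>M\<in>lift H. M \<in> {M. K \<odot> M \<odot> minv K \<in> lift X})"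
    if H: "H \<in> SubG" for H X
  proof
    assume "conj (mob K) H \<inter> X \<noteq> {}"
    then obtain f where f: "f \<in> conj (mob K) H" "f \<in> X" by blast
    then have "f \<in> isom" using conj_subset_isom[OF K subgroup_isom[OF SubG_subgroup[OF H]]] by blast
    then obtain M where M: "M \<in> unimod" "f = mob M" using isom_imp_mob by blast
    then have 1: "M \<in> lift (conj (mob K) H)" "M \<in> lift X" using f by (simp_all add: lift_def)
    have "K \<odot> (minv K \<odot> M \<odot> K) \<odot> minv K = M" using K by (simp add: mmul_assoc)
    then show "\<exists>M\<in>lift H. M \<in> {M. K \<odot> M \<odot> minv K \<in> lift X}"
      using 1 liftc[OF H] by (intro bexI[of _ "minv K \<odot> M \<odot> K"]) simp_all
  next
    assume "\<exists>M\<in>lift H. M \<in> {M. K \<odot> M \<odot> minv K \<in> lift X}"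
    then obtain M where M: "M \<in> lift H" "K \<odot> M \<odot> minv K \<in> lift X" by blast
    have "minv K \<odot> (K \<odot> M \<odot> minv K) \<odot> K = M" using K by (simp add: mmul_assoc)
    then have "K \<odot> M \<odot> minv K \<in> lift (conj (mob K) H)" using M(1) liftc[OF H] by simp
    then show "conj (mob K) H \<inter> X \<noteq> {}" using M(2) unfolding lift_def by blast
  qed
  have "continuous_map chabauty (topology_generated_by ?S) (conj (mob K))"
  proof (rule continuous_on_generated_topo)
    fix U assume "U \<in> ?S"
    then consider X where "compactin Gtop X" "U = {H. H \<inter> X = {}}" | X where "openin Gtop X" "U = {H. H \<inter> X \<noteq> {}}" by blast
    then show "openin chabauty (conj (mob K) -` U \<inter> topspace chabauty)"
    proof cases
      case 1
      let ?C = "(\<lambda>M. minv K \<odot> M \<odot> K) ` lift X"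
      have "compact ?C"
        by (intro compact_continuous_image compact_lift[OF 1(1)] continuous_on_subset[OF continuous_conj]) auto
      moreover have "?C \<subseteq> unimod" using K by (auto simp: lift_def)
      ultimately have op: "openin chabauty {H \<in> SubG. \<forall>M\<in>lift H. M \<notin> ?C}" by (rule openin_chabauty_miss)
      have C: "?C = {M. K \<odot> M \<odot> minv K \<in> lift X}"
      proof (intro equalityI subsetI)
        fix M assume "M \<in> {M. K \<odot> M \<odot> minv K \<in> lift X}"
        moreover have "M = minv K \<odot> (K \<odot> M \<odot> minv K) \<odot> K" using K by (simp add: mmul_assoc)
        ultimately show "M \<in> ?C" by blast
      next
        fix M assume "M \<in> ?C"
        then obtain A where "A \<in> lift X" "M = minv K \<odot> A \<odot> K" by blast
        then show "M \<in> {M. K \<odot> M \<odot> minv K \<in> lift X}" using K by (simp add: mmul_assoc)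
      qed
      have "conj (mob K) -` U \<inter> topspace chabauty = {H \<in> SubG. \<not> conj (mob K) H \<inter> X \<noteq> {}}"
        unfolding topspace_chabauty 1(2) by auto
      also have "\<dots> = {H \<in> SubG. \<not> (\<exists>M\<in>lift H. M \<in> ?C)}"
        unfolding C by (intro Collect_cong conj_cong refl arg_cong[of _ _ Not] hit)
      finally have "conj (mob K) -` U \<inter> topspace chabauty = {H \<in> SubG. \<forall>M\<in>lift H. M \<notin> ?C}"
        by (simp only: bex_simps not_not Bex_def Ball_def not_ex de_Morgan_conj imp_conv_disj)
      then show ?thesis using op by simp
    next
      case 2
      obtain T where T: "open T" "X = T \<inter> isom" using 2(1) by (auto simp: Gtop_def openin_subtopology)
      have "openin (top_of_set unimod) (unimod \<inter> mob -` T)"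
        by (rule continuous_openin_preimage_gen[OF continuous_on_mob T(1)])
      then obtain V where V: "open V" "unimod \<inter> mob -` T = unimod \<inter> V" by (auto simp: openin_open)
      have lX: "lift X = unimod \<inter> V" unfolding V(2)[symmetric] using mob_isom by (auto simp: lift_def T(2))
      let ?W = "(\<lambda>M. K \<odot> M \<odot> minv K) -` V"
      have "open ?W" by (rule open_vimage[OF V(1) continuous_conj])
      then have op: "openin chabauty {H \<in> SubG. \<exists>M\<in>lift H. M \<in> ?W}" by (rule openin_chabauty_hit)
      have "(\<exists>M\<in>lift H. M \<in> {M. K \<odot> M \<odot> minv K \<in> lift X}) \<longleftrightarrow> (\<exists>M\<in>lift H. M \<in> ?W)" for H
        unfolding lX using K by (auto simp: lift_def)
      note W = this
      have "conj (mob K) -` U \<inter> topspace chabauty = {H \<in> SubG. conj (mob K) H \<inter> X \<noteq> {}}"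
        unfolding topspace_chabauty 2(2) by auto
      also have "\<dots> = {H \<in> SubG. \<exists>M\<in>lift H. M \<in> ?W}"
        by (intro Collect_cong conj_cong refl trans[OF hit W])
      finally have "conj (mob K) -` U \<inter> topspace chabauty = {H \<in> SubG. \<exists>M\<in>lift H. M \<in> ?W}" .
      then show ?thesis using op by simp
    qed
  next
    have "UNIV \<in> ?S" by (rule UnI1, rule CollectI) (intro exI[of _ "{}"], auto)
    then show "conj (mob K) ` topspace chabauty \<subseteq> \<Union>?S" by blast
  qed
  moreover have "conj (mob K) \<in> topspace chabauty \<rightarrow> SubG" using SubG_conj[OF K] by (auto simp: topspace_chabauty)
  ultimately have "continuous_map chabauty (subtopology (topology_generated_by ?S) SubG) (conj (mob K))"
    by (simp add: continuous_map_in_subtopology image_subset_iff_funcset)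
  then show ?thesis unfolding chabauty_def .
qed

lemma measurable_conj:
  assumes \<nu>: "prob_on_SubG \<nu>" and K: "K \<in> unimod"
  shows "conj (mob K) \<in> \<nu> \<rightarrow>\<^sub>M \<nu>"
proof (rule measurable_sigma_sets[OF sets_prob_on_SubG[OF \<nu>]])
  show "{U. openin chabauty U} \<subseteq> Pow SubG" using openin_subset[of chabauty] topspace_chabauty by auto
  show "conj (mob K) \<in> space \<nu> \<rightarrow> SubG" using SubG_conj[OF K] by (auto simp: space_prob_on_SubG[OF \<nu>])
  fix U assume "U \<in> {U. openin chabauty U}"
  then have "openin chabauty {x \<in> topspace chabauty. conj (mob K) x \<in> U}"
    using openin_continuous_map_preimage[OF continuous_map_conj[OF K]] by blast
  moreover have "{x \<in> topspace chabauty. conj (mob K) x \<in> U} = conj (mob K) -` U \<inter> space \<nu>"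
    by (auto simp: space_prob_on_SubG[OF \<nu>] topspace_chabauty)
  ultimately show "conj (mob K) -` U \<inter> space \<nu> \<in> sets \<nu>"
    unfolding sets_prob_on_SubG[OF \<nu>] by (intro sigma_sets.Basic) simp
qed

text \<open>The tile is open and contains the deep point itself, so mass can be spread uniformly
  over it.\<close>

lemma harea_tile_pos:
  assumes H: "H \<in> SubG" and z: "z \<in> H2" and dp: "deep k H z" "k \<ge> 0"
  shows "harea (tile H z) > 0"
proof -
  have zt: "z \<in> tile H z" using deep_imp_sim_refl[OF dp] z by (simp add: tile_def)
  have op: "open (tile H z)" by (rule open_tile[OF H z])
  have TB: "tile H z \<in> sets borel" using op by (rule borel_open)
  show ?thesis
  proof (rule ccontr)
    assume "\<not> ?thesis"
    then have "(\<integral>\<^sup>+w. ennreal (1 / (Im w)\<^sup>2) * indicator (tile H z) w \<partial>lborel) = 0"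
      using harea_eq_nn_integral[OF TB] by simp
    then have "AE w in lborel. ennreal (1 / (Im w)\<^sup>2) * indicator (tile H z) w = 0"
      using TB by (subst (asm) nn_integral_0_iff_AE) auto
    then have "AE w in lborel. w \<notin> tile H z"
      by eventually_elim (auto simp: tile_def H2_def split: split_indicator_asm)
    then have "tile H z \<in> null_sets lborel"
      using TB by (subst AE_iff_null_sets) auto
    then have "negligible (tile H z)"
      by (simp add: negligible_iff_null_sets null_sets_completionI)
    then show False using open_not_negligible[OF op] zt by blast
  qed
qed

text \<open>Mass transport: every deep point spreads unit mass uniformly over its tile. Since any two
  points are exchanged by an isometry, the expected mass sent from x to y equals the mass sent from
  y to x, so the probability of being deep is the expected proportion of deep points in a tile.\<close>
lemma deep_probability:
  assumes cox: "coxeter_polygon P S" and nu: "\<nu> \<in> mu_P S" and E: "E > 1"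
  shows "emeasure \<nu> {H \<in> SubG. deep (E - 1 / E) H \<i>} \<le> ennreal (1 / E)"
proof -
  define k where "k = E - 1 / E"
  have "1 / E < 1" using E by simp
  then have "1 / E < E" using E by linarith
  then have k: "k > 0" "k \<ge> 0" by (simp_all add: k_def)
  have pr: "prob_on_SubG \<nu>" and invar: "\<And>g. g \<in> isom \<Longrightarrow> distr \<nu> \<nu> (conj g) = \<nu>"
    and ae: "AE H in \<nu>. \<exists>g\<in>isom. H = conj g (Gamma S)"
    using nu by (auto simp: mu_P_def)
  have i: "\<i> \<in> H2" by (simp add: H2_def)
  interpret prob_space \<nu> using pr by (simp add: prob_on_SubG_def)
  interpret LN: pair_sigma_finite "lborel :: complex measure" \<nu> ..
  have sp: "space \<nu> = SubG" by (rule space_prob_on_SubG[OF pr])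
  have sets_eq: "sets (lborel \<Otimes>\<^sub>M \<nu>) = sets (borel \<Otimes>\<^sub>M \<nu>)" by (intro sets_pair_measure_cong) auto
  have space_eq: "space (lborel \<Otimes>\<^sub>M \<nu>) = UNIV \<times> SubG" "space (borel \<Otimes>\<^sub>M \<nu>) = UNIV \<times> SubG"
    by (simp_all add: space_pair_measure sp)
  define D where "D = {q \<in> space (borel \<Otimes>\<^sub>M \<nu>). fst q \<in> H2 \<and> deep k (snd q) (fst q)}"
  define T where "T = {q \<in> space (borel \<Otimes>\<^sub>M \<nu>). fst q \<in> tile (snd q) \<i>}"
  have D [measurable]: "D \<in> sets (lborel \<Otimes>\<^sub>M \<nu>)" unfolding sets_eq D_def by (rule deep_measurable[OF pr k(2)])
  have T [measurable]: "T \<in> sets (lborel \<Otimes>\<^sub>M \<nu>)" unfolding sets_eq T_def by (rule tile_measurable[OF pr i])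
  have D_iff: "(z, H) \<in> D \<longleftrightarrow> z \<in> H2 \<and> deep k H z" if "H \<in> SubG" for z H
    using that by (simp add: D_def space_eq)
  have T_iff: "(z, H) \<in> T \<longleftrightarrow> z \<in> tile H \<i>" if "H \<in> SubG" for z H
    using that by (simp add: T_def space_eq)
  define Di where "Di = {H \<in> SubG. deep k H \<i>}"
  have "Di = Pair \<i> -` D" using i by (auto simp: Di_def D_def space_eq)
  then have Di [measurable]: "Di \<in> sets \<nu>" using sets_Pair1[OF D, of \<i>] by simp
  let ?w = "\<lambda>z::complex. ennreal (1 / (Im z)\<^sup>2)"
  have w [measurable]: "?w \<in> borel_measurable lborel" by measurable
  define a where "a H = (\<integral>\<^sup>+z. ?w z * indicator T (z, H) \<partial>lborel)" for H
  have wT: "(\<lambda>q. ?w (fst q) * indicator T q) \<in> borel_measurable (lborel \<Otimes>\<^sub>M \<nu>)" by measurable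
  have a_meas [measurable]: "a \<in> borel_measurable \<nu>"
    unfolding a_def using measurable_pair_swap[OF wT]
    by (intro lborel.borel_measurable_nn_integral) (simp add: case_prod_beta')
  have tB: "tile H \<i> \<in> sets borel" if "H \<in> SubG" for H using open_tile[OF that i] by (rule borel_open)
  have a_eq: "a H = harea (tile H \<i>)" if "H \<in> SubG" for H
    unfolding a_def harea_eq_nn_integral[OF tB[OF that]]
    by (intro nn_integral_cong) (auto simp: T_iff[OF that] indicator_def)
  \<comment> \<open>As densities in \<open>z\<close>, \<open>F1\<close> is the mass that i sends to
    \<open>z\<close> and \<open>F2\<close> the mass that \<open>z\<close> sends to i. Both are
    normalised by \<open>a H\<close>, the area of the tile that the two points share.\<close>
  define F1 where "F1 z H = ?w z * indicator T (z, H) * (indicator Di H * inverse (a H))" for z H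
  define F2 where "F2 z H = ?w z * indicator T (z, H) * indicator D (z, H) * inverse (a H)" for z H
  have F1m: "(\<lambda>q. F1 (fst q) (snd q)) \<in> borel_measurable (lborel \<Otimes>\<^sub>M \<nu>)"
    unfolding F1_def prod.collapse by measurable
  have F2m: "(\<lambda>q. F2 (fst q) (snd q)) \<in> borel_measurable (lborel \<Otimes>\<^sub>M \<nu>)"
    unfolding F2_def prod.collapse by measurable
  have secT: "(\<lambda>z. ?w z * indicator T (z, H)) \<in> borel_measurable lborel" if "H \<in> SubG" for H
    using that unfolding sp[symmetric] by measurable
  have "emeasure \<nu> Di = (\<integral>\<^sup>+H. indicator Di H \<partial>\<nu>)" by simp
  also have "\<dots> = (\<integral>\<^sup>+H. (\<integral>\<^sup>+z. F1 z H \<partial>lborel) \<partial>\<nu>)"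
  proof (rule nn_integral_cong_AE)
    \<comment> \<open>A deep i sends out mass exactly 1: the area of its tile is positive, and it is
      finite because \<open>H\<close> is a conjugate of the polygon group.\<close>
    show "AE H in \<nu>. indicator Di H = (\<integral>\<^sup>+z. F1 z H \<partial>lborel)"
      using ae AE_space
    proof eventually_elim
      case (elim H)
      then obtain g where g: "g \<in> isom" "H = conj g (Gamma S)" and H: "H \<in> SubG" using sp by blast
      obtain K where K: "K \<in> unimod" "g = mob K" using isom_imp_mob[OF g(1)] by blast
      have "(\<integral>\<^sup>+z. F1 z H \<partial>lborel) = a H * (indicator Di H * inverse (a H))"
        unfolding F1_def a_def by (rule nn_integral_multc[OF secT[OF H]])
      also have "\<dots> = indicator Di H"
      proof (cases "H \<in> Di")
        case True
        then have dp: "deep k H \<i>" by (simp add: Di_def)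
        have "a H \<noteq> 0" using harea_tile_pos[OF H i dp k(2)] a_eq[OF H] by simp
        moreover have "a H \<noteq> top_class.top"
          using harea_tile_finite[OF cox H _ K(1) i k(1) dp] g(2) K(2) a_eq[OF H] by simp
        ultimately have "a H * inverse (a H) = 1" using ennreal_divide_self[of "a H"] by (simp add: divide_ennreal_def less_top[symmetric])
        then show ?thesis using True by simp
      qed simp
      finally show ?case by simp
    qed
  qed
  also have "\<dots> = (\<integral>\<^sup>+z. (\<integral>\<^sup>+H. F1 z H \<partial>\<nu>) \<partial>lborel)"
    using LN.Fubini'[of F1] F1m by (simp add: case_prod_beta')
  also have "\<dots> = (\<integral>\<^sup>+z. (\<integral>\<^sup>+H. F2 z H \<partial>\<nu>) \<partial>lborel)"
  proof (rule nn_integral_cong)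
    fix z :: complex
    show "(\<integral>\<^sup>+H. F1 z H \<partial>\<nu>) = (\<integral>\<^sup>+H. F2 z H \<partial>\<nu>)"
    proof (cases "z \<in> H2")
      case False
      then have "F1 z H = F2 z H" if "H \<in> SubG" for H
        using T_iff[OF that, of z] by (simp add: F1_def F2_def tile_def)
      then show ?thesis by (intro nn_integral_cong) (simp add: sp)
    next
      case z: True
      show ?thesis
      proof (cases "z = \<i>")
        case True
        have "F1 z H = F2 z H" if "H \<in> SubG" for H
          using D_iff[OF that, of z] i that unfolding True F1_def F2_def Di_def
          by (simp add: indicator_def mult.assoc)
        then show ?thesis by (intro nn_integral_cong) (simp add: sp)
      next
        case False
        \<comment> \<open>\<open>R\<close> exchanges i and \<open>z\<close>. Conjugating the random
          group by it preserves \<nu> and turns mass sent from i to \<open>z\<close> into mass sent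
          from \<open>z\<close> to i.\<close>
        obtain R where R: "refl_mat R" "mob R \<i> = z" "mob R z = \<i>"
          using bisector_reflection[OF i z] False by blast
        have Ru: "R \<in> unimod" using R(1) by simp
        have m: "conj (mob R) \<in> \<nu> \<rightarrow>\<^sub>M \<nu>" by (rule measurable_conj[OF pr Ru])
        have F1z: "F1 z \<in> borel_measurable \<nu>"
          using measurable_compose[OF measurable_Pair1'[of z lborel \<nu>] F1m] by simp
        have pt: "F1 z (conj (mob R) H) = F2 z H" if H: "H \<in> SubG" for H
        proof -
          have Hi: "H \<subseteq> isom" by (rule subgroup_isom[OF SubG_subgroup[OF H]])
          have cH: "conj (mob R) H \<in> SubG" by (rule SubG_conj[OF Ru H])
          have d: "deep k (conj (mob R) H) \<i> \<longleftrightarrow> deep k H z" using deep_conj[OF Ru Hi z] R(3) by simp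
          have t: "tile (conj (mob R) H) \<i> = mob R ` tile H z" using tile_conj[OF Ru Hi z] R(3) by simp
          have zt: "z \<in> tile (conj (mob R) H) \<i> \<longleftrightarrow> z \<in> tile H \<i>"
            using sim_conj[OF Ru Hi z i] R z i by (simp add: tile_def sim_sym[of H z])
          have ar: "a (conj (mob R) H) = a H" if "z \<in> tile H \<i>"
          proof -
            have "tile H z \<in> sets borel" using open_tile[OF H z] by (rule borel_open)
            then have "a (conj (mob R) H) = harea (tile H z)"
              unfolding a_eq[OF cH] t by (rule harea_mob(2)[OF Ru]) (auto simp: tile_def)
            moreover have "tile H z = tile H \<i>" using that tile_eq[of H \<i> z] by (simp add: tile_def)
            ultimately show ?thesis by (simp add: a_eq[OF H])
          qed
          show ?thesis
          proof (cases "z \<in> tile H \<i>")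
            case True
            then show ?thesis using d zt ar z cH H T_iff[OF cH, of z] T_iff[OF H, of z] D_iff[OF H, of z]
              by (simp add: F1_def F2_def Di_def indicator_def)
          next
            case False
            then show ?thesis using zt T_iff[OF cH, of z] T_iff[OF H, of z] by (simp add: F1_def F2_def)
          qed
        qed
        have "(\<integral>\<^sup>+H. F1 z H \<partial>\<nu>) = (\<integral>\<^sup>+H. F1 z H \<partial>distr \<nu> \<nu> (conj (mob R)))"
          using invar[OF mob_isom[OF Ru]] by simp
        also have "\<dots> = (\<integral>\<^sup>+H. F1 z (conj (mob R) H) \<partial>\<nu>)" using F1z by (intro nn_integral_distr[OF m]) simp
        also have "\<dots> = (\<integral>\<^sup>+H. F2 z H \<partial>\<nu>)" by (intro nn_integral_cong) (simp add: sp pt)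
        finally show ?thesis .
      qed
    qed
  qed
  also have "\<dots> = (\<integral>\<^sup>+H. (\<integral>\<^sup>+z. F2 z H \<partial>lborel) \<partial>\<nu>)"
    using LN.Fubini'[of F2] F2m by (simp add: case_prod_beta')
  also have "\<dots> \<le> (\<integral>\<^sup>+H. ennreal (1 / E) \<partial>\<nu>)"
  proof (rule nn_integral_mono)
    fix H assume "H \<in> space \<nu>"
    then have H: "H \<in> SubG" by (simp add: sp)
    let ?B = "{w \<in> tile H \<i>. deep k H w}"
    have m: "(\<lambda>z. ?w z * indicator T (z, H) * indicator D (z, H)) \<in> borel_measurable lborel"
      using H unfolding sp[symmetric] by measurable
    have "{z. (z, H) \<in> D} = (\<lambda>z. (z, H)) -` D" by auto
    then have "{z. (z, H) \<in> D} \<in> sets borel" using sets_Pair2[OF D, of H] by simp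
    moreover have "?B = tile H \<i> \<inter> {z. (z, H) \<in> D}" using D_iff[OF H] by (auto simp: tile_def)
    ultimately have BB: "?B \<in> sets borel" using tB[OF H] by simp
    have "(\<integral>\<^sup>+z. F2 z H \<partial>lborel) = (\<integral>\<^sup>+z. ?w z * indicator T (z, H) * indicator D (z, H) \<partial>lborel) * inverse (a H)"
      unfolding F2_def by (rule nn_integral_multc[OF m])
    also have "(\<integral>\<^sup>+z. ?w z * indicator T (z, H) * indicator D (z, H) \<partial>lborel) = harea ?B"
      unfolding harea_eq_nn_integral[OF BB]
      by (intro nn_integral_cong) (auto simp: indicator_def T_iff[OF H] D_iff[OF H] tile_def)
    also have "harea ?B * inverse (a H) \<le> (ennreal (1 / E) * a H) * inverse (a H)"
      using harea_deep_part[OF i _ tB[OF H], of E] E unfolding a_eq[OF H] k_def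
      by (intro mult_right_mono) auto
    also have "\<dots> = ennreal (1 / E) * (a H * inverse (a H))" by (simp add: mult.assoc)
    also have "\<dots> \<le> ennreal (1 / E) * 1"
    proof (rule mult_left_mono)
      \<comment> \<open>In \<open>ennreal\<close> the product of 0 or of infinity with its inverse
        is 0, so the bound covers empty tiles and tiles of infinite area.\<close>
      show "a H * inverse (a H) \<le> 1"
      proof (cases "a H = 0 \<or> a H = top_class.top")
        case True
        then show ?thesis by auto
      next
        case False
        then show ?thesis using ennreal_divide_self[of "a H"] by (simp add: divide_ennreal_def less_top[symmetric])
      qed
    qed simp
    finally show "(\<integral>\<^sup>+z. F2 z H \<partial>lborel) \<le> ennreal (1 / E)" by simp
  qed
  also have "\<dots> = ennreal (1 / E)" by (simp add: emeasure_space_1)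
  finally show ?thesis by (simp add: Di_def k_def)
qed

section \<open>Weak limits\<close>

text \<open>Two points determine the wall equation up to a factor, and the normalisation of the
  determinant leaves only a sign.\<close>

lemma reflection_unique:
  assumes R: "refl_mat R" "refl_mat R'" and pq: "p \<in> H2" "q \<in> H2" "p \<noteq> q"
    and w: "wall R p = 0" "wall R q = 0" "wall R' p = 0" "wall R' q = 0"
  shows "mob R = mob R'"
proof -
  obtain a b c d where Re: "R = (a, b, c, d)" by (cases R)
  obtain a' b' c' d' where Re': "R' = (a', b', c', d')" by (cases R')
  have d: "a = - d" "d * d + b * c = 1" "a' = - d'" "d' * d' + b' * c' = 1"
    using R by (auto simp: Re Re' refl_mat_iff)
  define x u y v where "x = Re p" "u = (Re p)\<^sup>2 + (Im p)\<^sup>2" "y = Re q" "v = (Re q)\<^sup>2 + (Im q)\<^sup>2"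
  have ip: "Im p > 0" "Im q > 0" using pq by (auto simp: H2_def)
  have w': "c * u + 2 * d * x = b" "c * v + 2 * d * y = b" "c' * u + 2 * d' * x = b'" "c' * v + 2 * d' * y = b'"
    using w ip by (simp_all add: Re Re' d x_u_y_v_def)
  have ne: "x \<noteq> y \<or> u \<noteq> v"
  proof (rule ccontr)
    assume "\<not> ?thesis"
    then have "Re p = Re q" "(Im p)\<^sup>2 = (Im q)\<^sup>2" by (simp_all add: x_u_y_v_def)
    then show False using ip pq(3) by (auto simp: complex_eq_iff power2_eq_iff)
  qed
  have "R = R' \<or> R = - R'"
  proof (cases "x = y")
    case True
    then have uv: "u \<noteq> v" using ne by simp
    have "c * (u - v) = 0" "c' * (u - v) = 0" using w' unfolding True right_diff_distrib by linarith+
    then have c: "c = 0" "c' = 0" using uv by simp_all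
    then have "d * d = 1" "d' * d' = 1" using d by simp_all
    then have "d = d' \<or> d = - d'" by algebra
    then show ?thesis using c w' d by (auto simp: Re Re')
  next
    case False
    define t where "t = (u - v) / (2 * (y - x))"
    define s where "s = u + 2 * t * x"
    have "2 * d * (y - x) = c * (u - v)" "2 * d' * (y - x) = c' * (u - v)" using w' by (simp_all add: algebra_simps)
    then have t: "d = c * t" "d' = c' * t" using False by (simp_all add: t_def field_simps)
    then have s: "b = c * s" "b' = c' * s" using w'(1,3) by (simp_all add: s_def algebra_simps)
    have "c * c * (t * t + s) = 1" "c' * c' * (t * t + s) = 1" using d(2,4) by (simp_all add: t s algebra_simps)
    then have "c * c * (t * t + s) = c' * c' * (t * t + s)" "t * t + s \<noteq> 0" by auto
    then have "c * c = c' * c'" by simp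
    then have "c = c' \<or> c = - c'" by algebra
    then show ?thesis using t s d by (auto simp: Re Re')
  qed
  then show ?thesis using mob_eq_iff[of R R'] R by simp
qed

text \<open>\<open>side_reflections\<close> collects every reflection that fixes some
  \<open>hp_boundary h\<close> pointwise. As a side has infinitely many points, two of them leave at
  most one reflection for each \<open>h\<close>.\<close>

lemma finite_side_reflections:
  assumes cox: "coxeter_polygon P S" shows "finite (side_reflections S)"
proof -
  define F where "F h = {r \<in> reflections. \<forall>z\<in>hp_boundary h. r z = z}" for h
  have "finite (F h)" if h: "h \<in> S" for h
  proof -
    have "infinite (P \<inter> hp_boundary h)" "P = H2 \<inter> \<Inter>S" using cox h unfolding coxeter_polygon_def by blast+
    then have inf: "infinite (H2 \<inter> hp_boundary h)" using finite_subset[of "P \<inter> hp_boundary h" "H2 \<inter> hp_boundary h"] by blast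
    then obtain p where p: "p \<in> H2 \<inter> hp_boundary h" using infinite_imp_nonempty by blast
    have "infinite (H2 \<inter> hp_boundary h - {p})" using inf by simp
    then obtain q where q: "q \<in> H2 \<inter> hp_boundary h" "p \<noteq> q" using infinite_imp_nonempty by blast
    have "r = r'" if r: "r \<in> F h" "r' \<in> F h" for r r'
    proof -
      obtain R where R: "refl_mat R" "r = mob R" using r(1) unfolding F_def reflections_eq by blast
      obtain R' where R': "refl_mat R'" "r' = mob R'" using r(2) unfolding F_def reflections_eq by blast
      have "mob R p = p" "mob R q = q" "mob R' p = p" "mob R' q = q"
        using r p q unfolding F_def R(2)[symmetric] R'(2)[symmetric] by blast+
      then show ?thesis unfolding R(2) R'(2)
        using reflection_unique[OF R(1) R'(1), of p q] p q mob_refl_fixes_iff[OF R(1)] mob_refl_fixes_iff[OF R'(1)] by blast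
    qed
    then have "\<exists>r. F h \<subseteq> {r}" by (cases "F h = {}") blast+
    then show ?thesis using finite_subset by blast
  qed
  moreover have "side_reflections S = (\<Union>h\<in>S. F h)" by (auto simp: side_reflections_def F_def)
  moreover have "finite S" using cox by (simp add: coxeter_polygon_def)
  ultimately show ?thesis by simp
qed

lemma countable_generate_reflections:
  assumes "countable Y" "Y \<subseteq> reflections" shows "countable (generate IsomG Y)"
proof -
  have app: "foldr (\<circ>) (l @ m) id = foldr (\<circ>) l id \<circ> foldr (\<circ>) m id" for l m :: "(complex \<Rightarrow> complex) list"
    by (induction l) (simp_all add: comp_assoc)
  have "f \<in> (\<lambda>l. foldr (\<circ>) l id) ` lists Y" if "f \<in> generate IsomG Y" for f
    using that
  proof (induction rule: generate.induct)
    case one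
    then show ?case by (intro image_eqI[of _ _ "[]"]) simp_all
  next
    case (incl h)
    then show ?case by (intro image_eqI[of _ _ "[h]"]) simp_all
  next
    case (inv h)
    then obtain R where R: "refl_mat R" "h = mob R" using assms(2) unfolding reflections_eq by blast
    have "inv\<^bsub>IsomG\<^esub> h = h" unfolding R(2)
      by (rule group.inv_equality[OF group_IsomG]) (use R(1) in \<open>auto simp: fun_eq_iff mob_isom\<close>)
    then show ?case using inv by (intro image_eqI[of _ _ "[h]"]) simp_all
  next
    case (eng h1 h2)
    then obtain l m where lm: "l \<in> lists Y" "h1 = foldr (\<circ>) l id" "m \<in> lists Y" "h2 = foldr (\<circ>) m id" by blast
    have "h1 \<otimes>\<^bsub>IsomG\<^esub> h2 = foldr (\<circ>) (l @ m) id" unfolding app lm by (simp only: IsomG_simps)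
    then show ?case by (rule image_eqI) (use lm in simp)
  qed
  then have "generate IsomG Y \<subseteq> (\<lambda>l. foldr (\<circ>) l id) ` lists Y" by blast
  then show ?thesis by (rule countable_subset) (intro countable_image countable_lists assms(1))
qed

lemma countable_lift:
  assumes "countable H" shows "countable (lift H)"
proof -
  have "countable {M \<in> unimod. mob M = f}" for f
  proof (cases "\<exists>A\<in>unimod. mob A = f")
    case True
    then obtain A where A: "A \<in> unimod" "mob A = f" by blast
    have "{M \<in> unimod. mob M = f} \<subseteq> {A, - A}"
      unfolding A(2)[symmetric] using mob_eq_iff[OF _ A(1)] by blast
    then show ?thesis by (rule countable_subset) simp
  next
    case False
    then have "{M \<in> unimod. mob M = f} = {}" by blast
    then show ?thesis by (simp only: countable_empty)
  qed
  moreover have "lift H = (\<Union>f\<in>H. {M \<in> unimod. mob M = f})" unfolding lift_def by blast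
  ultimately show ?thesis using assms by simp
qed

text \<open>What is retained of a polygon group for taking limits; it makes no reference to the
  polygon, which varies along the approximation.\<close>

definition coxeter_like :: "(complex \<Rightarrow> complex) set \<Rightarrow> bool" where
  "coxeter_like H \<longleftrightarrow> H \<in> SubG \<and> discrete_mats (lift H) \<and> lift H \<subseteq> refl_gen (lift H)"

lemma AE_coxeter_like:
  assumes "\<nu> \<in> coxeter_IRS" shows "AE H in \<nu>. coxeter_like H"
proof -
  obtain P S where cox: "coxeter_polygon P S" and nu: "\<nu> \<in> mu_P S" using assms by (auto simp: coxeter_IRS_def)
  have pr: "prob_on_SubG \<nu>" and ae: "AE H in \<nu>. \<exists>g\<in>isom. H = conj g (Gamma S)"
    using nu by (auto simp: mu_P_def)
  have G: "Gamma S \<subseteq> isom" by (rule subgroup_isom[OF subgroup_Gamma])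
  have cnt: "countable (Gamma S)" unfolding Gamma_def
    by (rule countable_generate_reflections[OF countable_finite[OF finite_side_reflections[OF cox]] side_reflections_subset])
  have gen: "lift (Gamma S) \<subseteq> refl_gen (lift (Gamma S))"
    unfolding Gamma_def by (rule generate_reflections_lift[OF side_reflections_subset])
  from ae AE_space show ?thesis
  proof eventually_elim
    case (elim H)
    then obtain g where g: "g \<in> isom" "H = conj g (Gamma S)" by blast
    have H: "H \<in> SubG" using elim(2) space_prob_on_SubG[OF pr] by simp
    obtain K where K: "K \<in> unimod" "g = mob K" using isom_imp_mob[OF g(1)] by blast
    have K': "minv K \<in> unimod" using K(1) by simp
    have "countable H" unfolding g(2) conj_def using cnt by simp
    then have "discrete_mats (lift H)"
      by (intro mat_group.countable_closed_imp_discrete SubG_mat_group SubG_closed_lift H countable_lift)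
    moreover have "lift H \<subseteq> refl_gen (lift H)"
      unfolding g(2) K(2) lift_conj[OF K(1) G] by (rule generated_cj[OF K' gen])
    ultimately show ?case using H by (simp add: coxeter_like_def)
  qed
qed

section \<open>From weak limits to convergent sequences of groups\<close>

lemma tendsto_infdist_dense:
  fixes G :: "nat \<Rightarrow> 'a::metric_space set"
  assumes dense: "\<And>x e. e > 0 \<Longrightarrow> \<exists>k. dist x (q k) < e"
    and lim: "\<And>k. (\<lambda>n. infdist (q k) (G n)) \<longlonglongrightarrow> infdist (q k) H"
  shows "(\<lambda>n. infdist x (G n)) \<longlonglongrightarrow> infdist x H"
proof (rule LIMSEQ_I)
  fix r :: real assume r: "r > 0"
  obtain k where k: "dist x (q k) < r / 3" using dense[of "r / 3" x] r by auto
  obtain N where N: "\<And>n. n \<ge> N \<Longrightarrow> norm (infdist (q k) (G n) - infdist (q k) H) < r / 3"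
    using LIMSEQ_D[OF lim[of k], of "r / 3"] r by auto
  have "norm (infdist x (G n) - infdist x H) < r" if "n \<ge> N" for n
    using N[OF that] k infdist_triangle[of x "G n" "q k"] infdist_triangle[of "q k" "G n" x]
      infdist_triangle[of x H "q k"] infdist_triangle[of "q k" H x]
    unfolding real_norm_def dist_commute[of "q k" x] by linarith
  then show "\<exists>N. \<forall>n\<ge>N. norm (infdist x (G n) - infdist x H) < r" by blast
qed

text \<open>An element of \<open>H\<close> is the limit of nearest points in the approximating sets,
  and a limit of elements of these sets has distance 0 from the closed set \<open>H\<close>.\<close>

lemma mconv_if_infdist:
  assumes lim: "\<And>x. (\<lambda>n. infdist x (G n)) \<longlonglongrightarrow> infdist x H"
    and G: "\<And>n. closed (G n)" "\<And>n. G n \<noteq> {}" and H: "closed H" "H \<noteq> {}"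
  shows "mconv G H"
  unfolding mconv_def
proof (intro conjI ballI allI impI)
  fix M assume M: "M \<in> H"
  have "\<forall>n. \<exists>m. m \<in> G n \<and> infdist M (G n) = dist M m"
    using infdist_attains_inf[OF G] by blast
  then obtain m where m: "\<And>n. m n \<in> G n" "\<And>n. infdist M (G n) = dist M (m n)" by metis
  have "(\<lambda>n. dist M (m n)) \<longlonglongrightarrow> 0" using lim[of M] M by (simp add: m(2))
  then have "m \<longlonglongrightarrow> M" unfolding tendsto_dist_iff[of m] by (simp add: dist_commute)
  then show "\<exists>m. (\<forall>n. m n \<in> G n) \<and> m \<longlonglongrightarrow> M" using m(1) by blast
next
  fix r m M assume a: "strict_mono r \<and> (\<forall>k. m k \<in> G (r k)) \<and> m \<longlonglongrightarrow> M"
  have "(\<lambda>k. infdist M (G (r k))) \<longlonglongrightarrow> infdist M H"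
    using LIMSEQ_subseq_LIMSEQ[OF lim[of M], of r] a by (simp add: comp_def)
  moreover have "(\<lambda>k. dist M (m k)) \<longlonglongrightarrow> 0"
    using a unfolding tendsto_dist_iff[of m] by (simp add: dist_commute)
  moreover have "infdist M (G (r k)) \<le> dist M (m k)" for k using a by (intro infdist_le) blast
  ultimately have "infdist M H \<le> 0" by (intro LIMSEQ_le) auto
  then have "infdist M H = 0" using infdist_nonneg[of M H] by linarith
  then show "M \<in> H" using in_closed_iff_infdist_zero[OF H] by blast
qed

lemma continuous_chabauty_measurable:
  assumes \<nu>: "prob_on_SubG \<nu>" and f: "continuous_map chabauty euclideanreal f"
  shows "f \<in> borel_measurable \<nu>"
proof (rule borel_measurableI)
  fix U :: "real set" assume "open U"
  then have "openin chabauty {x \<in> topspace chabauty. f x \<in> U}"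
    using openin_continuous_map_preimage[OF f] by simp
  moreover have "{x \<in> topspace chabauty. f x \<in> U} = f -` U \<inter> space \<nu>"
    by (auto simp: space_prob_on_SubG[OF \<nu>] topspace_chabauty)
  ultimately show "f -` U \<inter> space \<nu> \<in> sets \<nu>"
    unfolding sets_prob_on_SubG[OF \<nu>] by (intro sigma_sets.Basic) simp
qed

lemma continuous_chabauty_integrable:
  assumes \<nu>: "prob_on_SubG \<nu>" and f: "continuous_map chabauty euclideanreal f" "bounded (f ` SubG)"
  shows "integrable \<nu> f"
proof -
  interpret prob_space \<nu> using \<nu> by (simp add: prob_on_SubG_def)
  obtain B where "\<And>H. H \<in> SubG \<Longrightarrow> norm (f H) \<le> B" using f(2) by (auto simp: bounded_iff)
  then show ?thesis
    by (intro integrable_const_bound[of _ B] AE_I2 continuous_chabauty_measurable[OF \<nu> f(1)])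
       (simp add: space_prob_on_SubG[OF \<nu>])
qed

lemma prob_coxeter_IRS: "\<nu> \<in> coxeter_IRS \<Longrightarrow> prob_on_SubG \<nu>"
  by (auto simp: coxeter_IRS_def mu_P_def)

lemma weak_closure_integral_le:
  assumes \<mu>: "\<mu> \<in> weak_closure M" and f: "continuous_map chabauty euclideanreal f" "bounded (f ` SubG)"
    and le: "\<And>\<nu>. \<nu> \<in> M \<Longrightarrow> (\<integral>H. f H \<partial>\<nu>) \<le> C"
  shows "(\<integral>H. f H \<partial>\<mu>) \<le> C"
proof (rule field_le_epsilon)
  fix e :: real assume "e > 0"
  then obtain \<nu> where "\<nu> \<in> M" "\<bar>(\<integral>H. f H \<partial>\<mu>) - (\<integral>H. f H \<partial>\<nu>)\<bar> < e"
    using \<mu> f unfolding weak_closure_def by (auto dest!: spec[of _ "{f}"])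
  then show "(\<integral>H. f H \<partial>\<mu>) \<le> C + e" using le[of \<nu>] by linarith
qed

text \<open>The way in which a statement about supports passes to the weak closure: the integral of
  \<open>f\<close> is 0 for every approximating measure, hence for the limit, and \<open>f\<close>
  is nonnegative.\<close>

lemma AE_zero_if_zero_on_coxeter_like:
  assumes \<mu>: "\<mu> \<in> weak_closure coxeter_IRS" and f: "continuous_map chabauty euclideanreal f" "bounded (f ` SubG)"
    and nn: "\<And>H. f H \<ge> 0" and z: "\<And>H. coxeter_like H \<Longrightarrow> f H = 0"
  shows "AE H in \<mu>. f H = 0"
proof -
  have pr: "prob_on_SubG \<mu>" using \<mu> by (simp add: weak_closure_def)
  have "(\<integral>H. f H \<partial>\<mu>) \<le> 0"
  proof (rule weak_closure_integral_le[OF \<mu> f])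
    fix \<nu> assume "\<nu> \<in> coxeter_IRS"
    from AE_coxeter_like[OF this] have "AE H in \<nu>. f H = 0" by eventually_elim (rule z)
    then show "(\<integral>H. f H \<partial>\<nu>) \<le> 0" using integral_eq_zero_AE[of f \<nu>] by simp
  qed
  moreover have "(\<integral>H. f H \<partial>\<mu>) \<ge> 0" using nn by simp
  ultimately have "(\<integral>H. f H \<partial>\<mu>) = 0" by linarith
  then show ?thesis
    using integral_nonneg_eq_0_iff_AE[OF continuous_chabauty_integrable[OF pr f]] nn by simp
qed

text \<open>Weak approximation of measures does not directly yield groups converging to a given
  \<open>H\<close>. The functions \<open>f c n\<close> form a countable family of bumps, positive
  where the first distances from a dense sequence are close to the rational values in
  \<open>c\<close>. Almost every \<open>H\<close> lies in no bump that vanishes on all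
  \<open>coxeter_like\<close> groups. So each bump around such an \<open>H\<close> contains one of
  these groups, and shrinking bumps give a sequence converging to \<open>H\<close>.\<close>

lemma AE_reflection_generated:
  assumes \<mu>: "\<mu> \<in> weak_closure coxeter_IRS"
  shows "AE H in \<mu>. H = generate IsomG (H \<inter> reflections)"
proof -
  have pr: "prob_on_SubG \<mu>" using \<mu> by (simp add: weak_closure_def)
  obtain D :: "mat2 set" where D: "countable D" "\<And>X. open X \<Longrightarrow> X \<noteq> {} \<Longrightarrow> \<exists>d\<in>D. d \<in> X"
    using countable_dense_setE by blast
  have "D \<noteq> {}" using D(2)[of UNIV] by blast
  define q where "q = from_nat_into D"
  have q: "\<exists>k. dist x (q k) < e" if "e > 0" for x e
  proof -
    have "ball x e \<noteq> {}" using that by simp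
    from D(2)[OF open_ball this] obtain d where d: "d \<in> D" "d \<in> ball x e" ..
    obtain k where "q k = d" using from_nat_into_surj[OF D(1) d(1)] unfolding q_def by blast
    then show ?thesis using d(2) by (intro exI[of _ k]) simp
  qed
  define s where "s k H = setdist {q k} (lift H)" for k H
  have s_eq: "s k H = infdist (q k) (lift H)" for k H by (simp add: s_def infdist_eq_setdist)
  have cs: "continuous_map chabauty euclideanreal (s k)" for k
    unfolding s_def by (rule continuous_map_setdist_lift) simp_all
  define f where "f c n H = max 0 (1 / real (Suc n) - (\<Sum>k<length c. \<bar>s k H - real_of_rat (c ! k)\<bar>))" for c n H
  have cf: "continuous_map chabauty euclideanreal (f c n)" for c n
    unfolding f_def by (intro continuous_intros cs) auto
  have f_nn: "f c n H \<ge> 0" for c n H by (simp add: f_def)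
  have f_le: "f c n H \<le> 1" for c n H
  proof -
    have "(\<Sum>k<length c. \<bar>s k H - real_of_rat (c ! k)\<bar>) \<ge> 0" by (intro sum_nonneg) simp
    moreover have "1 / real (Suc n) \<le> 1" by simp
    ultimately show ?thesis unfolding f_def by linarith
  qed
  have bf: "bounded (f c n ` SubG)" for c n
    unfolding bounded_iff using f_nn f_le by (intro exI[of _ 1]) auto
  have "AE H in \<mu>. \<forall>c n. (\<forall>\<Gamma>. coxeter_like \<Gamma> \<longrightarrow> f c n \<Gamma> = 0) \<longrightarrow> f c n H = 0"
    unfolding AE_all_countable
  proof (intro allI)
    fix c n
    show "AE H in \<mu>. (\<forall>\<Gamma>. coxeter_like \<Gamma> \<longrightarrow> f c n \<Gamma> = 0) \<longrightarrow> f c n H = 0"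
    proof (cases "\<forall>\<Gamma>. coxeter_like \<Gamma> \<longrightarrow> f c n \<Gamma> = 0")
      case True
      then have "AE H in \<mu>. f c n H = 0"
        using AE_zero_if_zero_on_coxeter_like[OF \<mu> cf bf f_nn] by blast
      then show ?thesis by eventually_elim simp
    next
      case False
      then show ?thesis by (intro AE_I2) blast
    qed
  qed
  then show ?thesis using AE_space
  proof eventually_elim
    case (elim H)
    then have H: "H \<in> SubG" using space_prob_on_SubG[OF pr] by simp
    have "\<exists>\<Gamma>. coxeter_like \<Gamma> \<and> (\<forall>k<n. \<bar>s k \<Gamma> - s k H\<bar> < 2 / real (Suc n))" for n
    proof -
      \<comment> \<open>\<open>n\<close> errors below \<delta> add up to less than the width 1 / (n
        + 1) of the bump, and \<delta> itself is at most this width.\<close>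
      define \<delta> where "\<delta> = 1 / (real (Suc n) * real (Suc n))"
      have "\<delta> > 0" by (simp add: \<delta>_def)
      have "\<exists>r. \<bar>s k H - real_of_rat r\<bar> < \<delta>" for k
      proof -
        obtain r where "s k H < real_of_rat r" "real_of_rat r < s k H + \<delta>"
          using of_rat_dense[of "s k H" "s k H + \<delta>"] \<open>\<delta> > 0\<close> by auto
        then show ?thesis by (intro exI[of _ r]) linarith
      qed
      then obtain r where r: "\<And>k. \<bar>s k H - real_of_rat (r k)\<bar> < \<delta>" by metis
      define c where "c = map r [0..<n]"
      have c: "length c = n" "\<And>k. k < n \<Longrightarrow> c ! k = r k" by (simp_all add: c_def)
      have "(\<Sum>k<length c. \<bar>s k H - real_of_rat (c ! k)\<bar>) \<le> (\<Sum>k<n. \<delta>)"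
        unfolding c(1) using r c(2) by (intro sum_mono) (simp add: less_imp_le)
      also have "\<dots> = real n * \<delta>" by simp
      also have "\<dots> < real (Suc n) * \<delta>" using \<open>\<delta> > 0\<close> by simp
      also have "\<dots> = 1 / real (Suc n)" by (simp add: \<delta>_def)
      finally have "(\<Sum>k<length c. \<bar>s k H - real_of_rat (c ! k)\<bar>) < 1 / real (Suc n)" .
      then have "f c n H \<noteq> 0" unfolding f_def by linarith
      then obtain \<Gamma> where \<Gamma>: "coxeter_like \<Gamma>" "f c n \<Gamma> \<noteq> 0" using elim(1) by blast
      have sum: "(\<Sum>k<length c. \<bar>s k \<Gamma> - real_of_rat (c ! k)\<bar>) < 1 / real (Suc n)"
        using \<Gamma>(2) unfolding f_def by linarith
      have "\<bar>s k \<Gamma> - s k H\<bar> < 2 / real (Suc n)" if "k < n" for k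
      proof -
        have "\<bar>s k \<Gamma> - real_of_rat (c ! k)\<bar> \<le> (\<Sum>k<length c. \<bar>s k \<Gamma> - real_of_rat (c ! k)\<bar>)"
          using that c(1) by (intro member_le_sum) auto
        moreover have "\<bar>s k H - real_of_rat (c ! k)\<bar> < \<delta>" using r[of k] c(2)[OF that] by simp
        moreover have "1 * real (Suc n) \<le> real (Suc n) * real (Suc n)" by (intro mult_right_mono) simp_all
        then have "\<delta> \<le> 1 / real (Suc n)" unfolding \<delta>_def by (intro frac_le) simp_all
        ultimately show ?thesis using sum by linarith
      qed
      then show ?thesis using \<Gamma>(1) by blast
    qed
    then obtain \<Gamma> where \<Gamma>: "\<And>n. coxeter_like (\<Gamma> n)"
      "\<And>n k. k < n \<Longrightarrow> \<bar>s k (\<Gamma> n) - s k H\<bar> < 2 / real (Suc n)" by metis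
    have \<Gamma>S: "\<Gamma> n \<in> SubG" for n using \<Gamma>(1) by (simp add: coxeter_like_def)
    have lim: "(\<lambda>n. infdist (q k) (lift (\<Gamma> n))) \<longlonglongrightarrow> infdist (q k) (lift H)" for k
      unfolding s_eq[symmetric]
    proof (rule LIM_zero_cancel, rule Lim_null_comparison)
      show "\<forall>\<^sub>F n in sequentially. norm (s k (\<Gamma> n) - s k H) \<le> 2 / real (Suc n)"
        using eventually_gt_at_top[of k] by eventually_elim (use \<Gamma>(2) in \<open>simp add: less_imp_le\<close>)
      show "(\<lambda>n. 2 / real (Suc n)) \<longlonglongrightarrow> 0"
        using tendsto_mult_right_zero[OF LIMSEQ_inverse_real_of_nat, of 2] by (simp add: divide_inverse)
    qed
    have ne: "lift H' \<noteq> {}" if "H' \<in> SubG" for H' using mone_in_lift[OF that] by blast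
    have "mconv (\<lambda>n. lift (\<Gamma> n)) (lift H)"
      by (intro mconv_if_infdist tendsto_infdist_dense[OF q lim] SubG_closed_lift ne \<Gamma>S H)
    then have "lift H \<subseteq> refl_gen (lift H)"
      by (rule limit_refl_generated)
         (use \<Gamma>(1) SubG_mat_group[OF H] in \<open>simp_all add: coxeter_like_def\<close>)
    then show ?case by (rule refl_gen_lift_imp_generate[OF SubG_subgroup[OF H]])
  qed
qed

text \<open>For E > 1, \<open>D E\<close> is a continuous function on closed subgroups that is
  positive exactly when no mirror of \<open>H\<close> comes within ln E of i. The bound 1/E for this
  open condition passes to weak limits, and a group without reflections satisfies the condition for
  all \<open>E\<close>.\<close>

lemma AE_contains_reflection:
  assumes \<mu>: "\<mu> \<in> weak_closure coxeter_IRS"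
  shows "AE H in \<mu>. H \<inter> reflections \<noteq> {}"
proof -
  have pr: "prob_on_SubG \<mu>" using \<mu> by (simp add: weak_closure_def)
  interpret prob_space \<mu> using pr by (simp add: prob_on_SubG_def)
  define K where "K E = {R. refl_mat R \<and> \<bar>wall R \<i>\<bar> \<le> E - 1 / E}" for E
  define D where "D E H = setdist (K E) (lift H)" for E H
  have wall_i: "wall R \<i> = fst (snd (snd R)) - fst (snd R)" for R by (cases R) simp
  have K: "compact (K E)" for E
  proof -
    have "bounded {R. refl_mat R \<and> (\<exists>z\<in>{\<i>}. \<bar>wall R z\<bar> \<le> E - 1 / E)}"
      by (rule bounded_walls_near) (simp_all add: H2_def)
    then have "bounded (K E)" by (simp add: K_def)
    moreover have "K E = {R. refl_mat R} \<inter> {R. \<bar>fst (snd (snd R)) - fst (snd R)\<bar> \<le> E - 1 / E}"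
      unfolding K_def wall_i by blast
    then have "closed (K E)" by (auto intro!: closed_Int closed_refl_mats closed_Collect_le continuous_intros)
    ultimately show ?thesis by (simp add: compact_eq_bounded_closed)
  qed
  have Kne: "K E \<noteq> {}" if "E > 1" for E
  proof -
    have "1 / E < 1" using that by simp
    then have "E - 1 / E \<ge> 0" using that by linarith
    \<comment> \<open>The reflection in the imaginary axis, whose mirror passes through i.\<close>
    then have "(1, 0, 0, - 1) \<in> K E" by (simp add: K_def refl_mat_def)
    then show ?thesis by blast
  qed
  have D_pos: "D E H > 0 \<longleftrightarrow> deep (E - 1 / E) H \<i>" if H: "H \<in> SubG" and E: "E > 1" for E H
  proof -
    have "D E H = 0 \<longleftrightarrow> K E \<inter> lift H \<noteq> {}"
      unfolding D_def using Kne[OF E] mone_in_lift[OF H] K SubG_closed_lift[OF H] setdist_eq_0_compact_closed by blast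
    moreover have "D E H \<ge> 0" by (simp add: D_def)
    moreover have "K E \<inter> lift H = {} \<longleftrightarrow> deep (E - 1 / E) H \<i>"
      unfolding K_def deep_def not_le[symmetric] by blast
    ultimately show ?thesis by linarith
  qed
  have cD: "continuous_map chabauty euclideanreal (D E)" if "E > 1" for E
    unfolding D_def by (rule continuous_map_setdist_lift[OF K Kne[OF that]])
  have prob_D: "measure \<mu> {H \<in> space \<mu>. D E H > 0} \<le> 1 / E" if E: "E > 1" for E
  proof -
    \<comment> \<open>Bounded continuous functions increasing to the indicator of the open set where
      \<open>D E\<close> is positive, as in the portmanteau theorem.\<close>
    define f where "f m H = min 1 (real m * D E H)" for m H
    have f: "0 \<le> f m H" "f m H \<le> 1" for m H by (simp_all add: f_def D_def)
    have cf: "continuous_map chabauty euclideanreal (f m)" for m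
      unfolding f_def by (intro continuous_intros cD[OF E]) auto
    have bf: "bounded (f m ` SubG)" for m
      unfolding bounded_iff using f by (intro exI[of _ 1]) auto
    have le: "(\<integral>H. f m H \<partial>\<mu>) \<le> 1 / E" for m
    proof (rule weak_closure_integral_le[OF \<mu> cf bf])
      fix \<nu> assume \<nu>: "\<nu> \<in> coxeter_IRS"
      then obtain P S where cox: "coxeter_polygon P S" and nu: "\<nu> \<in> mu_P S" by (auto simp: coxeter_IRS_def)
      note p = prob_coxeter_IRS[OF \<nu>]
      interpret N: prob_space \<nu> using p by (simp add: prob_on_SubG_def)
      let ?A = "{H \<in> space \<nu>. D E H > 0}"
      have [measurable]: "D E \<in> borel_measurable \<nu>" by (rule continuous_chabauty_measurable[OF p cD[OF E]])
      have A: "?A \<in> sets \<nu>" by measurable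
      have Aeq: "?A = {H \<in> SubG. deep (E - 1 / E) H \<i>}" using D_pos[OF _ E] by (auto simp: space_prob_on_SubG[OF p])
      have "f m H \<le> indicator ?A H" if "H \<in> space \<nu>" for H
      proof (cases "D E H > 0")
        case True
        then show ?thesis using f(2)[of m H] that by simp
      next
        case False
        then have "D E H = 0" using setdist_pos_le[of "K E" "lift H"] unfolding D_def by linarith
        then show ?thesis by (simp add: f_def)
      qed
      then have "(\<integral>H. f m H \<partial>\<nu>) \<le> (\<integral>H. indicator ?A H \<partial>\<nu>)"
        using A by (intro integral_mono continuous_chabauty_integrable[OF p cf bf]) (simp_all add: N.emeasure_eq_measure)
      also have "\<dots> = measure \<nu> ?A" using A by simp
      also have "\<dots> \<le> 1 / E"
        using deep_probability[OF cox nu E] E unfolding Aeq N.emeasure_eq_measure by (simp add: ennreal_le_iff)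
      finally show "(\<integral>H. f m H \<partial>\<nu>) \<le> 1 / E" .
    qed
    let ?A = "{H \<in> space \<mu>. D E H > 0}"
    have Dm [measurable]: "D E \<in> borel_measurable \<mu>" by (rule continuous_chabauty_measurable[OF pr cD[OF E]])
    have A: "?A \<in> sets \<mu>" by measurable
    have "(\<lambda>m. \<integral>H. f m H \<partial>\<mu>) \<longlonglongrightarrow> (\<integral>H. indicator ?A H \<partial>\<mu>)"
    proof (rule integral_dominated_convergence[where w = "\<lambda>_. 1"])
      show "AE H in \<mu>. (\<lambda>m. f m H) \<longlonglongrightarrow> indicator ?A H"
      proof (rule AE_I2)
        fix H assume H: "H \<in> space \<mu>"
        show "(\<lambda>m. f m H) \<longlonglongrightarrow> indicator ?A H"
        proof (cases "D E H > 0")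
          case True
          obtain N where N: "1 / D E H < real N" using reals_Archimedean2 by blast
          have "f m H = 1" if "m \<ge> N" for m
          proof -
            have "1 / D E H \<le> real m" using N that by linarith
            then have "1 \<le> real m * D E H" using True by (simp add: field_simps)
            then show ?thesis by (simp add: f_def)
          qed
          then have "\<forall>\<^sub>F m in sequentially. f m H = 1" using eventually_sequentially by blast
          then show ?thesis using True H by (simp add: tendsto_eventually)
        next
          case False
          then have "D E H = 0" using setdist_pos_le[of "K E" "lift H"] unfolding D_def by linarith
          then show ?thesis by (simp add: f_def)
        qed
      qed
      show "f m \<in> borel_measurable \<mu>" for m by (rule continuous_chabauty_measurable[OF pr cf])
      show "AE H in \<mu>. norm (f m H) \<le> 1" for m using f by simp
    qed (use A in simp_all)
    then have "(\<integral>H. indicator ?A H \<partial>\<mu>) \<le> 1 / E" by (rule LIMSEQ_le_const2) (use le in blast)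
    then show ?thesis using A by simp
  qed
  \<comment> \<open>The shift by 2 keeps the parameter above 1 for every \<open>n\<close>.\<close>
  define N where "N = {H \<in> space \<mu>. \<forall>n. D (real n + 2) H > 0}"
  have [measurable]: "D (real n + 2) \<in> borel_measurable \<mu>" for n
    by (rule continuous_chabauty_measurable[OF pr cD]) simp
  have N: "N \<in> sets \<mu>" unfolding N_def by measurable
  have "measure \<mu> N \<le> 1 / (real n + 2)" for n
  proof -
    have "{H \<in> space \<mu>. D (real n + 2) H > 0} \<in> sets \<mu>" by measurable
    then have "measure \<mu> N \<le> measure \<mu> {H \<in> space \<mu>. D (real n + 2) H > 0}"
      by (intro finite_measure_mono) (auto simp: N_def)
    then show ?thesis using prob_D[of "real n + 2"] by simp
  qed
  moreover have "(\<lambda>n. 1 / (real n + 2)) \<longlonglongrightarrow> 0" by real_asymp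
  ultimately have "measure \<mu> N \<le> 0" by (intro LIMSEQ_le_const) auto
  then have "measure \<mu> N = 0" using measure_nonneg[of \<mu> N] by linarith
  then have null: "N \<in> null_sets \<mu>" using N by (simp add: null_sets_def emeasure_eq_measure)
  show ?thesis
  proof (rule AE_I'[OF null], intro subsetI)
    fix H assume "H \<in> {H \<in> space \<mu>. \<not> H \<inter> reflections \<noteq> {}}"
    then have H: "H \<in> space \<mu>" "H \<in> SubG" "H \<inter> reflections = {}" using space_prob_on_SubG[OF pr] by auto
    have "\<not> refl_mat R" if "R \<in> lift H" for R
      using that H(3) unfolding lift_def reflections_eq by blast
    then have "deep k H \<i>" for k unfolding deep_def by blast
    then show "H \<in> N" using H D_pos[OF H(2)] by (simp add: N_def)
  qed
qed

theorem theorem4: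
  fixes \<mu> :: "(complex \<Rightarrow> complex) set measure"
  assumes "prob_on_SubG \<mu>"
    and "\<mu> \<in> weak_closure coxeter_IRS"
  shows "AE H in \<mu>. H \<noteq> {id} \<and> H = generate IsomG (H \<inter> reflections)"
  using AE_contains_reflection[OF assms(2)] AE_reflection_generated[OF assms(2)]
proof eventually_elim
  case (elim H)
  have "id \<notin> reflections" by (simp add: reflections_def)
  then show ?case using elim by blast
qed

end
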